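(* Let $\mathcal{D}:=\{(z,t)\in\mathbb{C}^2:\ t=|t|e^{i\theta}\ne0,\ e^{-i\theta/2}z\in\mathcal{D}_{|t|}(\tilde P)\}$, where $\tilde P(w)=P(e^{i\theta/2}w)$. 1. The logarithmic potential $U_t(z)=\int_{\mathbb{C}}\log|z-\xi|\,d\mu_t(\xi)$ satisfies the Hamilton–Jacobi PDE $$\partial_tU_t(z)=-(\partial_zU_t(z))^2,\qquad (z,t)\in\mathcal{D},$$ where $\partial_t$ is the Wirtinger derivative with respect to $t\in\mathbb{C}$. 2. The Stieltjes transform $m_t(z)=\int_{\mathbb{C}}\frac{\mu_t(dy)}{z-y}$ satisfies the PDEs $$\partial_tm_t(z)=-\tfrac12\partial_z(m_t^2(z))=-m_t(z)\,\partial_zm_t(z),\qquad (z,t)\in\mathcal{D},$$ $$\partial_{\bar t}m_t(z)=-\tfrac12\partial_z\overline{(m_t^2(z))}=-\overline{m_t(z)}\,\partial_z\overline{m_t(z)},\qquad (z,t)\in\mathcal{D}.$$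
   Context: $d\in\mathbb{N}$, $\lambda_1,\dots,\lambda_d\in\mathbb{C}$ are distinct, $\alpha_1,\dots,\alpha_d\in\mathbb{N}=\{1,2,\dots\}$, $\alpha=\sum_j\alpha_j$, $P(z)=\prod_{j=1}^d(z-\lambda_j)^{\alpha_j}$, $P^n$ is the $n$-th power of $P$, and for $t\in\mathbb{C}$, $P_t^n=e^{-\frac{t}{2\alpha n}\partial_z^2}P^n=\sum_{k\ge0}\frac{1}{k!}(-\frac{t}{2\alpha n})^k\partial_z^{2k}P^n$. For $t\in\mathbb{C}$, $\mu_t$ is the weak limit as $n\to\infty$ of $\mu_{n,t}=\frac1{\alpha n}\sum_{\lambda:P_t^n(\lambda)=0}\delta_\lambda$ (zeros counted with multiplicity); this limit exists and is a compactly supported probability measure on $\mathbb{C}$. Wirtinger derivatives: $\partial_z=\frac12(\partial_x-i\partial_y)$, $\partial_{\bar z}=\frac12(\partial_x+i\partial_y)$ for $z=x+iy$, and analogously $\partial_t,\partial_{\bar t}$ for complex $t$. Sets $\mathcal{D}_s$. For a polynomial $R$ with distinct zeros $\nu_1,\dots,\nu_d$ of multiplicities $\alpha_1,\dots,\alpha_d$ and $s>0$, let $G^R(z,u)=\frac1\alpha\sum_j\alpha_j\log|u-\nu_j|+\operatorname{Re}\frac{(z-u)^2}{2s}$, and let $Q(u)=\frac s\alpha\sum_j\alpha_j\prod_{k\ne j}(u-\nu_k)-(z-u)\prod_j(u-\nu_j)$, a polynomial of degree $d+1$ in $u$ whose roots are the solutions of $u+\frac s\alpha\sum_j\frac{\alpha_j}{u-\nu_j}=z$.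 Then $\mathcal{D}_s(R)$ is the set of all $z\in\mathbb{C}$ such that $Q$ has $d+1$ distinct roots and $G^R(z,\cdot)$ takes pairwise different values at these $d+1$ roots. The polynomial $\tilde P(w)=P(e^{i\theta/2}w)$ has zeros $e^{-i\theta/2}\lambda_j$ of multiplicity $\alpha_j$; the condition defining $\mathcal{D}$ does not depend on the choice of the argument $\theta$ of $t$. *)

theory Defs
  imports
    "HOL-Analysis.Analysis"
    "HOL-Probability.Probability"
    "HOL-Computational_Algebra.Computational_Algebra"
begin

text \<open>
  The Wirtinger derivatives \<open>(\<partial>\<^sub>x - \<i>\<partial>\<^sub>y)/2\<close> and \<open>(\<partial>\<^sub>x + \<i>\<partial>\<^sub>y)/2\<close>. As usual in HOL these
  are meaningful only where the two real partial derivatives exist, so statements using them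
  assert real differentiability separately.
\<close>

definition partial_x :: "(complex \<Rightarrow> complex) \<Rightarrow> complex \<Rightarrow> complex" where
  "partial_x f z = vector_derivative (\<lambda>x::real. f (z + of_real x)) (at 0)"

definition partial_y :: "(complex \<Rightarrow> complex) \<Rightarrow> complex \<Rightarrow> complex" where
  "partial_y f z = vector_derivative (\<lambda>y::real. f (z + \<i> * of_real y)) (at 0)"

definition wirtinger :: "(complex \<Rightarrow> complex) \<Rightarrow> complex \<Rightarrow> complex" where
  "wirtinger f z = (partial_x f z - \<i> * partial_y f z) / 2"

definition wirtinger_bar :: "(complex \<Rightarrow> complex) \<Rightarrow> complex \<Rightarrow> complex" where
  "wirtinger_bar f z = (partial_x f z + \<i> * partial_y f z) / 2"


text \<open>
  \<open>heat_flow c p\<close> is \<open>exp (c \<partial>\<^sub>z\<^sup>2) p\<close>; the terms of the exponential series with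
  \<open>k > degree p\<close> vanish.
\<close>

definition heat_flow :: "complex \<Rightarrow> complex poly \<Rightarrow> complex poly" where
  "heat_flow c p = (\<Sum>k\<le>degree p. smult (c ^ k / fact k) ((pderiv ^^ (2 * k)) p))"

text \<open>The number of zeros, counted with multiplicity.\<close>

definition total_mult :: "complex poly \<Rightarrow> nat" where
  "total_mult R = (\<Sum>\<nu> | poly R \<nu> = 0. order \<nu> R)"

definition evolved_power :: "complex poly \<Rightarrow> nat \<Rightarrow> complex \<Rightarrow> complex poly" where
  "evolved_power P n t = heat_flow (- t / (2 * of_nat (total_mult P) * of_nat n)) (P ^ n)"

text \<open>
  The measure \<open>\<mu>\<^bsub>n,t\<^esub>\<close> giving each zero of \<open>P\<^sub>t\<^sup>n\<close> its multiplicity divided by \<open>\<alpha>n\<close>. The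
  push-forward along the identity turns the measure on the finite set of zeros into a Borel
  measure on the complex plane.
\<close>

definition zero_measure :: "complex poly \<Rightarrow> nat \<Rightarrow> complex \<Rightarrow> complex measure" where
  "zero_measure P n t =
     distr
       (point_measure {w. poly (evolved_power P n t) w = 0}
          (\<lambda>w. ennreal (real (order w (evolved_power P n t)) / (real (total_mult P) * real n))))
       borel (\<lambda>w. w)"

text \<open>Weak convergence, which the library provides only for measures on the real line.\<close>

definition weakly_converges :: "(nat \<Rightarrow> complex measure) \<Rightarrow> complex measure \<Rightarrow> bool" where
  "weakly_converges Ms M \<longleftrightarrow>
     (\<forall>f :: complex \<Rightarrow> real. continuous_on UNIV f \<and> bounded (range f) \<longrightarrow>
        (\<lambda>n. \<integral>w. f w \<partial>Ms n) \<longlonglongrightarrow> (\<integral>w. f w \<partial>M))"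

definition compactly_supported :: "complex measure \<Rightarrow> bool" where
  "compactly_supported M \<longleftrightarrow> (\<exists>K. compact K \<and> emeasure M (- K) = 0)"

definition log_potential :: "complex measure \<Rightarrow> complex \<Rightarrow> real" where
  "log_potential M z = (\<integral>\<xi>. ln (cmod (z - \<xi>)) \<partial>M)"

definition stieltjes :: "complex measure \<Rightarrow> complex \<Rightarrow> complex" where
  "stieltjes M z = (\<integral>y. 1 / (z - y) \<partial>M)"


text \<open>The function \<open>G\<^sup>R(z,u)\<close> for time parameter \<open>s\<close>.\<close>

definition saddle_fun :: "real \<Rightarrow> complex poly \<Rightarrow> complex \<Rightarrow> complex \<Rightarrow> real" where
  "saddle_fun s R z u =
     1 / real (total_mult R) * (\<Sum>\<nu> | poly R \<nu> = 0. real (order \<nu> R) * ln (cmod (u - \<nu>)))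
     + Re ((z - u)\<^sup>2 / (2 * of_real s))"

text \<open>
  The polynomial \<open>Q\<close> in the variable \<open>u\<close>; no zero of \<open>R\<close> is a root of it, so
  \<open>saddle_fun\<close> never takes the logarithm of \<open>0\<close> at its roots.
\<close>

definition saddle_poly :: "real \<Rightarrow> complex poly \<Rightarrow> complex \<Rightarrow> complex poly" where
  "saddle_poly s R z =
     (let N = {\<nu>. poly R \<nu> = 0} in
      smult (of_real s / of_nat (total_mult R))
        (\<Sum>\<nu>\<in>N. smult (of_nat (order \<nu> R)) (\<Prod>\<kappa>\<in>N - {\<nu>}. [:- \<kappa>, 1:]))
      - [:z, - 1:] * (\<Prod>\<nu>\<in>N. [:- \<nu>, 1:]))"

definition generic_points :: "real \<Rightarrow> complex poly \<Rightarrow> complex set" where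
  "generic_points s R =
     {z. card {u. poly (saddle_poly s R z) u = 0} = card {\<nu>. poly R \<nu> = 0} + 1 \<and>
         inj_on (saddle_fun s R z) {u. poly (saddle_poly s R z) u = 0}}"

text \<open>
  The membership condition is the same for every argument \<open>\<theta>\<close> of \<open>t\<close>: replacing
  \<open>\<theta>\<close> by \<open>\<theta> + 2\<pi>\<close> reflects all data by \<open>w \<mapsto> -w\<close>.
\<close>

definition pde_domain :: "complex poly \<Rightarrow> (complex \<times> complex) set" where
  "pde_domain P =
     {(z, t). t \<noteq> 0 \<and>
        (\<exists>\<theta>::real. t = of_real (cmod t) * cis \<theta> \<and>
           cis (- \<theta> / 2) * z \<in> generic_points (cmod t) (pcompose P [:0, cis (\<theta> / 2):]))}"

end

theory Submission
  imports Defs "HOL-Complex_Analysis.Complex_Analysis" "HOL-Real_Asymp.Real_Asymp"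
begin

text \<open>
  Put \<open>N = \<alpha> n\<close> and \<open>p = P\<^sub>t\<^sup>n\<close>. The function \<open>v = ln p / N\<close> satisfies
  \<open>\<partial>\<^sub>t v = - ((\<partial>\<^sub>z v)\<^sup>2 + \<partial>\<^sub>z\<^sup>2 v / N) / 2\<close>. Where the zeros stay away from a neighbourhood of \<open>(z, t)\<close>,
  the functions \<open>\<partial>\<^sub>z v\<close> are uniformly bounded and converge to \<open>m\<close>; so their derivatives converge, the
  viscous term disappears, \<open>m\<close> is holomorphic in each variable, and \<open>U\<close> is the real part of the limit
  of \<open>v\<close>. Only the absence of zeros near a point of the domain has to be shown.

  For this, \<open>p\<close> is a multiple of \<open>\<integral> \<Phi>(x)\<^sup>n dx\<close> over the real line, where
  \<open>\<Phi>(x) = P(z + \<i> r x) exp (- \<alpha> x\<^sup>2 / 2)\<close> and \<open>r\<^sup>2 = t\<close>. The lowest level \<open>c\<close> at which the two ends of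
  the real line are joined in \<open>{\<bar>\<Phi>\<bar> < c}\<close> is the modulus of a saddle value. As the saddles are
  nondegenerate with distinct moduli, the contour can be deformed so that it meets \<open>{\<bar>\<Phi>\<bar> \<ge> c}\<close> in
  a single saddle point, whose contribution dominates uniformly for nearby \<open>(z, t)\<close>.
\<close>

section \<open>Level sets and mountain passes\<close>

text \<open>The measures for different \<open>t\<close> are given separately, so weak convergence
  alone says nothing about derivatives in \<open>t\<close>; these are taken at finite
  \<open>n\<close>, where \<open>t\<close> enters holomorphically. Which saddle dominates is never
  computed: the largest critical value need not be the relevant one, and only the topology of the
  sublevel sets decides. Genericity enters at two places: simple roots give exactly two descending
  sectors, and distinct values identify the critical point found from the left end with the one
  found from the right end. Zeros must be absent from a whole neighbourhood with one bound on
  \<open>n\<close>, so the saddle point estimate compares two explicit geometric rates instead of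
  using an asymptotic formula at a fixed parameter. As the logarithm is unbounded at infinity too,
  weak convergence can be applied to it only after a second bound, of Heilmann-Lieb type, has
  confined the zeros for all \<open>n\<close> and all \<open>t\<close> in a bounded set to one
  disc.\<close>

lemma holomorphic_log_on_ball:
  fixes f :: "complex \<Rightarrow> complex"
  assumes hol: "f holomorphic_on ball c r" and nz: "\<And>z. z \<in> ball c r \<Longrightarrow> f z \<noteq> 0"
  obtains G where "G holomorphic_on ball c r" "\<And>z. z \<in> ball c r \<Longrightarrow> f z = exp (G z)"
    "\<And>z. z \<in> ball c r \<Longrightarrow> deriv f z = f z * deriv G z"
proof -
  obtain G where G: "G holomorphic_on ball c r" "\<And>z. z \<in> ball c r \<Longrightarrow> f z = exp (G z)"
    using simply_connected_imp_holomorphic_log[OF hol] nz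
    by (metis convex_ball convex_imp_simply_connected convex_imp_locally_path_connected)
  have "deriv f z = f z * deriv G z" if z: "z \<in> ball c r" for z
  proof -
    have "((\<lambda>w. exp (G w)) has_field_derivative (exp (G z) * deriv G z)) (at z)"
      by (rule derivative_eq_intros holomorphic_derivI[OF G(1) open_ball z] refl | simp)+
    then have "(f has_field_derivative (exp (G z) * deriv G z)) (at z)"
      by (rule has_field_derivative_transform_within_open[OF _ open_ball z]) (simp add: G)
    then show ?thesis using G(2)[OF z] DERIV_imp_deriv by auto
  qed
  then show ?thesis using that G by blast
qed

text \<open>
  In the coordinate \<open>\<zeta>\<close> with \<open>f = - \<zeta>\<^sup>2\<close> the set \<open>Re f < 0\<close> is the pair of convex cones
  \<open>\<bar>Im \<zeta>\<bar> < \<bar>Re \<zeta>\<bar>\<close>; \<open>e\<close> is the direction of steepest descent.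
\<close>

lemma saddle_sectors:
  fixes f :: "complex \<Rightarrow> complex" and A :: real
  assumes holf: "f holomorphic_on ball x0 d" and d: "d > 0"
    and f0: "f x0 = 0" and f1: "deriv f x0 = 0"
    and f2: "deriv (deriv f) x0 * e\<^sup>2 = - of_real A" and A: "A > 0"
  obtains N S1 S2 \<delta> where "open N" "x0 \<in> N" "N \<subseteq> ball x0 d" "connected S1" "connected S2"
    "{x \<in> N. Re (f x) < 0} = S1 \<union> S2" "\<delta> > 0"
    "\<And>s. 0 < s \<Longrightarrow> s < \<delta> \<Longrightarrow> x0 + of_real s * e \<in> S1 \<and> x0 - of_real s * e \<in> S2"
proof -
  have e0: "e \<noteq> 0" and f2': "deriv (deriv f) x0 \<noteq> 0" using f2 A by auto
  have "x0 \<in> ball x0 d" using d by auto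
  obtain h r0 where r0: "r0 > 0" and h0: "h holomorphic_on ball x0 r0"
    and fh0: "\<And>w. w \<in> ball x0 r0 \<Longrightarrow> f w - f x0 = (w - x0)^2 * h w"
    and hnz: "\<And>w. w \<in> ball x0 r0 \<Longrightarrow> h w \<noteq> 0"
  proof (rule holomorphic_factor_order_of_zero [OF holf open_ball \<open>x0 \<in> ball x0 d\<close>, of 2])
    show "(deriv ^^ 2) f x0 \<noteq> 0" using f2' by (simp add: numeral_2_eq_2)
    show "(deriv ^^ i) f x0 = 0" if "0 < i" "i < 2" for i
    proof -
      have "i = 1" using that by simp
      then show ?thesis using f1 by simp
    qed
  qed (use that in auto)
  have fh: "f w = (w - x0)^2 * h w" if "w \<in> ball x0 r0" for w
    using fh0[OF that] f0 by simp
  have x0r0: "x0 \<in> ball x0 r0" using r0 by simp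
  have hd: "(h has_field_derivative deriv h w) (at w)" if "w \<in> ball x0 r0" for w
    using holomorphic_derivI[OF h0 open_ball that] .
  have df: "deriv f w = 2 * (w - x0) * h w + (w - x0)^2 * deriv h w" if w: "w \<in> ball x0 r0" for w
  proof -
    have "((\<lambda>w. (w - x0)^2 * h w) has_field_derivative (2 * (w - x0) * h w + (w - x0)^2 * deriv h w)) (at w)"
      by (rule derivative_eq_intros hd[OF w] refl | simp)+
    then have "(f has_field_derivative (2 * (w - x0) * h w + (w - x0)^2 * deriv h w)) (at w)"
      by (rule has_field_derivative_transform_within_open[OF _ open_ball w]) (simp add: fh)
    then show ?thesis by (rule DERIV_imp_deriv)
  qed
  have h'd: "(deriv h has_field_derivative deriv (deriv h) w) (at w)" if "w \<in> ball x0 r0" for w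
    using holomorphic_derivI[OF holomorphic_deriv[OF h0 open_ball] open_ball that] .
  have ddf: "deriv (deriv f) x0 = 2 * h x0"
  proof -
    have "((\<lambda>w. 2 * (w - x0) * h w + (w - x0)^2 * deriv h w) has_field_derivative (2 * h x0)) (at x0)"
      by (rule derivative_eq_intros hd[OF x0r0] h'd[OF x0r0] refl | simp)+
    then have "(deriv f has_field_derivative (2 * h x0)) (at x0)"
      by (rule has_field_derivative_transform_within_open[OF _ open_ball x0r0]) (simp add: df)
    then show ?thesis by (rule DERIV_imp_deriv)
  qed
  have h00: "h x0 \<noteq> 0" using hnz x0r0 by blast
  \<comment> \<open>\<open>h\<close> is divided by its value at \<open>x0\<close> so that the
    principal root \<open>csqrt\<close> of the quotient is holomorphic near
    \<open>x0\<close>.\<close>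
  define k where "k = (\<lambda>w. h w / h x0)"
  have hx0: "2 * h x0 * e^2 = - of_real A" using f2 ddf by simp
  have khol: "k holomorphic_on ball x0 r0"
    unfolding k_def using h0 h00 by (intro holomorphic_intros) auto
  have "isCont k x0" using khol x0r0
    by (meson open_ball continuous_on_eq_continuous_at holomorphic_on_imp_continuous_on)
  moreover have "k x0 = 1" using h00 by (simp add: k_def)
  ultimately obtain r1 where r1: "r1 > 0" "\<And>w. dist w x0 < r1 \<Longrightarrow> dist (k w) 1 < 1"
    unfolding continuous_at_eps_delta by (metis zero_less_one)
  have kRe: "Re (k w) > 0" if "w \<in> ball x0 r1" for w
  proof -
    have "cmod (1 - k w) < 1" using r1(2)[of w] that by (simp add: dist_commute dist_norm norm_minus_commute)
    then have "\<bar>Re (1 - k w)\<bar> < 1" using abs_Re_le_cmod[of "1 - k w"] by linarith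
    then show ?thesis by auto
  qed
  define r where "r = min d (min r0 r1)"
  have r: "r > 0" using d r0 r1 by (simp add: r_def)
  have sub: "ball x0 r \<subseteq> ball x0 d" "ball x0 r \<subseteq> ball x0 r0" "ball x0 r \<subseteq> ball x0 r1"
    by (auto simp: r_def)
  \<comment> \<open>Of the two square roots of \<open>- h x0\<close> this is the one with
    \<open>c * e\<close> real and positive, so that \<open>\<zeta>\<close> sends the ray in
    direction \<open>e\<close> into the right cone and the opposite ray into the left one.\<close>
  define c where "c = of_real (sqrt (A/2)) / e"
  define \<zeta> where "\<zeta> = (\<lambda>w. (w - x0) * c * csqrt (k w))"
  have c2: "c\<^sup>2 = - h x0"
  proof -
    have "c\<^sup>2 = of_real (A/2) / e^2" using A
      by (simp add: c_def power_divide flip: of_real_power)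
    also have "\<dots> = - h x0" using hx0 e0 by (simp add: field_simps)
    finally show ?thesis .
  qed
  have c0: "c \<noteq> 0" using A e0 by (simp add: c_def)
  have \<zeta>hol: "\<zeta> holomorphic_on ball x0 r"
    unfolding \<zeta>_def
  proof (intro holomorphic_intros)
    show "k holomorphic_on ball x0 r" using khol sub holomorphic_on_subset by blast
    show "\<And>z. z \<in> ball x0 r \<Longrightarrow> k z \<notin> \<real>\<^sub>\<le>\<^sub>0"
      using kRe sub(3) by (metis complex_nonpos_Reals_iff not_less subsetD)
  qed
  have f\<zeta>: "f w = - ((\<zeta> w)^2)" if "w \<in> ball x0 r" for w
  proof -
    have "(\<zeta> w)^2 = (w - x0)^2 * c\<^sup>2 * k w" by (simp add: \<zeta>_def power_mult_distrib)
    also have "\<dots> = - ((w - x0)^2 * h w)" using h00 by (simp add: c2 k_def)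
    finally show ?thesis using fh that sub by (auto simp: subset_eq)
  qed
  have x0r: "x0 \<in> ball x0 r" using r by simp
  have "(k has_field_derivative deriv k x0) (at x0)"
    using holomorphic_derivI[OF khol open_ball x0r0] .
  then have "(\<zeta> has_field_derivative c) (at x0)"
    unfolding \<zeta>_def using \<open>k x0 = 1\<close>
    by (auto intro!: derivative_eq_intros)
  then have "deriv \<zeta> x0 = c" by (rule DERIV_imp_deriv)
  then have "deriv \<zeta> x0 \<noteq> 0" using c0 by simp
  then obtain s where s: "s > 0" "ball x0 s \<subseteq> ball x0 r" "open (\<zeta> ` ball x0 s)" "inj_on \<zeta> (ball x0 s)"
    using has_complex_derivative_locally_invertible[OF \<zeta>hol x0r open_ball] by metis
  have \<zeta>hols: "\<zeta> holomorphic_on ball x0 s" using \<zeta>hol s(2) holomorphic_on_subset by blast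
  obtain g where g: "g holomorphic_on \<zeta> ` ball x0 s" "\<And>z. z \<in> ball x0 s \<Longrightarrow> g (\<zeta> z) = z"
    using holomorphic_has_inverse[OF \<zeta>hols open_ball s(4)] by metis
  have \<zeta>0: "\<zeta> x0 = 0" by (simp add: \<zeta>_def)
  have "0 \<in> \<zeta> ` ball x0 s" using \<zeta>0 s(1) by (metis centre_in_ball imageI)
  then obtain \<rho> where \<rho>: "\<rho> > 0" "ball 0 \<rho> \<subseteq> \<zeta> ` ball x0 s"
    using s(3) open_contains_ball by blast
  define N where "N = {w \<in> ball x0 s. \<zeta> w \<in> ball 0 \<rho>}"
  define W1 where "W1 = {z::complex. \<bar>Im z\<bar> < Re z} \<inter> ball 0 \<rho>"
  define W2 where "W2 = {z::complex. \<bar>Im z\<bar> < - Re z} \<inter> ball 0 \<rho>"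
  have cvx1: "convex {z::complex. \<bar>Im z\<bar> < Re z}"
  proof (rule convexI)
    fix x y :: complex and u v :: real
    assume *: "x \<in> {z. \<bar>Im z\<bar> < Re z}" "y \<in> {z. \<bar>Im z\<bar> < Re z}" "0 \<le> u" "0 \<le> v" "u + v = 1"
    have "\<bar>u * Im x + v * Im y\<bar> \<le> u * \<bar>Im x\<bar> + v * \<bar>Im y\<bar>"
      using * by (intro order_trans[OF abs_triangle_ineq]) (simp add: abs_mult)
    also have "\<dots> < u * Re x + v * Re y"
    proof (cases "u = 0")
      case True then show ?thesis using * by simp
    next
      case False
      then have "u * \<bar>Im x\<bar> < u * Re x" using * by simp
      moreover have "v * \<bar>Im y\<bar> \<le> v * Re y" using * by (simp add: mult_left_mono)
      ultimately show ?thesis by linarith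
    qed
    finally show "u *\<^sub>R x + v *\<^sub>R y \<in> {z. \<bar>Im z\<bar> < Re z}" by simp
  qed
  have eq2: "{z::complex. \<bar>Im z\<bar> < - Re z} = uminus ` {z::complex. \<bar>Im z\<bar> < Re z}"
  proof (intro equalityI subsetI)
    fix z assume z: "z \<in> {z::complex. \<bar>Im z\<bar> < - Re z}"
    then have "- z \<in> {z::complex. \<bar>Im z\<bar> < Re z}" by simp
    then show "z \<in> uminus ` {z::complex. \<bar>Im z\<bar> < Re z}" by (metis image_eqI minus_minus)
  qed auto
  have W1: "connected W1" unfolding W1_def by (intro convex_connected convex_Int cvx1 convex_ball)
  have W2: "connected W2" unfolding W2_def eq2
    by (intro convex_connected convex_Int convex_negations cvx1 convex_ball)
  have ng: "g z \<in> N \<and> \<zeta> (g z) = z" if z: "z \<in> ball 0 \<rho>" for z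
  proof -
    obtain w where "w \<in> ball x0 s" "\<zeta> w = z" using z \<rho>(2) by blast
    then show ?thesis using g(2) z by (auto simp: N_def)
  qed
  have contg: "continuous_on (ball 0 \<rho>) g"
    using g(1) \<rho>(2) holomorphic_on_imp_continuous_on holomorphic_on_subset by blast
  have opN: "open N"
  proof -
    have "open (ball x0 s \<inter> \<zeta> -` ball 0 \<rho>)"
      using \<zeta>hols holomorphic_on_imp_continuous_on
      by (metis continuous_on_open_vimage inf_commute open_ball)
    then show ?thesis by (simp add: N_def Int_def vimage_def)
  qed
    have x0N: "x0 \<in> N" using s(1) \<rho>(1) by (simp add: N_def \<zeta>0)
    obtain \<epsilon> where \<epsilon>: "\<epsilon> > 0" "ball x0 \<epsilon> \<subseteq> N" using opN x0N open_contains_ball by blast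
    define \<delta> where "\<delta> = \<epsilon> / cmod e"
  show ?thesis
  proof (rule that)
    show "open N" by fact
    show "x0 \<in> N" using s(1) \<rho>(1) by (simp add: N_def \<zeta>0)
    show "N \<subseteq> ball x0 d" using s(2) sub by (auto simp: N_def)
    show "connected (g ` W1)"
      by (rule connected_continuous_image[OF continuous_on_subset[OF contg] W1]) (auto simp: W1_def)
    show "connected (g ` W2)"
      by (rule connected_continuous_image[OF continuous_on_subset[OF contg] W2]) (auto simp: W2_def)
    have sgn: "Re (f w) < 0 \<longleftrightarrow> \<bar>Im (\<zeta> w)\<bar> < \<bar>Re (\<zeta> w)\<bar>" if "w \<in> ball x0 s" for w
    proof -
      have "Re (f w) = (Im (\<zeta> w))^2 - (Re (\<zeta> w))^2"
        using f\<zeta> that s(2) by (auto simp: power2_eq_square subset_eq)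
      then show ?thesis using abs_less_iff power2_less_imp_less
        by (metis abs_ge_zero diff_less_0_iff_less power2_abs power_strict_mono zero_less_numeral)
    qed
    show "{x \<in> N. Re (f x) < 0} = g ` W1 \<union> g ` W2"
    proof (intro equalityI subsetI)
      fix x assume x: "x \<in> {x \<in> N. Re (f x) < 0}"
      then have xs: "x \<in> ball x0 s" and xz: "\<zeta> x \<in> ball 0 \<rho>" by (auto simp: N_def)
      have "\<bar>Im (\<zeta> x)\<bar> < \<bar>Re (\<zeta> x)\<bar>" using sgn x xs by auto
      then have "\<zeta> x \<in> W1 \<or> \<zeta> x \<in> W2" using xz by (auto simp: W1_def W2_def abs_if split: if_splits)
      then show "x \<in> g ` W1 \<union> g ` W2" using g(2)[OF xs] by (metis UnCI imageI)
    next
      fix x assume "x \<in> g ` W1 \<union> g ` W2"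
      then obtain z where z: "z \<in> W1 \<union> W2" "x = g z" by auto
      then have zb: "z \<in> ball 0 \<rho>" by (auto simp: W1_def W2_def)
      have "x \<in> N" "\<zeta> x = z" using ng[OF zb] z by auto
      moreover have "\<bar>Im z\<bar> < \<bar>Re z\<bar>" using z by (auto simp: W1_def W2_def)
      ultimately show "x \<in> {x \<in> N. Re (f x) < 0}" using sgn by (auto simp: N_def)
    qed
    show "\<delta> > 0" using \<epsilon> e0 by (simp add: \<delta>_def)
    fix t :: real assume t: "0 < t" "t < \<delta>"
    have mem: "x0 + of_real t * e \<in> N" "x0 - of_real t * e \<in> N"
      using \<epsilon>(2) t e0 by (auto simp: subset_eq dist_norm norm_mult \<delta>_def field_simps)
    have key: "t * sqrt (A/2) > 0" using t A by simp
    \<comment> \<open>The principal root of a number with positive real part has argument between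
      -pi/4 and pi/4, so it lies in the right cone; the image of the ray need not be
      straight.\<close>
    have sq: "\<bar>Im (csqrt w)\<bar> < Re (csqrt w)" if "Re w > 0" for w
    proof -
      have w: "Re w = (Re (csqrt w))^2 - (Im (csqrt w))^2"
        by (metis Re_power2 power2_csqrt)
      have "Re (csqrt w) \<ge> 0" by (rule Re_csqrt)
      moreover have "(Im (csqrt w))^2 < (Re (csqrt w))^2" using w that by (simp del: csqrt.simps)
      ultimately show ?thesis using power2_less_imp_less[of "\<bar>Im (csqrt w)\<bar>" "Re (csqrt w)"] by (simp del: csqrt.simps)
    qed
    have kk: "Re (k w) > 0" if "w \<in> N" for w
    proof (rule kRe)
      show "w \<in> ball x0 r1" using that s(2) sub unfolding N_def by blast
    qed
    have z1: "\<zeta> (x0 + of_real t * e) = of_real (t * sqrt (A/2)) * csqrt (k (x0 + of_real t * e))"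
      using e0 by (simp add: \<zeta>_def c_def)
    have z2: "\<zeta> (x0 - of_real t * e) = - (of_real (t * sqrt (A/2)) * csqrt (k (x0 - of_real t * e)))"
      using e0 by (simp add: \<zeta>_def c_def)
    have "\<zeta> (x0 + of_real t * e) \<in> W1"
    proof -
      have "\<zeta> (x0 + of_real t * e) \<in> ball 0 \<rho>" using mem by (auto simp: N_def)
      moreover have "\<bar>Im (\<zeta> (x0 + of_real t * e))\<bar> < Re (\<zeta> (x0 + of_real t * e))"
        using mult_strict_left_mono[OF sq[OF kk[OF mem(1)]] key] key t A
        unfolding z1 by (simp add: abs_mult del: csqrt.simps)
      ultimately show ?thesis by (simp add: W1_def)
    qed
    moreover have "\<zeta> (x0 - of_real t * e) \<in> W2"
    proof -
      have "\<zeta> (x0 - of_real t * e) \<in> ball 0 \<rho>" using mem by (auto simp: N_def)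
      moreover have "\<bar>Im (\<zeta> (x0 - of_real t * e))\<bar> < - Re (\<zeta> (x0 - of_real t * e))"
        using mult_strict_left_mono[OF sq[OF kk[OF mem(2)]] key] key t A
        unfolding z2 by (simp add: abs_mult del: csqrt.simps)
      ultimately show ?thesis by (simp add: W2_def)
    qed
    moreover have "g (\<zeta> (x0 + of_real t * e)) = x0 + of_real t * e"
      using mem(1) by (intro g(2)) (simp add: N_def)
    moreover have "g (\<zeta> (x0 - of_real t * e)) = x0 - of_real t * e"
      using mem(2) by (intro g(2)) (simp add: N_def)
    ultimately show "x0 + of_real t * e \<in> g ` W1 \<and> x0 - of_real t * e \<in> g ` W2"
      by (metis imageI)
  qed
qed

text \<open>Near a noncritical point \<open>\<Phi>\<close> is injective with an image containing a
  disc, so the local sublevel set is the continuous image, under the inverse, of an intersection of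
  two discs, which is convex.\<close>

lemma regular_level_point:
  fixes \<Phi> :: "complex \<Rightarrow> complex"
  assumes hol: "\<Phi> holomorphic_on S" and S: "open S" "y \<in> S"
    and nz: "deriv \<Phi> y \<noteq> 0" and c: "c > 0"
  obtains N where "open N" "y \<in> N" "N \<subseteq> S" "connected {x \<in> N. cmod (\<Phi> x) < c}"
    "{x \<in> N. cmod (\<Phi> x) \<le> c} \<subseteq> closure {x \<in> N. cmod (\<Phi> x) < c}"
proof -
  obtain r where r: "r > 0" "ball y r \<subseteq> S" "open (\<Phi> ` ball y r)" "inj_on \<Phi> (ball y r)"
    using has_complex_derivative_locally_invertible[OF hol S(2) S(1) nz] .
  have holr: "\<Phi> holomorphic_on ball y r" using hol r(2) holomorphic_on_subset by blast
  obtain g where g: "g holomorphic_on \<Phi> ` ball y r" "\<And>z. z \<in> ball y r \<Longrightarrow> g (\<Phi> z) = z"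
    using holomorphic_has_inverse[OF holr open_ball r(4)] by metis
  have "\<Phi> y \<in> \<Phi> ` ball y r" using r(1) by simp
  then obtain \<rho> where \<rho>: "\<rho> > 0" "ball (\<Phi> y) \<rho> \<subseteq> \<Phi> ` ball y r"
    using r(3) open_contains_ball by blast
  define N where "N = {x \<in> ball y r. \<Phi> x \<in> ball (\<Phi> y) \<rho>}"
  have opN: "open N"
  proof -
    have "open (ball y r \<inter> \<Phi> -` ball (\<Phi> y) \<rho>)"
      using holr holomorphic_on_imp_continuous_on
      by (metis continuous_on_open_vimage inf_commute open_ball)
    then show ?thesis by (simp add: N_def Int_def vimage_def)
  qed
  have eq: "{x \<in> N. cmod (\<Phi> x) < c} = g ` (ball (\<Phi> y) \<rho> \<inter> ball 0 c)"
  proof (intro equalityI subsetI)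
    fix x assume "x \<in> {x \<in> N. cmod (\<Phi> x) < c}"
    then show "x \<in> g ` (ball (\<Phi> y) \<rho> \<inter> ball 0 c)"
      using g(2)[of x] by (intro image_eqI[of _ _ "\<Phi> x"]) (auto simp: N_def)
  next
    fix x assume "x \<in> g ` (ball (\<Phi> y) \<rho> \<inter> ball 0 c)"
    then obtain z where z: "z \<in> ball (\<Phi> y) \<rho>" "z \<in> ball 0 c" "x = g z" by auto
    then obtain w where "w \<in> ball y r" "\<Phi> w = z" using \<rho>(2) by blast
    then show "x \<in> {x \<in> N. cmod (\<Phi> x) < c}" using z g(2)[of w] by (auto simp: N_def)
  qed
  show ?thesis
  proof
    show "open N" by fact
    show "y \<in> N" using r \<rho> by (simp add: N_def)
    show "N \<subseteq> S" using r by (auto simp: N_def)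
    have "continuous_on (ball (\<Phi> y) \<rho> \<inter> ball 0 c) g"
      using g(1) \<rho>(2) holomorphic_on_imp_continuous_on
      by (meson continuous_on_subset inf_le1 subset_trans)
    then show "connected {x \<in> N. cmod (\<Phi> x) < c}"
      unfolding eq by (intro connected_continuous_image convex_connected convex_Int convex_ball)
    show "{x \<in> N. cmod (\<Phi> x) \<le> c} \<subseteq> closure {x \<in> N. cmod (\<Phi> x) < c}"
    proof
      fix x assume "x \<in> {x \<in> N. cmod (\<Phi> x) \<le> c}"
      then have x: "x \<in> N" "cmod (\<Phi> x) \<le> c" by auto
      show "x \<in> closure {x \<in> N. cmod (\<Phi> x) < c}"
        unfolding closure_iff_nhds_not_empty
      proof (intro allI impI)
        fix A U assume U: "U \<subseteq> A" "open U" "x \<in> U"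
        have op: "open (U \<inter> N)" "U \<inter> N \<subseteq> ball y r" using U opN by (auto simp: N_def)
        have "open (\<Phi> ` (U \<inter> N))"
          using open_mapping_thm3[of \<Phi> "U \<inter> N"] op holr r(4) holomorphic_on_subset inj_on_subset by blast
        moreover have "\<Phi> x \<in> \<Phi> ` (U \<inter> N)" using U x by auto
        ultimately obtain \<epsilon> where \<epsilon>: "\<epsilon> > 0" "ball (\<Phi> x) \<epsilon> \<subseteq> \<Phi> ` (U \<inter> N)"
          using open_contains_ball by blast
        \<comment> \<open>Shrinking the value \<open>\<Phi> x\<close> towards 0 by the factor
          \<open>1 - s\<close> brings its modulus below \<open>c\<close>; the bound
          \<open>\<epsilon> / (2 * c)\<close> keeps the new value among those attained near
          \<open>x\<close>, and \<open>1/2\<close> keeps the factor positive.\<close>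
        define s where "s = min (1/2) (\<epsilon> / (2 * c))"
        have s: "0 < s" "s \<le> 1/2" "s * c < \<epsilon>" using \<epsilon> c by (auto simp: s_def min_def field_simps)
        define z where "z = of_real (1 - s) * \<Phi> x"
        have "dist (\<Phi> x) z = s * cmod (\<Phi> x)"
          using s by (simp add: z_def dist_norm algebra_simps norm_mult)
        also have "\<dots> \<le> s * c" using x s by simp
        finally have "z \<in> ball (\<Phi> x) \<epsilon>" using s by simp
        then obtain w where w: "w \<in> U \<inter> N" "\<Phi> w = z" using \<epsilon> by blast
        have "cmod (of_real (1 - s)) = 1 - s" using s by (subst norm_of_real) auto
        then have "cmod z = (1 - s) * cmod (\<Phi> x)" by (simp add: z_def norm_mult)
        also have "\<dots> \<le> (1 - s) * c" using x s by (intro mult_left_mono) auto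
        also have "\<dots> < c" using s c by simp
        finally show "{x \<in> N. cmod (\<Phi> x) < c} \<inter> A \<noteq> {}" using w U by auto
      qed
    qed
  qed
qed

text \<open>
  Without a critical point on its boundary, the closure of the component of \<open>a\<close> would be relatively
  open in \<open>{x. cmod (\<Phi> x) \<le> c}\<close>, so a slightly higher level would still separate \<open>a\<close> from \<open>b\<close>. The
  sign \<open>\<sigma>\<close> lets the left and the right end of the real line share one proof.
\<close>

lemma critical_point_in_component_closure:
  fixes \<Phi> :: "complex \<Rightarrow> complex"
  defines "V \<equiv> \<lambda>c. {x. cmod (\<Phi> x) < c}"
  assumes \<sigma>: "\<sigma> = 1 \<or> \<sigma> = - (1::real)" and hol: "\<Phi> holomorphic_on UNIV" and c: "c > 0"
    and strip: "\<And>C. bounded {x. \<bar>Re x\<bar> \<le> Y \<and> cmod (\<Phi> x) \<le> C}"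
    and left: "\<And>x. \<sigma> * Re x \<le> - Y \<Longrightarrow> cmod (\<Phi> x) \<le> c \<Longrightarrow> x \<in> closure (connected_component_set (V c) a)"
    and right: "\<And>x. \<sigma> * Re x \<ge> Y \<Longrightarrow> cmod (\<Phi> x) \<le> c \<Longrightarrow> x \<in> closure (connected_component_set (V c) b)"
    and Y: "Y \<ge> 0" and ab: "\<sigma> * Re a < - Y" "\<sigma> * Re b > Y" and disj: "\<not> connected_component (V c) a b"
    and conn: "\<And>c'. c' > c \<Longrightarrow> connected_component (V c') a b"
  shows "\<exists>y \<in> closure (connected_component_set (V c) a). cmod (\<Phi> y) = c \<and> deriv \<Phi> y = 0"
proof (rule ccontr)
  assume neg: "\<not> ?thesis"
  define L where "L = connected_component_set (V c) a"
  define R where "R = connected_component_set (V c) b"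
  have contn: "continuous_on UNIV (\<lambda>x. cmod (\<Phi> x))"
    using hol holomorphic_on_imp_continuous_on continuous_on_norm by blast
  have opV: "open (V c)" for c unfolding V_def
    using contn by (intro open_Collect_less) auto
  have clX: "closed {x. cmod (\<Phi> x) \<le> C}" for C
    using contn by (intro closed_Collect_le) auto
  have opL: "open L" "open R" unfolding L_def R_def using opV by (auto intro: open_connected_component)
  \<comment> \<open>Components of an open set are open, so the component of a limit point of
    \<open>L\<close> in the sublevel set meets \<open>L\<close>.\<close>
  have VL: "x \<in> L" if x: "x \<in> closure L" "cmod (\<Phi> x) < c" for x
  proof -
    have "open (connected_component_set (V c) x)" using opV open_connected_component by blast
    moreover have "x \<in> connected_component_set (V c) x" using x(2) by (simp add: V_def)
    ultimately have "connected_component_set (V c) x \<inter> L \<noteq> {}"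
      using x(1) open_Int_closure_eq_empty by blast
    then show ?thesis unfolding L_def
      using \<open>x \<in> connected_component_set (V c) x\<close> connected_component_nonoverlap by blast
  qed
  have LV: "L \<subseteq> V c" unfolding L_def by (rule connected_component_subset)
  have clL: "cmod (\<Phi> x) \<le> c" if "x \<in> closure L" for x
  proof -
    have "closure L \<subseteq> {x. cmod (\<Phi> x) \<le> c}"
      using LV by (intro closure_minimal clX) (auto simp: V_def)
    then show ?thesis using that by auto
  qed
  \<comment> \<open>Relative openness of \<open>closure L\<close>: at a point of modulus
    \<open>c\<close> the local sublevel set is connected and meets \<open>L\<close>, so it lies in
    \<open>L\<close>, and the local closed sublevel set lies in its closure.\<close>
  have reg: "\<exists>N. open N \<and> y \<in> N \<and> N \<inter> {x. cmod (\<Phi> x) \<le> c} \<subseteq> closure L \<and> N \<inter> V c \<subseteq> L"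
    if y: "y \<in> closure L" for y
  proof (cases "cmod (\<Phi> y) < c")
    case True
    then have "y \<in> L" using VL y by blast
    then show ?thesis using opL closure_subset by (intro exI[of _ L]) blast
  next
    case False
    then have "cmod (\<Phi> y) = c" using clL[OF y] by simp
    then have dnz: "deriv \<Phi> y \<noteq> 0" using neg y by (auto simp: L_def)
    obtain N where N: "open N" "y \<in> N" "N \<subseteq> UNIV" "connected {x \<in> N. cmod (\<Phi> x) < c}"
      "{x \<in> N. cmod (\<Phi> x) \<le> c} \<subseteq> closure {x \<in> N. cmod (\<Phi> x) < c}"
      by (rule regular_level_point[OF hol open_UNIV UNIV_I dnz c])
    obtain w where w: "w \<in> N" "w \<in> L" using N y open_Int_closure_eq_empty[OF N(1)] by blast
    have "{x \<in> N. cmod (\<Phi> x) < c} \<subseteq> connected_component_set (V c) w"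
      using w LV N(4) by (intro connected_component_maximal) (auto simp: V_def)
    also have "\<dots> = L" using w unfolding L_def by (metis connected_component_eq)
    finally have "{x \<in> N. cmod (\<Phi> x) < c} \<subseteq> L" .
    then show ?thesis using N closure_mono[of "{x \<in> N. cmod (\<Phi> x) < c}" L]
      by (intro exI[of _ N]) (auto simp: V_def)
  qed
  have clLR: "closure L \<inter> closure R = {}"
  proof (rule ccontr)
    assume "closure L \<inter> closure R \<noteq> {}"
    then obtain y where y: "y \<in> closure L" "y \<in> closure R" by blast
    obtain N where N: "open N" "y \<in> N" "N \<inter> V c \<subseteq> L" using reg[OF y(1)] by blast
    then obtain w where "w \<in> N" "w \<in> R" using y(2) open_Int_closure_eq_empty[OF N(1)] by blast
    moreover have "R \<subseteq> V c" unfolding R_def by (rule connected_component_subset)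
    ultimately have "w \<in> L" "w \<in> R" using \<open>N \<inter> V c \<subseteq> L\<close> by auto
    then have "connected_component (V c) a b" unfolding L_def R_def
      using connected_component_sym connected_component_trans by (metis mem_Collect_eq)
    then show False using disj by simp
  qed
  \<comment> \<open>Inside the strip the closed sublevel set splits into two disjoint closed parts;
    outside the strip the sign of the real part alone tells the two sides apart.\<close>
  define E where "E = closure L \<inter> {x. \<bar>Re x\<bar> \<le> Y}"
  define F where "F = ({x. cmod (\<Phi> x) \<le> c} - closure L) \<inter> {x. \<bar>Re x\<bar> \<le> Y}"
  have cstrip: "closed {x. \<bar>Re x\<bar> \<le> Y}" by (intro closed_Collect_le continuous_intros)
  have cptX: "compact {x. \<bar>Re x\<bar> \<le> Y \<and> cmod (\<Phi> x) \<le> C}" for C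
  proof -
    have "closed ({x. \<bar>Re x\<bar> \<le> Y} \<inter> {x. cmod (\<Phi> x) \<le> C})" using cstrip clX by blast
    then show ?thesis using strip by (simp add: compact_eq_bounded_closed Int_def)
  qed
  have clE: "closed E" unfolding E_def using cstrip by auto
  have clF: "closed F"
  proof -
    define W where "W = \<Union>{N. open N \<and> N \<inter> {x. cmod (\<Phi> x) \<le> c} \<subseteq> closure L}"
    have "open W" unfolding W_def by blast
    have "F = {x. cmod (\<Phi> x) \<le> c} \<inter> {x. \<bar>Re x\<bar> \<le> Y} \<inter> - W"
    proof (intro equalityI subsetI)
      fix x assume x: "x \<in> F"
      have "x \<notin> W"
      proof
        assume "x \<in> W"
        then obtain N where "N \<inter> {x. cmod (\<Phi> x) \<le> c} \<subseteq> closure L" "x \<in> N" unfolding W_def by blast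
        then show False using x unfolding F_def by blast
      qed
      then show "x \<in> {x. cmod (\<Phi> x) \<le> c} \<inter> {x. \<bar>Re x\<bar> \<le> Y} \<inter> - W" using x by (auto simp: F_def)
    next
      fix x assume x: "x \<in> {x. cmod (\<Phi> x) \<le> c} \<inter> {x. \<bar>Re x\<bar> \<le> Y} \<inter> - W"
      have "x \<notin> closure L"
      proof
        assume "x \<in> closure L"
        then show False using reg[of x] x unfolding W_def by blast
      qed
      then show "x \<in> F" using x by (auto simp: F_def)
    qed
    then show ?thesis using \<open>open W\<close> clX cstrip by (metis closed_Int closed_def open_closed)
  qed
  have "E \<inter> F = {}" by (auto simp: E_def F_def)
  then obtain O1 O2 where O: "open O1" "open O2" "E \<subseteq> O1" "F \<subseteq> O2" "O1 \<inter> O2 = {}"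
    using separation_normal[OF clE clF] by metis
  \<comment> \<open>\<open>O1\<close> is cut where \<open>\<sigma> * Re x\<close> reaches
    \<open>Y\<close>, and \<open>O2\<close> where it reaches \<open>- Y\<close>, so that the added
    half-planes leave the two sets disjoint. By \<open>left\<close> and \<open>right\<close> the
    cuts lose no point of modulus at most \<open>c\<close>.\<close>
  define P1 where "P1 = (O1 \<inter> {x. \<sigma> * Re x < Y}) \<union> {x. \<sigma> * Re x < - Y}"
  define P2 where "P2 = (O2 \<inter> {x. \<sigma> * Re x > - Y}) \<union> {x. \<sigma> * Re x > Y}"
  have opP: "open P1" "open P2" unfolding P1_def P2_def
    using O by (auto intro!: open_Collect_less continuous_intros)
  have P12: "P1 \<inter> P2 = {}" using O(5) Y by (auto simp: P1_def P2_def)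
  \<comment> \<open>What the two open sets miss in the strip up to level \<open>c + 1\<close> is
    compact with modulus above \<open>c\<close>. Its minimum yields a level \<open>c'\<close> above
    \<open>c\<close> at which \<open>P1\<close> and \<open>P2\<close> still cover the sublevel set
    and separate \<open>a\<close> from \<open>b\<close>.\<close>
  define Z where "Z = {x. \<bar>Re x\<bar> \<le> Y \<and> cmod (\<Phi> x) \<le> c + 1} - (P1 \<union> P2)"
  have "compact Z" unfolding Z_def using cptX opP by (intro compact_diff) auto
  have Zc: "cmod (\<Phi> x) > c" if "x \<in> Z" for x
  proof (rule ccontr)
    assume "\<not> c < cmod (\<Phi> x)"
    then have xc: "cmod (\<Phi> x) \<le> c" by simp
    have xs: "\<bar>Re x\<bar> \<le> Y" "x \<notin> P1" "x \<notin> P2" using that by (auto simp: Z_def)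
    show False
    proof (cases "x \<in> closure L")
      case True
      then have "x \<in> O1" using xs O(3) by (auto simp: E_def)
      then have "\<sigma> * Re x = Y" using xs \<sigma> by (auto simp: P1_def)
      then have "x \<in> closure R" using right xc by (auto simp: R_def)
      then show False using True clLR by blast
    next
      case False
      then have "x \<in> O2" using xs O(4) xc by (auto simp: F_def)
      then have "\<sigma> * Re x = - Y" using xs \<sigma> by (auto simp: P2_def)
      then have "x \<in> closure L" using left xc by (auto simp: L_def)
      then show False using False by blast
    qed
  qed
  obtain c' where c': "c < c'" "c' \<le> c + 1" "\<And>x. x \<in> Z \<Longrightarrow> c' \<le> cmod (\<Phi> x)"
  proof (cases "Z = {}")
    case True then show ?thesis using that[of "c+1"] by auto
  next
    case False
    then obtain x where x: "x \<in> Z" "\<forall>y\<in>Z. cmod (\<Phi> x) \<le> cmod (\<Phi> y)"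
      using continuous_attains_inf[OF \<open>compact Z\<close>] contn continuous_on_subset by (metis subset_UNIV)
    show ?thesis using x Zc[of x] by (intro that[of "min (c+1) (cmod (\<Phi> x))"]) (auto simp: min_le_iff_disj)
  qed
  have cov: "V c' \<subseteq> P1 \<union> P2"
  proof
    fix x assume x: "x \<in> V c'"
    show "x \<in> P1 \<union> P2"
    proof (cases "\<bar>Re x\<bar> \<le> Y")
      case True
      then show ?thesis using x c'(2) c'(3)[of x] by (force simp: Z_def V_def)
    next
      case False then show ?thesis using \<sigma> by (auto simp: P1_def P2_def)
    qed
  qed
  obtain T where T: "connected T" "T \<subseteq> V c'" "a \<in> T" "b \<in> T"
    using conn[OF c'(1)] unfolding connected_component_def by blast
  have "a \<in> P1" "b \<in> P2" using ab by (auto simp: P1_def P2_def)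
  then show False using connectedD[OF T(1) opP] T P12 cov by blast
qed

text \<open>Walking horizontally outwards from \<open>x\<close> decreases the modulus, and far out a
  half-strip as high as \<open>x\<close> lies below level \<open>c\<close> and meets the real
  ray.\<close>

lemma reaches_end:
  fixes \<Phi> :: "complex \<Rightarrow> complex" and \<sigma> X :: real
  defines "V \<equiv> \<lambda>c. {x. cmod (\<Phi> x) < c}"
  assumes \<sigma>: "\<sigma> = 1 \<or> \<sigma> = - 1"
    and decay: "\<And>M. \<exists>X. \<forall>x. \<bar>Im x\<bar> \<le> M \<longrightarrow> \<sigma> * Re x \<ge> X \<longrightarrow> cmod (\<Phi> x) < c"
    and mono: "\<And>s. s > 0 \<Longrightarrow> cmod (\<Phi> (x + of_real (\<sigma> * s))) < cmod (\<Phi> x)"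
    and ray: "\<And>r. r \<ge> X \<Longrightarrow> cmod (\<Phi> (of_real (\<sigma> * r))) < c"
    and x: "cmod (\<Phi> x) \<le> c"
  shows "x \<in> closure (connected_component_set (V c) (of_real (\<sigma> * X)))"
proof -
  obtain X3 where X3: "\<And>w. \<bar>Im w\<bar> \<le> \<bar>Im x\<bar> \<Longrightarrow> \<sigma> * Re w \<ge> X3 \<Longrightarrow> cmod (\<Phi> w) < c"
    using decay[of "\<bar>Im x\<bar>"] by blast
  \<comment> \<open>The starting point is excluded since its modulus may equal \<open>c\<close>; it
    is only a limit of \<open>T1\<close>, which is why the conclusion speaks of a closure.\<close>
  define T1 where "T1 = (\<lambda>s. x + of_real (\<sigma> * s)) ` {0::real<..}"
  define T2 where "T2 = {w. \<sigma> * Re w \<ge> X3} \<inter> {w. Im w \<le> \<bar>Im x\<bar>} \<inter> {w. Im w \<ge> - \<bar>Im x\<bar>}"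
  define T3 where "T3 = (\<lambda>r. of_real (\<sigma> * r) :: complex) ` {X..}"
  have c1: "connected T1" unfolding T1_def
    by (intro connected_continuous_image continuous_intros convex_connected) auto
  have c3: "connected T3" unfolding T3_def
    by (intro connected_continuous_image continuous_intros convex_connected) auto
  have "{w. \<sigma> * Re w \<ge> X3} = {w. Re w \<ge> X3} \<or> {w. \<sigma> * Re w \<ge> X3} = {w. Re w \<le> - X3}"
    using \<sigma> by auto
  then have c2: "connected T2" unfolding T2_def
    by (intro convex_connected convex_Int convex_halfspace_Im_ge convex_halfspace_Im_le)
       (metis convex_halfspace_Re_ge convex_halfspace_Re_le)
  have m12: "T1 \<inter> T2 \<noteq> {}"
  proof -
    define s where "s = max 1 (X3 - \<sigma> * Re x)"
    have "x + of_real (\<sigma> * s) \<in> T1" by (auto simp: T1_def s_def)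
    moreover have "x + of_real (\<sigma> * s) \<in> T2" using \<sigma> by (auto simp: T2_def s_def)
    ultimately show ?thesis by blast
  qed
  have m23: "T2 \<inter> T3 \<noteq> {}"
  proof -
    have "of_real (\<sigma> * max X X3) \<in> T3" by (auto simp: T3_def)
    moreover have "of_real (\<sigma> * max X X3) \<in> T2" using \<sigma> by (auto simp: T2_def)
    ultimately show ?thesis by blast
  qed
  have con: "connected (T1 \<union> (T2 \<union> T3))"
    using m12 m23 c1 c2 c3 by (intro connected_Un) auto
  have sub: "T1 \<union> (T2 \<union> T3) \<subseteq> V c"
    using mono x ray X3 by (force simp: T1_def T2_def T3_def V_def)
  have mem: "of_real (\<sigma> * X) \<in> T1 \<union> (T2 \<union> T3)" by (auto simp: T3_def)
  have T1: "T1 \<subseteq> connected_component_set (V c) (of_real (\<sigma> * X))"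
    using connected_component_maximal[OF mem con sub] by blast
  have "x \<in> closure T1"
    unfolding closure_approachable
  proof (intro allI impI)
    fix e :: real assume e: "e > 0"
    have "x + of_real (\<sigma> * (e/2)) \<in> T1" using e unfolding T1_def by (intro imageI) simp
    moreover have "dist (x + of_real (\<sigma> * (e/2))) x < e"
      using e \<sigma> by (auto simp: dist_norm norm_mult)
    ultimately show "\<exists>y\<in>T1. dist y x < e" by blast
  qed
  then show ?thesis using closure_mono[OF T1] by blast
qed

text \<open>As \<open>deriv \<Phi> x0 = 0\<close>, the equation for the second derivative says that
  \<open>ln \<Phi>\<close> has second derivative \<open>- A\<close> in direction \<open>e\<close>: a
  direction of steepest descent of the modulus, oriented towards the right end. The crossing is
  demanded for every small \<open>s\<close> and all large \<open>X\<close> because both are fixed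
  only after further neighbourhoods have been chosen.\<close>

definition saddle_crossing :: "(complex \<Rightarrow> complex) \<Rightarrow> complex \<Rightarrow> complex \<Rightarrow> real \<Rightarrow> real \<Rightarrow> bool" where
  "saddle_crossing \<Phi> x0 e A \<delta> \<longleftrightarrow> \<Phi> x0 \<noteq> 0 \<and> deriv \<Phi> x0 = 0 \<and> A > 0 \<and> cmod e = 1 \<and>
     deriv (deriv \<Phi>) x0 * e\<^sup>2 = - of_real A * \<Phi> x0 \<and> \<delta> > 0 \<and>
     (\<forall>s. 0 < s \<longrightarrow> s < \<delta> \<longrightarrow> (\<exists>X1. \<forall>X\<ge>X1.
        connected_component {x. cmod (\<Phi> x) < cmod (\<Phi> x0)} (- of_real X) (x0 - of_real s * e) \<and>
        connected_component {x. cmod (\<Phi> x) < cmod (\<Phi> x0)} (x0 + of_real s * e) (of_real X)))"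

text \<open>
  The pass is at the infimum \<open>c\<close> of the levels joining the two ends of the real line. The
  components of both ends at level \<open>c\<close> have a critical point of that level in their closures, which
  is the same point by \<open>inj\<close>; being disjoint, they occupy the two sectors at it.
\<close>

theorem mountain_pass:
  fixes \<Phi> :: "complex \<Rightarrow> complex"
  assumes hol: "\<Phi> holomorphic_on UNIV"
    and strip: "\<And>Y C. bounded {x. \<bar>Re x\<bar> \<le> Y \<and> cmod (\<Phi> x) \<le> C}"
    and decay: "\<And>M \<epsilon>. \<epsilon> > 0 \<Longrightarrow> \<exists>X. \<forall>x. \<bar>Im x\<bar> \<le> M \<longrightarrow> \<bar>Re x\<bar> \<ge> X \<longrightarrow> cmod (\<Phi> x) < \<epsilon>"
    and Y0: "Y0 \<ge> 0"
    and mono1: "\<And>x s. Re x \<ge> Y0 \<Longrightarrow> s > 0 \<Longrightarrow> cmod (\<Phi> (x + of_real s)) < cmod (\<Phi> x)"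
    and mono2: "\<And>x s. Re x \<le> - Y0 \<Longrightarrow> s > 0 \<Longrightarrow> cmod (\<Phi> (x - of_real s)) < cmod (\<Phi> x)"
    and nondeg: "\<And>x. \<Phi> x \<noteq> 0 \<Longrightarrow> deriv \<Phi> x = 0 \<Longrightarrow> deriv (deriv \<Phi>) x \<noteq> 0"
    and inj: "\<And>x y. \<Phi> x \<noteq> 0 \<Longrightarrow> deriv \<Phi> x = 0 \<Longrightarrow> deriv \<Phi> y = 0 \<Longrightarrow> cmod (\<Phi> x) = cmod (\<Phi> y) \<Longrightarrow> x = y"
  obtains x0 e A \<delta> where "saddle_crossing \<Phi> x0 e A \<delta>"
proof -

  \<comment> \<open>Levels that join the two ends of the real line\<close>
  define V where "V = (\<lambda>c. {x. cmod (\<Phi> x) < c})"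
  have contn: "continuous_on UNIV (\<lambda>x. cmod (\<Phi> x))"
    using hol holomorphic_on_imp_continuous_on continuous_on_norm by blast
  have opV: "open (V c)" for c unfolding V_def
    using contn by (intro open_Collect_less) auto
  have Vmono: "V c \<subseteq> V c'" if "c \<le> c'" for c c' using that by (auto simp: V_def)
  \<comment> \<open>Beyond \<open>X\<close> both real half-lines lie below level \<open>c\<close>.
    Any two such \<open>X\<close> therefore name the same two components, so being joined does not
    depend on the choice of \<open>X\<close>.\<close>
  define ray where "ray = (\<lambda>c X. X > Y0 \<and> (\<forall>r\<ge>X. cmod (\<Phi> (of_real r)) < c \<and> cmod (\<Phi> (- of_real r)) < c))"
  have ray_ex: "\<exists>X0. \<forall>X\<ge>X0. ray c X" if cp: "c > 0" for c
  proof -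
    obtain X where X: "\<forall>x. \<bar>Im x\<bar> \<le> 0 \<longrightarrow> \<bar>Re x\<bar> \<ge> X \<longrightarrow> cmod (\<Phi> x) < c" using decay[OF cp] by blast
    have "ray c X'" if "X' \<ge> max (Y0 + 1) \<bar>X\<bar>" for X'
      using that X by (auto simp: ray_def)
    then show ?thesis by blast
  qed
  have ray_conn: "connected_component (V c) (of_real X) (of_real X') \<and>
      connected_component (V c) (- of_real X) (- of_real X')" if "ray c X" "ray c X'" for c X X'
  proof -
    define T where "T = (of_real :: real \<Rightarrow> complex) ` {min X X'..}"
    define T' where "T' = (\<lambda>r. - of_real r :: complex) ` {min X X'..}"
    have "connected T" "connected T'" unfolding T_def T'_def
      by (intro connected_continuous_image continuous_intros convex_connected; simp)+
    moreover have "T \<subseteq> V c" "T' \<subseteq> V c" using that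
      by (auto simp: T_def T'_def V_def ray_def min_def split: if_splits)
    moreover have "of_real X \<in> T" "of_real X' \<in> T" "- of_real X \<in> T'" "- of_real X' \<in> T'"
      by (auto simp: T_def T'_def)
    ultimately show ?thesis unfolding connected_component_def by blast
  qed
  define conn where "conn = (\<lambda>c. c > 0 \<and> (\<exists>X. ray c X \<and> connected_component (V c) (- of_real X) (of_real X)))"
  have connD: "connected_component (V c) (- of_real X) (of_real X)" if cc: "conn c" "ray c X" for c X
  proof -
    obtain X' where "ray c X'" "connected_component (V c) (- of_real X') (of_real X')"
      using cc(1) by (auto simp: conn_def)
    then show ?thesis using ray_conn[OF that(2), of X'] ray_conn[of c X' X] that(2)
      by (meson connected_component_trans)
  qed
  have conn_mono: "conn c'" if cc: "conn c" "c \<le> c'" for c c'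
  proof -
    obtain X where "ray c X" "connected_component (V c) (- of_real X) (of_real X)" "c > 0"
      using cc(1) by (auto simp: conn_def)
    moreover from this have "ray c' X" using that(2) by (fastforce simp: ray_def)
    ultimately show ?thesis using that(2) connected_component_mono[OF Vmono[OF that(2)]]
      by (auto simp: conn_def)
  qed
  have "\<exists>c. conn c"
  proof -
    obtain X where X: "\<forall>X'\<ge>X. ray 1 X'" using ray_ex[of 1] by auto
    have "compact (cball (0::complex) \<bar>X\<bar>)" by simp
    then have "bounded ((\<lambda>x. cmod (\<Phi> x)) ` cball 0 \<bar>X\<bar>)"
      using contn by (intro compact_imp_bounded compact_continuous_image) (auto intro: continuous_on_subset)
    then obtain B where B: "\<forall>x \<in> cball 0 \<bar>X\<bar>. cmod (\<Phi> x) \<le> B"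
      unfolding bounded_iff by auto
    define c where "c = \<bar>B\<bar> + 2"
    have real: "cmod (\<Phi> (of_real r)) < c" for r :: real
    proof (cases "\<bar>r\<bar> \<le> \<bar>X\<bar>")
      case True
      then have "cmod (\<Phi> (of_real r)) \<le> B" by (intro B[rule_format]) auto
      then show ?thesis by (auto simp: c_def)
    next
      case False
      have "ray 1 \<bar>r\<bar>" using X False by auto
      then have "cmod (\<Phi> (of_real r)) < 1" unfolding ray_def
        by (metis abs_if minus_minus of_real_minus order_refl)
      then show ?thesis by (auto simp: c_def)
    qed
    have "ray c (Y0 + 1)" using real[of] real[of "- _"] by (simp add: ray_def)
    moreover have "connected_component (V c) (- of_real (Y0+1)) (of_real (Y0+1))"
    proof -
      have "connected (range (of_real :: real \<Rightarrow> complex))"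
        by (intro connected_continuous_image continuous_intros) auto
      moreover have "range (of_real :: real \<Rightarrow> complex) \<subseteq> V c" using real by (auto simp: V_def)
      moreover have "- of_real (Y0+1) \<in> range (of_real :: real \<Rightarrow> complex)" by (metis of_real_minus rangeI)
      ultimately show ?thesis unfolding connected_component_def by blast
    qed
    moreover have "c > 0" by (simp add: c_def)
    ultimately show ?thesis unfolding conn_def by blast
  qed
  \<comment> \<open>Every joining set crosses the line \<open>Re x = Y0\<close>. There
    \<open>mono1\<close> excludes zeros, and compactness makes the modulus bounded away from 0, so
    the joining levels have a positive lower bound.\<close>
  have "\<exists>m>0. \<forall>c. conn c \<longrightarrow> c > m"
  proof -
    define Z where "Z = {x. \<bar>Re x\<bar> \<le> Y0 \<and> cmod (\<Phi> x) \<le> 1} \<inter> {x. Re x = Y0}"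
    have "closed {x. \<bar>Re x\<bar> \<le> Y0 \<and> cmod (\<Phi> x) \<le> 1}"
      using contn by (intro closed_Collect_conj closed_Collect_le) (auto intro!: continuous_intros)
    moreover have "closed {x. Re x = Y0}" by (intro closed_Collect_eq continuous_intros)
    ultimately have "closed Z" unfolding Z_def by (rule closed_Int)
    moreover have "bounded Z" unfolding Z_def by (rule bounded_subset[OF strip[of Y0 1]]) simp
    ultimately have "compact Z" by (simp add: compact_eq_bounded_closed)
    have pos: "cmod (\<Phi> x) > 0" if "Re x = Y0" for x
    proof -
      have "cmod (\<Phi> (x + of_real 1)) < cmod (\<Phi> x)" by (rule mono1) (use that in auto)
      then show ?thesis using norm_ge_zero order_le_less_trans by blast
    qed
    obtain m where m: "m > 0" "m \<le> 1" "\<And>x. x \<in> Z \<Longrightarrow> m \<le> cmod (\<Phi> x)"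
    proof (cases "Z = {}")
      case True then show ?thesis using that[of 1] by auto
    next
      case False
      then obtain x where x: "x \<in> Z" "\<forall>y\<in>Z. cmod (\<Phi> x) \<le> cmod (\<Phi> y)"
        using continuous_attains_inf[OF \<open>compact Z\<close>] contn continuous_on_subset by (metis subset_UNIV)
      show ?thesis using x pos[of x]
        by (intro that[of "min 1 (cmod (\<Phi> x))"]) (auto simp: min_le_iff_disj Z_def)
    qed
    have m': "m \<le> cmod (\<Phi> x)" if "Re x = Y0" for x
      using m that Y0 by (cases "cmod (\<Phi> x) \<le> 1") (auto simp: Z_def)
    have "c > m" if cc: "conn c" for c
    proof -
      obtain X where X: "ray c X" "connected_component (V c) (- of_real X) (of_real X)"
        using cc by (auto simp: conn_def)
      then obtain T where T: "connected T" "T \<subseteq> V c" "- of_real X \<in> T" "of_real X \<in> T"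
        unfolding connected_component_def by blast
      have "\<exists>z\<in>T. (1::complex) \<bullet> z = Y0"
        using X(1) Y0 by (intro connected_ivt_hyperplane[OF T(1,3,4)]) (auto simp: ray_def inner_complex_def)
      then obtain z where "z \<in> T" "Re z = Y0" by (auto simp: inner_complex_def)
      then show ?thesis using m' T(2) by (force simp: V_def)
    qed
    then show ?thesis using m by blast
  qed
  then obtain m where m: "m > 0" "\<And>c. conn c \<Longrightarrow> c > m" by blast

  \<comment> \<open>The critical level\<close>
  define c where "c = Inf {c. conn c}"
  have bdd: "bdd_below {c. conn c}" using m(2) by (auto intro!: bdd_belowI[of _ m] less_imp_le)
  have cpos: "c > 0"
  proof -
    have "m \<le> c" unfolding c_def using \<open>\<exists>c. conn c\<close> m(2)
      by (intro cInf_greatest) (auto intro: less_imp_le)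
    then show ?thesis using m by simp
  qed
  have conn_gt: "conn c'" if "c' > c" for c'
  proof -
    have "\<exists>x\<in>{c. conn c}. x < c'" using that \<open>\<exists>c. conn c\<close> bdd unfolding c_def
      by (subst (asm) cInf_less_iff) auto
    then show ?thesis using conn_mono less_imp_le by blast
  qed
  \<comment> \<open>The infimum is not attained: along a joining path the modulus has a maximum
    below \<open>c\<close>, so a smaller level would join the ends as well.\<close>
  have nconn: "\<not> conn c"
  proof
    assume cc: "conn c"
    obtain X where X: "ray (c/2) X" using ray_ex[of "c/2"] cpos by auto
    have "ray c X" using X cpos by (fastforce simp: ray_def)
    then have "path_component (V c) (- of_real X) (of_real X)"
      using connD[OF cc] opV open_path_connected_component by metis
    then obtain g where g: "path g" "path_image g \<subseteq> V c" "pathstart g = - of_real X" "pathfinish g = of_real X"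
      unfolding path_component_def by blast
    obtain w where w: "w \<in> path_image g" "\<forall>y\<in>path_image g. cmod (\<Phi> y) \<le> cmod (\<Phi> w)"
      using continuous_attains_sup[OF compact_path_image[OF g(1)] path_image_nonempty] contn continuous_on_subset
      by (metis subset_UNIV)
    define M where "M = cmod (\<Phi> w)"
    have M: "M < c" using w g by (auto simp: M_def V_def)
    define c' where "c' = (max M (c/2) + c) / 2"
    have c': "M < c'" "c/2 < c'" "c' < c" using M cpos by (auto simp: c'_def)
    have "ray c' X" using X c' by (fastforce simp: ray_def)
    moreover have "path_image g \<subseteq> V c'" using w c' by (fastforce simp: V_def M_def)
    then have "connected_component (V c') (- of_real X) (of_real X)"
      unfolding connected_component_def using g connected_path_image
      by (metis pathfinish_in_path_image pathstart_in_path_image)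
    ultimately have "conn c'" using c' cpos by (auto simp: conn_def)
    then have "c \<le> c'" unfolding c_def using bdd by (intro cInf_lower) auto
    then show False using c' by simp
  qed
  obtain X0 where X0: "\<And>X. X \<ge> X0 \<Longrightarrow> ray c X" using ray_ex[OF cpos] by blast
  define X where "X = max X0 (Y0 + 1)"
  have rX: "ray c X" using X0 by (simp add: X_def)
  have XY: "X > Y0" by (simp add: X_def)
  have disj: "\<not> connected_component (V c) (- of_real X) (of_real X)"
    using nconn rX cpos by (auto simp: conn_def)
  have con': "connected_component (V c') (- of_real X) (of_real X)" if "c' > c" for c'
  proof -
    have "ray c' X" using rX that by (fastforce simp: ray_def)
    then show ?thesis using connD[OF conn_gt[OF that]] by blast
  qed
  define L where "L = connected_component_set (V c) (- of_real X)"
  define R where "R = connected_component_set (V c) (of_real X)"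
  have dec: "\<exists>X. \<forall>x. \<bar>Im x\<bar> \<le> M \<longrightarrow> \<sigma> * Re x \<ge> X \<longrightarrow> cmod (\<Phi> x) < c" if "\<sigma> = 1 \<or> \<sigma> = -1" for \<sigma> M
  proof -
    obtain X where X: "\<forall>x. \<bar>Im x\<bar> \<le> M \<longrightarrow> \<bar>Re x\<bar> \<ge> X \<longrightarrow> cmod (\<Phi> x) < c" using decay[OF cpos] by blast
    then show ?thesis using that by (intro exI[of _ X]) auto
  qed
  have left: "x \<in> closure L" if "Re x \<le> - Y0" "cmod (\<Phi> x) \<le> c" for x
  proof -
    have "x \<in> closure (connected_component_set {x. cmod (\<Phi> x) < c} (of_real ((-1) * X)))"
      by (rule reaches_end) (use dec[of "-1"] mono2[OF that(1)] rX that(2) in \<open>auto simp: ray_def\<close>)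
    then show ?thesis by (simp add: L_def V_def)
  qed
  have right: "x \<in> closure R" if "Re x \<ge> Y0" "cmod (\<Phi> x) \<le> c" for x
  proof -
    have "x \<in> closure (connected_component_set {x. cmod (\<Phi> x) < c} (of_real (1 * X)))"
      by (rule reaches_end) (use dec[of "1"] mono1[OF that(1)] rX that(2) in \<open>auto simp: ray_def\<close>)
    then show ?thesis by (simp add: R_def V_def)
  qed

  \<comment> \<open>The critical point common to both components\<close>
  have "\<exists>y \<in> closure L. cmod (\<Phi> y) = c \<and> deriv \<Phi> y = 0"
    unfolding L_def V_def
    by (rule critical_point_in_component_closure[where \<sigma>=1 and b="of_real X" and Y=Y0])
       (use hol cpos strip Y0 left right XY disj con' in \<open>auto simp: L_def R_def V_def\<close>)
  then obtain x0 where x0: "x0 \<in> closure L" "cmod (\<Phi> x0) = c" "deriv \<Phi> x0 = 0" by blast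
  have "\<exists>y \<in> closure R. cmod (\<Phi> y) = c \<and> deriv \<Phi> y = 0"
    unfolding R_def V_def
    by (rule critical_point_in_component_closure[where \<sigma>="-1" and b="- of_real X" and Y=Y0])
       (use hol cpos strip Y0 left right XY disj con' in
         \<open>auto simp: L_def R_def V_def connected_component_sym_eq\<close>)
  then obtain y0 where y0: "y0 \<in> closure R" "cmod (\<Phi> y0) = c" "deriv \<Phi> y0 = 0" by blast
  have nz: "\<Phi> x0 \<noteq> 0" using x0 cpos by auto
  have "x0 = y0" using inj[of x0 y0] nz x0 y0 by simp
  then have x0R: "x0 \<in> closure R" using y0 by simp

  \<comment> \<open>The two sectors at the saddle\<close>
  define D where "D = deriv (deriv \<Phi>) x0 / \<Phi> x0"
  have D0: "D \<noteq> 0" using nondeg[OF nz x0(3)] nz by (simp add: D_def)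
  define A where "A = cmod D"
  define e where "e = csqrt (- of_real A / D)"
  have e2: "D * e\<^sup>2 = - of_real A" using D0 by (simp add: e_def)
  have "cmod (e\<^sup>2) = 1" using D0 by (simp add: e_def A_def norm_divide)
  then have e1: "cmod e = 1" by (simp add: norm_power power2_eq_1_iff) (metis norm_ge_zero le_minus_one_simps(3))
  have A: "A > 0" using D0 by (simp add: A_def)
  have ct: "isCont \<Phi> x0" using hol
    by (meson UNIV_I continuous_on_eq_continuous_at holomorphic_on_imp_continuous_on open_UNIV)
  then obtain d where d: "d > 0" "\<And>y. dist x0 y < d \<Longrightarrow> \<Phi> y \<noteq> 0"
    using continuous_at_avoid[OF ct nz] by (metis dist_commute)
  have "\<Phi> holomorphic_on ball x0 d" using hol holomorphic_on_subset by blast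
  then obtain G where G: "G holomorphic_on ball x0 d" "\<And>z. z \<in> ball x0 d \<Longrightarrow> \<Phi> z = exp (G z)"
    and \<Phi>d: "\<And>z. z \<in> ball x0 d \<Longrightarrow> deriv \<Phi> z = \<Phi> z * deriv G z"
    using holomorphic_log_on_ball[of \<Phi> x0 d] d(2) by (metis mem_ball)
  have x0d: "x0 \<in> ball x0 d" using d by simp
  have Gd: "(G has_field_derivative deriv G w) (at w)" if "w \<in> ball x0 d" for w
    using holomorphic_derivI[OF G(1) open_ball that] .
  have G1: "deriv G x0 = 0" using \<Phi>d[OF x0d] x0 nz by simp
  have "(deriv G has_field_derivative deriv (deriv G) x0) (at x0)"
    using holomorphic_derivI[OF holomorphic_deriv[OF G(1) open_ball] open_ball x0d] .
  moreover have "(\<Phi> has_field_derivative deriv \<Phi> x0) (at x0)"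
    using holomorphic_derivI[OF hol open_UNIV] by simp
  ultimately have "((\<lambda>w. \<Phi> w * deriv G w) has_field_derivative (\<Phi> x0 * deriv (deriv G) x0)) (at x0)"
    using G1 x0(3) by (auto intro!: derivative_eq_intros)
  then have "(deriv \<Phi> has_field_derivative (\<Phi> x0 * deriv (deriv G) x0)) (at x0)"
    by (rule has_field_derivative_transform_within_open[OF _ open_ball x0d]) (simp add: \<Phi>d)
  then have dd: "deriv (deriv \<Phi>) x0 = \<Phi> x0 * deriv (deriv G) x0" by (rule DERIV_imp_deriv)
  \<comment> \<open>Passing to a logarithm turns \<open>cmod (\<Phi> w) < c\<close> into
    \<open>Re (f w) < 0\<close>, the form that \<open>saddle_sectors\<close> needs.\<close>
  define f where "f = (\<lambda>w. G w - G x0)"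
  have fhol: "f holomorphic_on ball x0 d" unfolding f_def using G(1) by (intro holomorphic_intros)
  have fd: "deriv f w = deriv G w" if "w \<in> ball x0 d" for w
    unfolding f_def using Gd[OF that] by (intro DERIV_imp_deriv) (auto intro!: derivative_eq_intros)
  have "deriv (deriv f) x0 = deriv (deriv G) x0"
    by (rule complex_derivative_transform_within_open[of _ "ball x0 d"])
       (use fhol G(1) x0d fd in \<open>auto intro!: holomorphic_deriv\<close>)
  then have f2: "deriv (deriv f) x0 * e\<^sup>2 = - of_real A" using e2 dd nz by (simp add: D_def)
  have fneg: "Re (f w) < 0 \<longleftrightarrow> cmod (\<Phi> w) < c" if "w \<in> ball x0 d" for w
  proof -
    have "cmod (\<Phi> w) = exp (Re (G w))" "c = exp (Re (G x0))" using G(2) that x0d x0(2) by auto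
    then show ?thesis by (simp add: f_def)
  qed
  obtain N S1 S2 \<delta> where N: "open N" "x0 \<in> N" "N \<subseteq> ball x0 d" "connected S1" "connected S2"
    "{x \<in> N. Re (f x) < 0} = S1 \<union> S2" "\<delta> > 0"
    "\<And>s. 0 < s \<Longrightarrow> s < \<delta> \<Longrightarrow> x0 + of_real s * e \<in> S1 \<and> x0 - of_real s * e \<in> S2"
  proof (rule saddle_sectors[OF fhol d(1) _ _ f2 A])
    show "f x0 = 0" by (simp add: f_def)
    show "deriv f x0 = 0" using fd[OF x0d] G1 by simp
  qed (use that in blast)
  have S12: "S1 \<union> S2 = N \<inter> V c" unfolding N(6)[symmetric] V_def using fneg N(3) by blast
  have LV: "L \<subseteq> V c" "R \<subseteq> V c" unfolding L_def R_def by (rule connected_component_subset)+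
  have LR: "L \<inter> R = {}" unfolding L_def R_def
    using disj connected_component_nonoverlap[of "V c" "- of_real X" "of_real X"]
      connected_component_eq_eq[of "V c" "- of_real X" "of_real X"] by blast
  have sub: "S \<subseteq> C" if SC: "connected S" "S \<subseteq> V c" "S \<inter> C \<noteq> {}" "C = connected_component_set (V c) a" for S C a
  proof -
    obtain w where w: "w \<in> S" "w \<in> C" using SC(3) by blast
    have "S \<subseteq> connected_component_set (V c) w" using w that by (intro connected_component_maximal)
    also have "\<dots> = C" using w that(4) by (metis connected_component_eq)
    finally show ?thesis .
  qed
  have "L \<inter> N \<noteq> {}" "R \<inter> N \<noteq> {}" using x0(1) x0R N(1,2) open_Int_closure_eq_empty[OF N(1)] by blast+
  then have "L \<inter> (S1 \<union> S2) \<noteq> {}" "R \<inter> (S1 \<union> S2) \<noteq> {}" using S12 LV by blast+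
  then have "(S1 \<inter> L \<noteq> {} \<or> S2 \<inter> L \<noteq> {}) \<and> (S1 \<inter> R \<noteq> {} \<or> S2 \<inter> R \<noteq> {})" by blast
  then have "(S1 \<subseteq> L \<or> S2 \<subseteq> L) \<and> (S1 \<subseteq> R \<or> S2 \<subseteq> R)"
    using sub[OF N(4) _ _ L_def] sub[OF N(5) _ _ L_def] sub[OF N(4) _ _ R_def] sub[OF N(5) _ _ R_def]
      S12 by (metis Int_lower2 Un_subset_iff)
  moreover have "S1 \<noteq> {}" "S2 \<noteq> {}" using N(8)[of "\<delta>/2"] N(7) by auto
  ultimately have cases: "(S1 \<subseteq> R \<and> S2 \<subseteq> L) \<or> (S1 \<subseteq> L \<and> S2 \<subseteq> R)" using LR by blast
  \<comment> \<open>It is not known in advance which sector belongs to which end, so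
    \<open>e\<close> may have to be replaced by \<open>- e\<close>; its square is the same.\<close>
  obtain \<epsilon> where \<epsilon>: "\<epsilon> = 1 \<or> \<epsilon> = (-1::complex)"
    "\<And>s. 0 < s \<Longrightarrow> s < \<delta> \<Longrightarrow> x0 + of_real s * (\<epsilon> * e) \<in> R \<and> x0 - of_real s * (\<epsilon> * e) \<in> L"
  proof (cases "S1 \<subseteq> R \<and> S2 \<subseteq> L")
    case True
    then show ?thesis using N(8) by (intro that[of 1]) auto
  next
    case False
    then have "S1 \<subseteq> L" "S2 \<subseteq> R" using cases by auto
    then show ?thesis using N(8) by (intro that[of "-1"]) (auto simp: subset_eq)
  qed
  show ?thesis
  proof (rule that, unfold saddle_crossing_def, intro conjI allI impI)
    show "\<Phi> x0 \<noteq> 0" "deriv \<Phi> x0 = 0" "A > 0" "\<delta> > 0" by (fact nz x0(3) A N(7))+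
    show "cmod (\<epsilon> * e) = 1" using \<epsilon>(1) e1 by (auto simp: norm_mult)
    show "deriv (deriv \<Phi>) x0 * (\<epsilon> * e)\<^sup>2 = - of_real A * \<Phi> x0"
      using \<epsilon>(1) e2 nz by (auto simp: D_def power_mult_distrib field_simps)
    fix s :: real assume s: "0 < s" "s < \<delta>"
    show "\<exists>X1. \<forall>X\<ge>X1.
        connected_component {x. cmod (\<Phi> x) < cmod (\<Phi> x0)} (- of_real X) (x0 - of_real s * (\<epsilon> * e)) \<and>
        connected_component {x. cmod (\<Phi> x) < cmod (\<Phi> x0)} (x0 + of_real s * (\<epsilon> * e)) (of_real X)"
    proof (intro exI[of _ X0] allI impI)
      fix X' assume "X' \<ge> X0"
      then have r: "ray c X'" using X0 by blast
      have 1: "connected_component (V c) (of_real X) (x0 + of_real s * (\<epsilon> * e))"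
        "connected_component (V c) (- of_real X) (x0 - of_real s * (\<epsilon> * e))"
        using \<epsilon>(2)[OF s] by (auto simp: L_def R_def)
      then show "connected_component {x. cmod (\<Phi> x) < cmod (\<Phi> x0)} (- of_real X') (x0 - of_real s * (\<epsilon> * e)) \<and>
        connected_component {x. cmod (\<Phi> x) < cmod (\<Phi> x0)} (x0 + of_real s * (\<epsilon> * e)) (of_real X')"
        using ray_conn[OF r rX] ray_conn[OF rX r]
        unfolding x0(2) V_def[symmetric, THEN fun_cong, simplified]
        by (metis (no_types, lifting) V_def connected_component_sym connected_component_trans)
    qed
  qed
qed

section \<open>Polynomials times Gaussians\<close>

lemma complex_poly_root_product:
  fixes p :: "complex poly"
  assumes "p \<noteq> 0"
  obtains A where "size A = degree p" "\<And>x. poly p x = lead_coeff p * (\<Prod>a\<in>#A. x - a)"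
proof -
  define A where "A = proots p"
  have A: "size A = degree p" "smult (lead_coeff p) (\<Prod>a\<in>#A. [:- a, 1:]) = p"
    by (simp_all add: A_def size_proots_complex complex_poly_decompose_multiset)
  have "poly (\<Prod>a\<in>#A. [:- a, 1:]) x = (\<Prod>a\<in>#A. x - a)" for x
    by (induction A) (auto simp: algebra_simps)
  then have "poly p x = lead_coeff p * (\<Prod>a\<in>#A. x - a)" for x
    by (subst A(2)[symmetric]) simp
  then show ?thesis using that A(1) by blast
qed

lemma prod_mset_norm_mono:
  fixes f :: "complex \<Rightarrow> complex" and g :: "complex \<Rightarrow> real"
  assumes "\<And>a. a \<in># A \<Longrightarrow> cmod (f a) \<le> g a"
  shows "cmod (\<Prod>a\<in>#A. f a) \<le> (\<Prod>a\<in>#A. g a)"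
  using assms
proof (induction A)
  case (add x A)
  have "cmod (f x * (\<Prod>a\<in>#A. f a)) \<le> g x * (\<Prod>a\<in>#A. g a)"
    unfolding norm_mult using add by (intro mult_mono) (auto intro: order_trans[OF norm_ge_zero])
  then show ?case by simp
qed auto

lemma prod_mset_norm_ge:
  fixes f :: "complex \<Rightarrow> complex"
  assumes "\<And>a. a \<in># A \<Longrightarrow> cmod (f a) \<ge> \<rho>" "\<rho> \<ge> 0"
  shows "cmod (\<Prod>a\<in>#A. f a) \<ge> \<rho> ^ size A"
  using assms
proof (induction A)
  case (add x A)
  have "\<rho> * \<rho> ^ size A \<le> cmod (f x) * cmod (\<Prod>a\<in>#A. f a)"
    using add by (intro mult_mono) auto
  then show ?case by (simp add: norm_mult)
qed auto

text \<open>If every root were farther from \<open>x\<close>, the product of the linear factors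
  would be too large. This is a quantitative continuity of roots: a small value together with a
  known leading coefficient forces a root nearby.\<close>

lemma poly_nearest_root:
  fixes p :: "complex poly"
  assumes "degree p > 0"
  obtains w where "poly p w = 0" "cmod (lead_coeff p) * cmod (x - w) ^ degree p \<le> cmod (poly p x)"
proof -
  have p0: "p \<noteq> 0" using assms by auto
  obtain A where A: "size A = degree p" "\<And>x. poly p x = lead_coeff p * (\<Prod>a\<in>#A. x - a)"
    using complex_poly_root_product[OF p0] by blast
  have "A \<noteq> {#}" using A(1) assms by auto
  then have ne: "set_mset A \<noteq> {}" by simp
  define w where "w = (ARG_MIN (\<lambda>a. cmod (x - a)) a. a \<in> set_mset A)"
  have w: "w \<in> set_mset A" "\<And>a. a \<in> set_mset A \<Longrightarrow> cmod (x - w) \<le> cmod (x - a)"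
    using arg_min_if_finite(1)[OF finite_set_mset ne, of "\<lambda>a. cmod (x - a)"]
      arg_min_least[OF finite_set_mset ne, of _ "\<lambda>a. cmod (x - a)"]
    by (auto simp: w_def arg_min_on_def)
  have "poly p w = 0" unfolding A(2) using w(1) by (auto simp: prod_mset_zero_iff)
  moreover have "cmod (x - w) ^ size A \<le> cmod (\<Prod>a\<in>#A. x - a)"
    using w by (intro prod_mset_norm_ge) auto
  then have "cmod (lead_coeff p) * cmod (x - w) ^ degree p \<le> cmod (poly p x)"
    unfolding A(2)[of x] norm_mult A(1) by (intro mult_left_mono) auto
  ultimately show ?thesis using that by blast
qed

text \<open>Outside a disc that keeps every root at distance at least 1, a shift by \<open>h\<close>
  enlarges each linear factor at most by \<open>1 + cmod h\<close>. The resulting exponential rate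
  is what a Gaussian has to beat.\<close>

lemma poly_shift_bound:
  fixes p :: "complex poly"
  assumes "p \<noteq> 0"
  obtains B where "B \<ge> 0" "\<And>x h. cmod x \<ge> B \<Longrightarrow> poly p x \<noteq> 0 \<and> cmod (poly p (x + h)) \<le> cmod (poly p x) * exp (real (degree p) * cmod h)"
    "\<And>x. cmod x \<ge> B \<Longrightarrow> cmod (poly p x) \<ge> cmod (lead_coeff p)"
proof -
  obtain A where A: "size A = degree p" "\<And>x. poly p x = lead_coeff p * (\<Prod>a\<in>#A. x - a)"
    using complex_poly_root_product[OF assms] by blast
  obtain R where R: "\<And>a. a \<in># A \<Longrightarrow> cmod a \<le> R"
    using finite_set_mset[of A] by (metis bounded_iff finite_imp_bounded)
  define B where "B = max 0 R + 1"
  have far: "cmod (x - a) \<ge> 1" if "a \<in># A" "cmod x \<ge> B" for a x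
    using R[OF that(1)] that(2) norm_triangle_ineq2[of x a] by (auto simp: B_def)
  have lc: "lead_coeff p \<noteq> 0" using assms by simp
  show ?thesis
  proof (rule that[of B])
    show "B \<ge> 0" by (simp add: B_def)
    fix x :: complex assume x: "cmod x \<ge> B"
    have "1 ^ size A \<le> cmod (\<Prod>a\<in>#A. x - a)" using far x by (intro prod_mset_norm_ge) auto
    then show "cmod (poly p x) \<ge> cmod (lead_coeff p)"
      unfolding A(2)[of x] norm_mult using mult_left_mono[of 1 "cmod (\<Prod>a\<in>#A. x - a)" "cmod (lead_coeff p)"] by simp
    fix h :: complex
    have 1: "cmod (x + h - a) \<le> cmod (x - a) * exp (cmod h)" if "a \<in># A" for a
    proof -
      have "cmod (x + h - a) \<le> cmod (x - a) + cmod h" using norm_triangle_ineq[of "x - a" h] by (simp add: algebra_simps)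
      also have "\<dots> \<le> cmod (x - a) * (1 + cmod h)"
        using mult_right_mono[OF far[OF that x], of "cmod h"] by (simp add: algebra_simps)
      also have "\<dots> \<le> cmod (x - a) * exp (cmod h)" by (intro mult_left_mono exp_ge_add_one_self) auto
      finally show ?thesis .
    qed
    have "cmod (\<Prod>a\<in>#A. x + h - a) \<le> (\<Prod>a\<in>#A. cmod (x - a) * exp (cmod h))"
      using 1 by (rule prod_mset_norm_mono)
    also have "\<dots> = cmod (\<Prod>a\<in>#A. x - a) * exp (real (size A) * cmod h)"
      by (induction A) (auto simp: norm_mult mult_ac exp_add distrib_left)
    finally have "cmod (poly p (x + h)) \<le> cmod (poly p x) * exp (real (degree p) * cmod h)"
      unfolding A(2) norm_mult A(1)[symmetric] using mult_left_mono norm_ge_zero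
      by (metis mult.assoc)
    moreover have "poly p x \<noteq> 0" unfolding A(2) using lc far[OF _ x] by (force simp: prod_mset_zero_iff)
    ultimately show "poly p x \<noteq> 0 \<and> cmod (poly p (x + h)) \<le> cmod (poly p x) * exp (real (degree p) * cmod h)"
      by blast
  qed
qed

lemma poly_norm_growth:
  fixes p :: "complex poly"
  obtains B where "B > 0" "\<And>x. cmod (poly p x) \<le> B * (1 + cmod x) ^ degree p"
proof -
  define B where "B = (\<Sum>i\<le>degree p. cmod (coeff p i)) + 1"
  have "cmod (poly p x) \<le> B * (1 + cmod x) ^ degree p" for x
  proof -
    have "cmod (poly p x) \<le> (\<Sum>i\<le>degree p. cmod (coeff p i * x ^ i))"
      unfolding poly_altdef by (rule norm_sum)
    also have "\<dots> \<le> (\<Sum>i\<le>degree p. cmod (coeff p i) * (1 + cmod x) ^ degree p)"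
    proof (rule sum_mono)
      fix i assume "i \<in> {..degree p}"
      then have "cmod x ^ i \<le> (1 + cmod x) ^ degree p"
        using power_mono[of "cmod x" "1 + cmod x" i] power_increasing[of i "degree p" "1 + cmod x"] by simp
      then show "cmod (coeff p i * x ^ i) \<le> cmod (coeff p i) * (1 + cmod x) ^ degree p"
        by (simp add: norm_mult norm_power mult_left_mono)
    qed
    also have "\<dots> \<le> B * (1 + cmod x) ^ degree p"
      by (simp add: B_def sum_distrib_right[symmetric] mult_right_mono)
    finally show ?thesis .
  qed
  moreover have "B > 0" unfolding B_def by (intro add_nonneg_pos sum_nonneg) auto
  ultimately show ?thesis using that by blast
qed

definition gauss_poly :: "complex poly \<Rightarrow> real \<Rightarrow> complex \<Rightarrow> complex" where
  "gauss_poly p k x = poly p x * exp (- (of_real k * x\<^sup>2 / 2))"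

text \<open>The polynomial factor of the derivative of \<open>gauss_poly p k\<close>. The
  exponential factor has no zeros, so the roots of this polynomial are the critical points.\<close>

definition saddle_eqn :: "complex poly \<Rightarrow> real \<Rightarrow> complex poly" where
  "saddle_eqn p k = pderiv p - [:0, of_real k:] * p"

text \<open>Zeros of \<open>p\<close> are exempt: multiple ones are critical points too, but of
  value 0, while the level of the pass is positive.\<close>

definition generic_saddles :: "complex poly \<Rightarrow> real \<Rightarrow> bool" where
  "generic_saddles p k \<longleftrightarrow>
     (\<forall>x. poly p x \<noteq> 0 \<longrightarrow> poly (saddle_eqn p k) x = 0 \<longrightarrow> poly (pderiv (saddle_eqn p k)) x \<noteq> 0) \<and>
     inj_on (\<lambda>x. cmod (gauss_poly p k x)) {x. poly p x \<noteq> 0 \<and> poly (saddle_eqn p k) x = 0}"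

lemma gauss_poly_zero_iff [simp]: "gauss_poly p k x = 0 \<longleftrightarrow> poly p x = 0"
  by (simp add: gauss_poly_def)

lemma has_field_derivative_gauss_poly:
  "(gauss_poly p k has_field_derivative gauss_poly (saddle_eqn p k) k x) (at x)"
  unfolding gauss_poly_def [abs_def] saddle_eqn_def
  by (rule derivative_eq_intros poly_DERIV refl | simp)+ (simp add: algebra_simps)

lemma deriv_gauss_poly: "deriv (gauss_poly p k) = gauss_poly (saddle_eqn p k) k"
  using has_field_derivative_gauss_poly DERIV_imp_deriv by blast

lemma holomorphic_gauss_poly [holomorphic_intros]: "gauss_poly p k holomorphic_on S"
  using has_field_derivative_gauss_poly
  by (meson field_differentiable_at_within field_differentiable_def holomorphic_onI)

lemma norm_gauss_poly:
  "cmod (gauss_poly p k x) = cmod (poly p x) * exp (k * ((Im x)\<^sup>2 - (Re x)\<^sup>2) / 2)"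
  by (simp add: gauss_poly_def norm_mult Re_power2 algebra_simps diff_divide_distrib)

lemma mountain_pass_gauss_poly:
  assumes p: "p \<noteq> 0" and k: "k > 0"
    and gen: "generic_saddles p k"
  obtains x0 e A \<delta> where "saddle_crossing (gauss_poly p k) x0 e A \<delta>"
proof -
  define \<Phi> where "\<Phi> = gauss_poly p k"
  have inj: "x = y" if "poly p x \<noteq> 0" "poly p y \<noteq> 0" "poly (saddle_eqn p k) x = 0" "poly (saddle_eqn p k) y = 0"
      "cmod (gauss_poly p k x) = cmod (gauss_poly p k y)" for x y
    by (rule inj_onD[OF conjunct2[OF gen[unfolded generic_saddles_def]] that(5)]) (use that in auto)
  obtain B where B: "B \<ge> 0" "\<And>x h. cmod x \<ge> B \<Longrightarrow> poly p x \<noteq> 0 \<and> cmod (poly p (x + h)) \<le> cmod (poly p x) * exp (real (degree p) * cmod h)"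
    "\<And>x. cmod x \<ge> B \<Longrightarrow> cmod (poly p x) \<ge> cmod (lead_coeff p)"
    using poly_shift_bound[OF p] by metis
  have lc: "cmod (lead_coeff p) > 0" using p by simp
  \<comment> \<open>Where \<open>k * \<bar>Re x\<bar>\<close> exceeds \<open>degree p\<close>, the
    Gaussian decays faster than \<open>poly_shift_bound\<close> lets the polynomial grow.\<close>
  define Y0 where "Y0 = max B (real (degree p) / k)"
  have step: "cmod (gauss_poly p k (x + of_real (\<sigma> * s))) < cmod (gauss_poly p k x)"
    if x: "\<sigma> * Re x \<ge> Y0" and s: "s > 0" and \<sigma>: "\<sigma> = 1 \<or> \<sigma> = -1" for \<sigma> x s
  proof -
    have "\<bar>Re x\<bar> \<ge> B" using x \<sigma> by (auto simp: Y0_def)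
    then have xB: "cmod x \<ge> B" using abs_Re_le_cmod[of x] by linarith
    have 1: "cmod (poly p (x + of_real (\<sigma> * s))) \<le> cmod (poly p x) * exp (real (degree p) * s)"
      using B(2)[OF xB, of "of_real (\<sigma> * s)"] s \<sigma> by (auto simp: norm_mult)
    have "real (degree p) \<le> k * (\<sigma> * Re x)" using x k by (simp add: Y0_def field_simps)
    then have "real (degree p) * s \<le> k * (\<sigma> * Re x) * s" using s by (intro mult_right_mono) auto
    moreover have "k * s * s > 0" using k s by simp
    moreover have "(Re x + \<sigma> * s)\<^sup>2 = (Re x)\<^sup>2 + 2 * (\<sigma> * Re x) * s + s * s"
      using \<sigma> by (auto simp: power2_eq_square algebra_simps)
    then have "k * ((Im x)\<^sup>2 - (Re x + \<sigma> * s)\<^sup>2) / 2 = k * ((Im x)\<^sup>2 - (Re x)\<^sup>2) / 2 - k * (\<sigma> * Re x) * s - k * s * s / 2"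
      by (simp add: field_simps)
    ultimately have 2: "real (degree p) * s + k * ((Im x)\<^sup>2 - (Re x + \<sigma> * s)\<^sup>2) / 2 < k * ((Im x)\<^sup>2 - (Re x)\<^sup>2) / 2"
      by linarith
    have "cmod (gauss_poly p k (x + of_real (\<sigma> * s))) \<le> cmod (poly p x) * exp (real (degree p) * s) * exp (k * ((Im x)\<^sup>2 - (Re x + \<sigma> * s)\<^sup>2) / 2)"
      unfolding norm_gauss_poly using 1 by (intro mult_mono) auto
    also have "\<dots> = cmod (poly p x) * exp (real (degree p) * s + k * ((Im x)\<^sup>2 - (Re x + \<sigma> * s)\<^sup>2) / 2)"
      by (simp add: exp_add)
    also have "\<dots> < cmod (gauss_poly p k x)" unfolding norm_gauss_poly
      using 2 B(2)[OF xB, of 0] by (intro mult_strict_left_mono) auto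
    finally show ?thesis .
  qed
  show ?thesis
  proof (rule mountain_pass[of \<Phi> Y0])
    show "\<Phi> holomorphic_on UNIV" unfolding \<Phi>_def by (rule holomorphic_gauss_poly)
    show "Y0 \<ge> 0" using B(1) by (simp add: Y0_def)
    show "cmod (\<Phi> (x + of_real s)) < cmod (\<Phi> x)" if "Re x \<ge> Y0" "s > 0" for x s
      using step[of 1 x s] that by (simp add: \<Phi>_def)
    show "cmod (\<Phi> (x - of_real s)) < cmod (\<Phi> x)" if "Re x \<le> - Y0" "s > 0" for x s
      using step[of "-1" x s] that by (simp add: \<Phi>_def)
    show "deriv (deriv \<Phi>) x \<noteq> 0" if "\<Phi> x \<noteq> 0" "deriv \<Phi> x = 0" for x
      using that gen unfolding generic_saddles_def \<Phi>_def deriv_gauss_poly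
      by (auto simp: saddle_eqn_def[of "saddle_eqn p k"])
    show "x = y" if "\<Phi> x \<noteq> 0" "deriv \<Phi> x = 0" "deriv \<Phi> y = 0" "cmod (\<Phi> x) = cmod (\<Phi> y)" for x y
    proof -
      have "\<Phi> y \<noteq> 0" using that by (metis norm_eq_zero)
      then show ?thesis using that inj[of x y] unfolding \<Phi>_def deriv_gauss_poly by auto
    qed
    show "bounded {x. \<bar>Re x\<bar> \<le> Y \<and> cmod (\<Phi> x) \<le> C}" for Y C
    proof -
      \<comment> \<open>In the strip and outside the disc of radius \<open>B\<close> the modulus is
        at least \<open>l * exp (k * (Im x)\<^sup>2 / 2)\<close>. The radius \<open>M\<close> is
        chosen so that already the linear lower bound of the exponential exceeds
        \<open>\<bar>C\<bar> / l\<close>.\<close>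
      define l where "l = cmod (lead_coeff p) * exp (- k * Y\<^sup>2 / 2)"
      have l: "l > 0" using lc by (simp add: l_def)
      define M where "M = max B (\<bar>Y\<bar> + 1 + 2 / k * (\<bar>C\<bar> / l + 1))"
      have "cmod x \<le> M" if x: "\<bar>Re x\<bar> \<le> Y" "cmod (\<Phi> x) \<le> C" for x
      proof (rule ccontr)
        assume "\<not> cmod x \<le> M"
        then have xM: "cmod x > B" "cmod x > \<bar>Y\<bar> + 1 + 2 / k * (\<bar>C\<bar> / l + 1)" by (auto simp: M_def)
        have "cmod x \<le> \<bar>Re x\<bar> + \<bar>Im x\<bar>" by (rule cmod_le)
        then have im: "\<bar>Im x\<bar> > 1 + 2 / k * (\<bar>C\<bar> / l + 1)" using xM x(1) by linarith
        have pos: "0 < 2 / k * (\<bar>C\<bar> / l + 1)" using k l by (intro mult_pos_pos add_nonneg_pos) auto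
        have "\<bar>Im x\<bar> * 1 \<le> \<bar>Im x\<bar> * \<bar>Im x\<bar>" using im pos by (intro mult_left_mono) linarith+
        then have im2: "(Im x)\<^sup>2 > 2 / k * (\<bar>C\<bar> / l + 1)" using im by (simp add: power2_eq_square)
        have "k / 2 * (2 / k * (\<bar>C\<bar> / l + 1)) < k / 2 * (Im x)\<^sup>2" using im2 k by (intro mult_strict_left_mono) auto
        then have "\<bar>C\<bar> / l < k * (Im x)\<^sup>2 / 2" using k by simp
        also have "\<dots> \<le> exp (k * (Im x)\<^sup>2 / 2)" using exp_ge_add_one_self[of "k * (Im x)\<^sup>2 / 2"] by linarith
        finally have "\<bar>C\<bar> < l * exp (k * (Im x)\<^sup>2 / 2)" using l by (simp add: field_simps)
        also have "\<dots> = cmod (lead_coeff p) * exp (k * ((Im x)\<^sup>2 - Y\<^sup>2) / 2)"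
          by (simp add: l_def exp_add[symmetric] mult.assoc) (simp add: algebra_simps diff_divide_distrib)
        also have "\<dots> \<le> cmod (\<Phi> x)"
        proof -
          have "(Re x)\<^sup>2 \<le> Y\<^sup>2" using x(1) by (metis abs_ge_zero power2_abs power_mono)
          then have "k * ((Im x)\<^sup>2 - Y\<^sup>2) / 2 \<le> k * ((Im x)\<^sup>2 - (Re x)\<^sup>2) / 2" using k by simp
          then show ?thesis unfolding \<Phi>_def norm_gauss_poly using B(3)[of x] xM by (intro mult_mono) auto
        qed
        finally show False using x by simp
      qed
      then show ?thesis unfolding bounded_iff by blast
    qed
    show "\<exists>X. \<forall>x. \<bar>Im x\<bar> \<le> M \<longrightarrow> \<bar>Re x\<bar> \<ge> X \<longrightarrow> cmod (\<Phi> x) < \<epsilon>" if \<epsilon>: "\<epsilon> > 0" for M \<epsilon>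
    proof -
      obtain D where D: "D > 0" "\<And>x. cmod (poly p x) \<le> D * (1 + cmod x) ^ degree p"
        using poly_norm_growth by blast
      have "((\<lambda>t::real. D * (1 + t + M) ^ degree p * exp (k * (M\<^sup>2 - t\<^sup>2) / 2)) \<longlongrightarrow> 0) at_top"
        using k by real_asymp
      then have "\<forall>\<^sub>F t in at_top. D * (1 + t + M) ^ degree p * exp (k * (M\<^sup>2 - t\<^sup>2) / 2) < \<epsilon>"
        using \<epsilon> by (rule order_tendstoD(2))
      then obtain X where X: "\<And>t. t \<ge> X \<Longrightarrow> D * (1 + t + M) ^ degree p * exp (k * (M\<^sup>2 - t\<^sup>2) / 2) < \<epsilon>"
        unfolding eventually_at_top_linorder by blast
      have "cmod (\<Phi> x) < \<epsilon>" if x: "\<bar>Im x\<bar> \<le> M" "\<bar>Re x\<bar> \<ge> X" for x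
      proof -
        have "cmod (poly p x) \<le> D * (1 + cmod x) ^ degree p" by (rule D)
        also have "\<dots> \<le> D * (1 + \<bar>Re x\<bar> + M) ^ degree p"
          using cmod_le[of x] x D(1) by (intro mult_left_mono power_mono) auto
        finally have 1: "cmod (poly p x) \<le> D * (1 + \<bar>Re x\<bar> + M) ^ degree p" .
        have "(Im x)\<^sup>2 \<le> M\<^sup>2" using x(1) by (metis abs_ge_zero power2_abs power_mono)
        then have "k * ((Im x)\<^sup>2 - (Re x)\<^sup>2) / 2 \<le> k * (M\<^sup>2 - \<bar>Re x\<bar>\<^sup>2) / 2" using k by simp
        then have "cmod (\<Phi> x) \<le> D * (1 + \<bar>Re x\<bar> + M) ^ degree p * exp (k * (M\<^sup>2 - \<bar>Re x\<bar>\<^sup>2) / 2)"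
          unfolding \<Phi>_def norm_gauss_poly using 1 by (intro mult_mono) (auto intro: order_trans[OF norm_ge_zero])
        also have "\<dots> < \<epsilon>" using X x(2) by blast
        finally show ?thesis .
      qed
      then show ?thesis by blast
    qed
  qed (use that in \<open>simp add: \<Phi>_def\<close>)
qed

section \<open>Uniform saddle point estimate\<close>

text \<open>The Taylor remainder is at most \<open>exp s * s\<close>; since
  \<open>s \<le> exp s - 1\<close>, doubling the exponent absorbs the linear factor.\<close>

lemma norm_exp_minus_one_le:
  fixes \<xi> :: complex
  assumes "cmod \<xi> \<le> s"
  shows "cmod (exp \<xi> - 1) \<le> exp (2 * s) - 1"
proof -
  have s: "s \<ge> 0" using assms norm_ge_zero order_trans by blast
  have "cmod (exp \<xi> - 1) \<le> exp \<bar>Re \<xi>\<bar> * cmod \<xi>"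
    using Taylor_exp[of \<xi> 0] by simp
  also have "\<dots> \<le> exp s * s"
    using assms abs_Re_le_cmod[of \<xi>] by (intro mult_mono) auto
  also have "\<dots> \<le> exp s * (exp s - 1)"
    using exp_ge_add_one_self[of s] by (intro mult_left_mono) (linarith, simp)
  also have "\<dots> = exp (2 * s) - exp s" by (simp add: algebra_simps flip: exp_add)
  also have "\<dots> \<le> exp (2 * s) - 1" using s by simp
  finally show ?thesis .
qed

text \<open>The integrand is twice a Gaussian minus one that is wider by the factor
  \<open>sqrt 2\<close>. By rescaling, the wider one has at most \<open>sqrt 2 \<le> 3/2\<close>
  times the integral of the narrow one, and \<open>2 - 3/2 = 1/2\<close> is left.\<close>

lemma integral_gaussian_defect:
  fixes \<beta> \<delta> :: real
  assumes \<beta>: "\<beta> \<ge> 0" and \<delta>: "\<delta> > 0"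
  shows "integral {-\<delta>..\<delta>} (\<lambda>v. exp (- \<beta> * v\<^sup>2) * (2 - exp (\<beta> * v\<^sup>2 / 2))) \<ge> integral {-\<delta>..\<delta>} (\<lambda>v. exp (- \<beta> * v\<^sup>2)) / 2"
proof -
  define I where "I = integral {-\<delta>..\<delta>} (\<lambda>v. exp (- \<beta> * v\<^sup>2))"
  define s where "s = sqrt 2"
  have s: "s > 0" "s\<^sup>2 = 2" "s \<le> 3/2"
    unfolding s_def by (simp, simp, rule real_le_lsqrt) (auto simp: power2_eq_square)
  have int: "(\<lambda>v. exp (- \<beta> * v\<^sup>2)) integrable_on {a..b}" for a b
    by (intro integrable_continuous_real continuous_intros)
  have int2: "(\<lambda>v. exp (- \<beta> * v\<^sup>2 / 2)) integrable_on {a..b}" for a b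
    by (intro integrable_continuous_real continuous_intros) auto
  have hi: "((\<lambda>v. exp (- \<beta> * v\<^sup>2 / 2)) has_integral (s * integral {-(\<delta>/s)..\<delta>/s} (\<lambda>v. exp (- \<beta> * v\<^sup>2)))) {-\<delta>..\<delta>}"
  proof -
    have "((\<lambda>x. exp (- \<beta> * (1 / s * x)\<^sup>2)) has_integral
       integral {-(\<delta>/s)..\<delta>/s} (\<lambda>v. exp (- \<beta> * v\<^sup>2)) /\<^sub>R \<bar>1 / s\<bar>) ((\<lambda>x. x / (1 / s)) ` {-(\<delta>/s)..\<delta>/s})"
      using has_integral_stretch_real[OF integrable_integral[OF int], of "1/s" "-(\<delta>/s)" "\<delta>/s"] s by simp
    moreover have "(\<lambda>x. x / (1 / s)) ` {-(\<delta>/s)..\<delta>/s} = {-\<delta>..\<delta>}"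
    proof -
      have "(\<lambda>x. x / (1 / s)) = (*) s" by (auto simp: mult.commute)
      then have "(\<lambda>x. x / (1 / s)) ` {-(\<delta>/s)..\<delta>/s} = {s * - (\<delta>/s)..s * (\<delta>/s)}"
        by (simp only: image_mult_atLeastAtMost[OF s(1)])
      then show ?thesis using s by simp
    qed
    moreover have "(\<lambda>x. exp (- \<beta> * (1 / s * x)\<^sup>2)) = (\<lambda>v. exp (- \<beta> * v\<^sup>2 / 2))"
      using s by (simp add: power_mult_distrib power_divide)
    ultimately show ?thesis using s by simp
  qed
  have "integral {-(\<delta>/s)..\<delta>/s} (\<lambda>v. exp (- \<beta> * v\<^sup>2)) \<le> I"
    unfolding I_def
  proof (rule integral_subset_le)
    have "1 \<le> s" using s by (metis less_eq_real_def one_le_numeral one_le_power real_le_lsqrt real_sqrt_ge_one s_def)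
    then show "{-(\<delta>/s)..\<delta>/s} \<subseteq> {-\<delta>..\<delta>}" using \<delta> s
      by (auto simp: field_simps intro: order_trans) 
  qed (use int in auto)
  then have "integral {-\<delta>..\<delta>} (\<lambda>v. exp (- \<beta> * v\<^sup>2 / 2)) \<le> s * I"
    using integral_unique[OF hi] s by simp
  also have "\<dots> \<le> 3/2 * I"
    unfolding I_def using s by (intro mult_right_mono integral_nonneg int) auto
  finally have le: "integral {-\<delta>..\<delta>} (\<lambda>v. exp (- \<beta> * v\<^sup>2 / 2)) \<le> 3/2 * I" .
  have "(\<lambda>v. exp (- \<beta> * v\<^sup>2) * (2 - exp (\<beta> * v\<^sup>2 / 2))) = (\<lambda>v. 2 * exp (- \<beta> * v\<^sup>2) - exp (- \<beta> * v\<^sup>2 / 2))"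
    by (auto simp: algebra_simps simp flip: exp_add)
  moreover have "integral {-\<delta>..\<delta>} (\<lambda>v. 2 * exp (- \<beta> * v\<^sup>2) - exp (- \<beta> * v\<^sup>2 / 2)) = 2 * I - integral {-\<delta>..\<delta>} (\<lambda>v. exp (- \<beta> * v\<^sup>2 / 2))"
    unfolding I_def using int int2 by (subst Henstock_Kurzweil_Integration.integral_diff) (auto intro: integrable_on_mult_right)
  ultimately show ?thesis using le unfolding I_def by simp
qed

text \<open>
  Explicit in place of asymptotic, so that the bound is uniform in every parameter on which \<open>f\<close>
  may depend: on the segment \<open>f ^ n\<close> differs from a Gaussian by a relative error that is itself
  dominated by a wider Gaussian.
\<close>

lemma saddle_segment_lower_bound:
  fixes f :: "complex \<Rightarrow> complex" and A \<rho> \<delta> :: real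
  assumes hol: "f holomorphic_on ball x0 \<rho>" and nz: "\<And>x. x \<in> ball x0 \<rho> \<Longrightarrow> f x \<noteq> 0"
    and A: "A > 0" and e: "cmod e = 1" and \<delta>: "\<delta> > 0"
    and curv: "\<And>x. x \<in> ball x0 \<rho> \<Longrightarrow>
      cmod ((deriv (deriv f) x * f x - (deriv f x)\<^sup>2) / (f x)\<^sup>2 * e\<^sup>2 + of_real A) \<le> A / 8"
    and y: "dist x0 y + \<delta> < \<rho>" "deriv f y = 0" and n: "n \<ge> 1"
  shows "cmod (integral {-\<delta>..\<delta>} (\<lambda>v. f (y + of_real v * e) ^ n)) \<ge> cmod (f y) ^ n * (min \<delta> 1 * exp (- A / 2) / n)"
proof -
  define S where "S = (\<lambda>v. y + v * e) ` cball 0 \<delta>"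
  have inb: "y + v * e \<in> ball x0 \<rho>" if "cmod v \<le> \<delta>" for v
  proof -
    have "dist x0 (y + v * e) \<le> dist x0 y + cmod v"
      using norm_triangle_ineq4[of "x0 - y" "v * e"] e by (simp add: dist_norm norm_mult algebra_simps)
    then show ?thesis using y that by simp
  qed
  obtain G where G: "G holomorphic_on ball x0 \<rho>" "\<And>z. z \<in> ball x0 \<rho> \<Longrightarrow> f z = exp (G z)"
    and fd: "\<And>w. w \<in> ball x0 \<rho> \<Longrightarrow> deriv f w = f w * deriv G w"
    using holomorphic_log_on_ball[OF hol nz] by metis
  have Gd: "(G has_field_derivative deriv G w) (at w)" if "w \<in> ball x0 \<rho>" for w
    using holomorphic_derivI[OF G(1) open_ball that] .
  have Gdd: "(deriv G has_field_derivative deriv (deriv G) w) (at w)" if "w \<in> ball x0 \<rho>" for w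
    using holomorphic_derivI[OF holomorphic_deriv[OF G(1) open_ball] open_ball that] .
  have fdd: "deriv (deriv G) w = (deriv (deriv f) w * f w - (deriv f w)\<^sup>2) / (f w)\<^sup>2" if w: "w \<in> ball x0 \<rho>" for w
  proof -
    have d1: "(f has_field_derivative deriv f w) (at w)" using holomorphic_derivI[OF hol open_ball w] .
    have "((\<lambda>w. f w * deriv G w) has_field_derivative (f w * deriv (deriv G) w + deriv f w * deriv G w)) (at w)"
      using d1 Gdd[OF w] by (auto intro!: derivative_eq_intros)
    then have "(deriv f has_field_derivative (f w * deriv (deriv G) w + deriv f w * deriv G w)) (at w)"
      by (rule has_field_derivative_transform_within_open[OF _ open_ball w]) (simp add: fd)
    then have "deriv (deriv f) w = f w * deriv (deriv G) w + deriv f w * deriv G w" by (rule DERIV_imp_deriv)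
    then show ?thesis using fd[OF w] nz[OF w] by (simp add: field_simps power2_eq_square)
  qed
  have yb: "y \<in> ball x0 \<rho>" using inb[of 0] \<delta> by simp
  have G1: "deriv G y = 0" using fd[OF yb] y(2) nz[OF yb] by simp
  \<comment> \<open>\<open>F 0\<close> is the deviation of the logarithm of \<open>f\<close> from
    its quadratic model, and \<open>F 1\<close>, \<open>F 2\<close> are its derivatives. The first
    two vanish at 0, and \<open>curv\<close> bounds the third by \<open>A / 8\<close>.\<close>
  define F where "F = (\<lambda>(i::nat) v. if i = 0 then G (y + v * e) - G y + of_real A * v\<^sup>2 / 2
      else if i = 1 then deriv G (y + v * e) * e + of_real A * v
      else deriv (deriv G) (y + v * e) * e\<^sup>2 + of_real A)"
  have F0: "cmod (G (y + v * e) - G y + of_real A * v\<^sup>2 / 2) \<le> A / 8 * (cmod v)\<^sup>2" if v: "cmod v \<le> \<delta>" for v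
  proof -
    have "cmod (F 0 v - (\<Sum>i\<le>1. F i 0 * (v - 0) ^ i / fact i)) \<le> A / 8 * cmod (v - 0) ^ Suc 1 / fact 1"
    proof (rule complex_Taylor[of "cball 0 \<delta>"])
      fix i :: nat and x :: complex assume i: "x \<in> cball 0 \<delta>" "i \<le> 1"
      then have b: "y + x * e \<in> ball x0 \<rho>" by (intro inb) auto
      have c1: "((\<lambda>v. G (y + v * e)) has_field_derivative (deriv G (y + x * e) * e)) (at x within cball 0 \<delta>)"
        by (rule DERIV_chain2[where g = "\<lambda>v. y + v * e" and x = x, OF Gd[OF b]]) (auto intro!: derivative_eq_intros)
      have c2: "((\<lambda>v. deriv G (y + v * e)) has_field_derivative (deriv (deriv G) (y + x * e) * e)) (at x within cball 0 \<delta>)"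
        by (rule DERIV_chain2[where g = "\<lambda>v. y + v * e" and x = x, OF Gdd[OF b]]) (auto intro!: derivative_eq_intros)
      show "(F i has_field_derivative F (Suc i) x) (at x within cball 0 \<delta>)"
        using i(2) c1 c2 by (cases i) (auto simp: F_def power2_eq_square intro!: derivative_eq_intros)
    next
      fix x :: complex assume "x \<in> cball 0 \<delta>"
      then have b: "y + x * e \<in> ball x0 \<rho>" by (intro inb) auto
      show "cmod (F (Suc 1) x) \<le> A / 8" using curv[OF b] fdd[OF b] by (simp add: F_def)
    qed (use v \<delta> in auto)
    moreover have "(\<Sum>i\<le>1. F i 0 * (v - 0) ^ i / fact i) = 0" using G1 by (simp add: F_def)
    ultimately show ?thesis by (simp add: F_def power2_eq_square G1)
  qed
  define \<beta> where "\<beta> = real n * A / 2"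
  have \<beta>: "\<beta> \<ge> 0" using A by (simp add: \<beta>_def)
  define E where "E = (\<lambda>v::real. exp (of_nat n * (G (y + of_real v * e) - G y)))"
  have fE: "f (y + of_real v * e) ^ n = f y ^ n * E v" if "v \<in> {-\<delta>..\<delta>}" for v
  proof -
    have "cmod (of_real v) \<le> \<delta>" using that by auto
    then have "f (y + of_real v * e) = exp (G (y + of_real v * e))" by (intro G inb)
    then show ?thesis using G(2)[OF yb] by (simp add: E_def exp_of_nat_mult[symmetric] exp_diff right_diff_distrib)
  qed
  have contE: "continuous_on {-\<delta>..\<delta>} E"
  proof -
    have "continuous_on {-\<delta>..\<delta>} (\<lambda>v::real. G (y + of_real v * e))"
      by (rule continuous_on_compose2[OF holomorphic_on_imp_continuous_on[OF G(1)]])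
         (auto intro!: continuous_intros inb simp del: mem_ball)
    then show ?thesis unfolding E_def by (intro continuous_intros)
  qed
  have close: "cmod (E v - of_real (exp (- \<beta> * v\<^sup>2))) \<le> exp (- \<beta> * v\<^sup>2) * (exp (\<beta> * v\<^sup>2 / 2) - 1)"
    if "v \<in> {-\<delta>..\<delta>}" for v
  proof -
    define \<xi> where "\<xi> = of_nat n * (G (y + of_real v * e) - G y + of_real A * (of_real v)\<^sup>2 / 2)"
    have "cmod \<xi> \<le> real n * (A / 8 * (cmod (of_real v))\<^sup>2)"
      unfolding \<xi>_def norm_mult norm_of_nat using that by (intro mult_left_mono F0) auto
    then have "cmod \<xi> \<le> \<beta> * v\<^sup>2 / 4" by (simp add: \<beta>_def)
    \<comment> \<open>The factor 2 in \<open>norm_exp_minus_one_le\<close> turns the quarter into a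
      half, which is the error that \<open>integral_gaussian_defect\<close> tolerates; hence the
      constant \<open>A / 8\<close> in the hypothesis \<open>curv\<close>.\<close>
    then have 1: "cmod (exp \<xi> - 1) \<le> exp (\<beta> * v\<^sup>2 / 2) - 1" using norm_exp_minus_one_le by fastforce
    have "E v = exp (of_real (- \<beta> * v\<^sup>2) + \<xi>)"
      by (simp add: E_def \<xi>_def \<beta>_def algebra_simps)
    also have "\<dots> = of_real (exp (- \<beta> * v\<^sup>2)) * exp \<xi>" by (simp only: exp_add exp_of_real)
    finally have "E v - of_real (exp (- \<beta> * v\<^sup>2)) = of_real (exp (- \<beta> * v\<^sup>2)) * (exp \<xi> - 1)"
      by (simp add: algebra_simps)
    then show ?thesis using 1 by (simp add: norm_mult)
  qed
  have re: "Re (E v) \<ge> exp (- \<beta> * v\<^sup>2) * (2 - exp (\<beta> * v\<^sup>2 / 2))" if "v \<in> {-\<delta>..\<delta>}" for v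
  proof -
    have "\<bar>Re (E v - of_real (exp (- \<beta> * v\<^sup>2)))\<bar> \<le> exp (- \<beta> * v\<^sup>2) * (exp (\<beta> * v\<^sup>2 / 2) - 1)"
      using close[OF that] abs_Re_le_cmod order_trans by blast
    then have "Re (E v) \<ge> exp (- \<beta> * v\<^sup>2) - exp (- \<beta> * v\<^sup>2) * (exp (\<beta> * v\<^sup>2 / 2) - 1)" by (simp add: abs_le_iff)
    then show ?thesis by (simp add: algebra_simps)
  qed
  have intE: "E integrable_on {-\<delta>..\<delta>}" using contE by (rule integrable_continuous_real)
  define I where "I = integral {-\<delta>..\<delta>} (\<lambda>v. exp (- \<beta> * v\<^sup>2))"
  have intc: "(\<lambda>v. exp (- \<beta> * v\<^sup>2)) integrable_on {a..b}" for a b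
    by (intro integrable_continuous_real continuous_intros)
  have "I / 2 \<le> integral {-\<delta>..\<delta>} (\<lambda>v. exp (- \<beta> * v\<^sup>2) * (2 - exp (\<beta> * v\<^sup>2 / 2)))"
    unfolding I_def by (rule integral_gaussian_defect[OF \<beta> \<delta>])
  also have "\<dots> \<le> integral {-\<delta>..\<delta>} (\<lambda>v. Re (E v))"
  proof (rule integral_le)
    show "(\<lambda>v. exp (- \<beta> * v\<^sup>2) * (2 - exp (\<beta> * v\<^sup>2 / 2))) integrable_on {-\<delta>..\<delta>}"
      by (intro integrable_continuous_real continuous_intros) auto
    show "(\<lambda>v. Re (E v)) integrable_on {-\<delta>..\<delta>}"
      using contE by (intro integrable_continuous_real continuous_intros)
  qed (use re in auto)
  also have "\<dots> = Re (integral {-\<delta>..\<delta>} E)"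
    using integral_linear[OF intE bounded_linear_Re] by (simp add: o_def)
  also have "\<dots> \<le> cmod (integral {-\<delta>..\<delta>} E)" by (rule complex_Re_le_cmod)
  finally have 1: "I / 2 \<le> cmod (integral {-\<delta>..\<delta>} E)" .
  \<comment> \<open>For \<open>\<bar>v\<bar> \<le> 1 / n\<close> the Gaussian is at least
    \<open>exp (- A / 2)\<close>. Using this length instead of the true width of order
    \<open>1 / sqrt n\<close> costs a polynomial factor, which the exponential gap absorbs
    later.\<close>
  define \<tau> where "\<tau> = min \<delta> 1 / n"
  have \<tau>: "\<tau> > 0" "\<tau> \<le> \<delta>" "\<tau> \<le> 1 / n"
    using n \<delta> by (auto simp: \<tau>_def field_simps min_def intro: order_trans[of _ "\<delta> * 1"])
  have "2 * \<tau> * exp (- A / 2) = integral {-\<tau>..\<tau>} (\<lambda>v. exp (- A / 2))" using \<tau> by simp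
  also have "\<dots> \<le> integral {-\<tau>..\<tau>} (\<lambda>v. exp (- \<beta> * v\<^sup>2))"
  proof (rule integral_le)
    fix v assume "v \<in> {-\<tau>..\<tau>}"
    then have v: "\<bar>v\<bar> \<le> 1 / n" using \<tau> by auto
    have "1 / real n \<le> 1" using n by simp
    then have v1: "\<bar>v\<bar> \<le> 1" using v by linarith
    have "real n * \<bar>v\<bar> \<le> 1" using v n by (simp add: field_simps)
    have "real n * v\<^sup>2 = real n * \<bar>v\<bar> * \<bar>v\<bar>" by (simp add: power2_eq_square)
    also have "\<dots> \<le> 1 * 1"
      using v1 \<open>real n * \<bar>v\<bar> \<le> 1\<close> by (intro mult_mono) auto
    finally have "A / 2 * (real n * v\<^sup>2) \<le> A / 2 * 1" using A by (intro mult_left_mono) auto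
    then show "exp (- A / 2) \<le> exp (- \<beta> * v\<^sup>2)" by (simp add: \<beta>_def mult_ac)
  qed (use intc in auto)
  also have "\<dots> \<le> I" unfolding I_def using \<tau> intc by (intro integral_subset_le) auto
  finally have 2: "\<tau> * exp (- A / 2) \<le> cmod (integral {-\<delta>..\<delta>} E)" using 1 by simp
  have "integral {-\<delta>..\<delta>} (\<lambda>v. f (y + of_real v * e) ^ n) = integral {-\<delta>..\<delta>} (\<lambda>v. f y ^ n * E v)"
    using fE by (intro Henstock_Kurzweil_Integration.integral_cong) auto
  also have "\<dots> = f y ^ n * integral {-\<delta>..\<delta>} E" by simp
  finally have "cmod (integral {-\<delta>..\<delta>} (\<lambda>v. f (y + of_real v * e) ^ n)) = cmod (f y) ^ n * cmod (integral {-\<delta>..\<delta>} E)"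
    by (simp add: norm_mult norm_power)
  then show ?thesis using mult_left_mono[OF 2, of "cmod (f y) ^ n"] by (simp add: \<tau>_def)
qed

text \<open>The constant bounds the speed of the path and depends on nothing else, so the same one
  serves all powers and all nearby parameters. A polynomial path has bounded speed on the unit
  interval.\<close>

lemma primitive_difference_bound:
  fixes g :: "real \<Rightarrow> complex"
  assumes "polynomial_function g"
  obtains B where "B \<ge> 0"
    "\<And>\<Psi> f M. (\<And>x. (\<Psi> has_field_derivative f x) (at x)) \<Longrightarrow> (\<And>x. x \<in> path_image g \<Longrightarrow> cmod (f x) \<le> M) \<Longrightarrow> M \<ge> 0 \<Longrightarrow>
       cmod (\<Psi> (pathfinish g) - \<Psi> (pathstart g)) \<le> B * M"
proof -
  obtain g' where g': "polynomial_function g'" "\<And>x. (g has_vector_derivative g' x) (at x)"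
    using has_vector_derivative_polynomial_function[OF assms] by blast
  have "bounded (g' ` {0..1})"
    using g'(1) by (intro compact_imp_bounded compact_continuous_image continuous_on_polymonial_function) auto
  then obtain B where B: "\<forall>x\<in>{0..1}. cmod (g' x) \<le> B" unfolding bounded_iff by auto
  have B0: "B \<ge> 0" using B order_trans[OF norm_ge_zero] by (metis atLeastAtMost_iff order_refl zero_le_one)
  show ?thesis
  proof (rule that[OF B0])
    fix \<Psi> f :: "complex \<Rightarrow> complex" and M :: real
    assume d: "\<And>x. (\<Psi> has_field_derivative f x) (at x)" and b: "\<And>x. x \<in> path_image g \<Longrightarrow> cmod (f x) \<le> M" and M: "M \<ge> 0"
    have "((\<lambda>t. g' t * f (g t)) has_integral (\<Psi> (g 1) - \<Psi> (g 0))) {0..1}"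
    proof (rule fundamental_theorem_of_calculus)
      fix t :: real assume "t \<in> {0..1}"
      have "((\<Psi> \<circ> g) has_vector_derivative g' t * f (g t)) (at t)"
        by (rule field_vector_diff_chain_at[OF g'(2) d])
      then show "((\<lambda>t. \<Psi> (g t)) has_vector_derivative g' t * f (g t)) (at t within {0..1})"
        by (simp add: o_def has_vector_derivative_at_within)
    qed auto
    then have "cmod (\<Psi> (g 1) - \<Psi> (g 0)) \<le> (B * M) * measure lborel (cbox 0 (1::real))"
    proof (intro has_integral_bound)
      show "0 \<le> B * M" using B0 M by simp
      show "cmod (g' t * f (g t)) \<le> B * M" if "t \<in> cbox 0 1" for t :: real
        unfolding norm_mult using that B b[of "g t"] B0 by (intro mult_mono) (auto simp: path_image_def)
    qed auto
    then show "cmod (\<Psi> (pathfinish g) - \<Psi> (pathstart g)) \<le> B * M"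
      by (simp add: pathfinish_def pathstart_def)
  qed
qed

lemma entire_primitive:
  fixes f :: "complex \<Rightarrow> complex"
  assumes "f holomorphic_on UNIV"
  obtains \<Psi> where "\<And>x. (\<Psi> has_field_derivative f x) (at x)"
  using holomorphic_convex_primitive'[OF convex_UNIV open_UNIV assms] by auto

lemma isCont_eventually_in_open:
  assumes "isCont g p" "open S" "g p \<in> S"
  shows "\<forall>\<^sub>F q in nhds p. g q \<in> S"
  using assms unfolding continuous_at tendsto_at_iff_tendsto_nhds by (rule topological_tendstoD)

text \<open>With a primitive \<open>\<Psi>\<close> of the \<open>n\<close>-th power, deforming the
  contour amounts to telescoping differences of \<open>\<Psi>\<close>. The outer paths and the
  direction \<open>e\<close> are those of \<open>\<kappa>0\<close>; only the middle segment moves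
  with the critical point \<open>y\<close> of the nearby parameter, and two short segments attach it
  to the fixed paths. If the integral were 0, the middle piece, at least of order
  \<open>\<theta>2 ^ n / n\<close>, would be a sum of pieces of order
  \<open>\<theta>1 ^ n\<close>.\<close>

lemma saddle_point_nonvanishing:
  fixes \<Phi> :: "'k::metric_space \<Rightarrow> complex \<Rightarrow> complex" and w :: "real \<Rightarrow> real"
  assumes hol: "\<And>\<kappa>. \<Phi> \<kappa> holomorphic_on UNIV"
    and cont0: "continuous_on UNIV (\<lambda>(\<kappa>, x). \<Phi> \<kappa> x)"
    and cont1: "continuous_on UNIV (\<lambda>(\<kappa>, x). deriv (\<Phi> \<kappa>) x)"
    and cont2: "continuous_on UNIV (\<lambda>(\<kappa>, x). deriv (deriv (\<Phi> \<kappa>)) x)"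
    and crossing: "saddle_crossing (\<Phi> \<kappa>0) x0 e A \<delta>0"
    and crit_near: "\<And>\<epsilon>. \<epsilon> > 0 \<Longrightarrow> \<forall>\<^sub>F \<kappa> in nhds \<kappa>0. \<exists>y. dist x0 y < \<epsilon> \<and> deriv (\<Phi> \<kappa>) y = 0"
    and w: "integrable lborel w" "\<And>x. 0 \<le> w x" "\<And>x. w x \<le> 1"
    and tail: "\<And>\<theta>. \<theta> > 0 \<Longrightarrow> \<exists>X. \<forall>\<^sub>F \<kappa> in nhds \<kappa>0. \<forall>x. \<bar>x\<bar> \<ge> X \<longrightarrow> cmod (\<Phi> \<kappa> (of_real x)) \<le> \<theta> * w x"
  shows "\<exists>N. \<forall>\<^sub>F \<kappa> in nhds \<kappa>0. \<forall>n\<ge>N. (LINT x|lborel. \<Phi> \<kappa> (of_real x) ^ n) \<noteq> 0"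
proof -
  note sc = crossing[unfolded saddle_crossing_def]
  have nz: "\<Phi> \<kappa>0 x0 \<noteq> 0" and crit: "deriv (\<Phi> \<kappa>0) x0 = 0" and A: "A > 0" and e: "cmod e = 1"
    and curv: "deriv (deriv (\<Phi> \<kappa>0)) x0 * e\<^sup>2 = - of_real A * \<Phi> \<kappa>0 x0" and \<delta>0: "\<delta>0 > 0"
    using sc by auto

  \<comment> \<open>Curvature near the saddle\<close>
  define c where "c = cmod (\<Phi> \<kappa>0 x0)"
  have c: "c > 0" using nz by (simp add: c_def)
  \<comment> \<open>The fraction is the second derivative of \<open>ln (\<Phi> \<kappa>)\<close>, so
    \<open>\<psi>\<close> is the deviation of the curvature in direction \<open>e\<close> from
    \<open>- A\<close>.\<close>
  define \<psi> where "\<psi> = (\<lambda>(\<kappa>, x). (deriv (deriv (\<Phi> \<kappa>)) x * \<Phi> \<kappa> x - (deriv (\<Phi> \<kappa>) x)\<^sup>2) / (\<Phi> \<kappa> x)\<^sup>2 * e\<^sup>2 + of_real A)"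
  have ic: "isCont (\<lambda>(\<kappa>, x). \<Phi> \<kappa> x) (\<kappa>0, x0)" "isCont (\<lambda>(\<kappa>, x). deriv (\<Phi> \<kappa>) x) (\<kappa>0, x0)"
    "isCont (\<lambda>(\<kappa>, x). deriv (deriv (\<Phi> \<kappa>)) x) (\<kappa>0, x0)"
    using cont0 cont1 cont2 by (auto simp: continuous_on_eq_continuous_at)
  have ic\<psi>: "isCont \<psi> (\<kappa>0, x0)"
    unfolding \<psi>_def case_prod_unfold using ic[unfolded case_prod_unfold] nz
    by (intro continuous_intros) auto
  have \<psi>0: "\<psi> (\<kappa>0, x0) = 0"
    using curv crit nz by (simp add: \<psi>_def power2_eq_square field_simps)
  have ev: "\<forall>\<^sub>F p in nhds (\<kappa>0, x0). cmod (\<psi> p) < A / 8" 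
  proof -
    have "\<forall>\<^sub>F p in nhds (\<kappa>0, x0). \<psi> p \<in> ball 0 (A/8)"
      using A \<psi>0 by (intro isCont_eventually_in_open[OF ic\<psi>]) auto
    then show ?thesis by simp
  qed
  have ev0: "\<forall>\<^sub>F p in nhds (\<kappa>0, x0). (case p of (\<kappa>, x) \<Rightarrow> \<Phi> \<kappa> x) \<in> - {0}" 
    using nz by (intro isCont_eventually_in_open[OF ic(1)]) auto
  obtain P1 \<rho> where P1: "eventually P1 (nhds \<kappa>0)" "\<rho> > 0"
    "\<And>\<kappa> x. P1 \<kappa> \<Longrightarrow> dist x x0 < \<rho> \<Longrightarrow> cmod (\<psi> (\<kappa>, x)) < A / 8 \<and> \<Phi> \<kappa> x \<noteq> 0"
  proof -
    have "\<forall>\<^sub>F p in nhds (\<kappa>0, x0). cmod (\<psi> p) < A / 8 \<and> (case p of (\<kappa>, x) \<Rightarrow> \<Phi> \<kappa> x) \<noteq> 0"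
      using ev ev0 by eventually_elim auto
    then obtain Pf Pg where "eventually Pf (nhds \<kappa>0)" "eventually Pg (nhds x0)"
       "\<And>\<kappa> x. Pf \<kappa> \<Longrightarrow> Pg x \<Longrightarrow> cmod (\<psi> (\<kappa>, x)) < A / 8 \<and> \<Phi> \<kappa> x \<noteq> 0"
      unfolding nhds_prod eventually_prod_filter by auto
    then show ?thesis using that unfolding eventually_nhds_metric[of _ x0] by blast
  qed
  \<comment> \<open>The critical point will move by less than \<open>\<delta>\<close>, so a segment
    of half-length \<open>\<delta>\<close> about it stays within
    \<open>2 * \<delta> < \<rho>\<close> of \<open>x0\<close>.\<close>
  define \<delta> where "\<delta> = min (\<delta>0 / 2) (\<rho> / 3)"
  have \<delta>: "0 < \<delta>" "\<delta> < \<delta>0" "\<delta> < \<rho> / 2" using \<delta>0 P1(2) by (auto simp: \<delta>_def min_def)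

  \<comment> \<open>The contour for the base parameter\<close>
  define pl where "pl = x0 - of_real \<delta> * e"
  define pr where "pr = x0 + of_real \<delta> * e"
  define V where "V = {x. cmod (\<Phi> \<kappa>0 x) < c}"
  obtain X1 where X1: "\<And>X. X \<ge> X1 \<Longrightarrow> connected_component V (- of_real X) pl \<and> connected_component V pr (of_real X)"
    using sc \<delta>(1,2) unfolding V_def c_def pl_def pr_def by blast
  obtain X2 where X2: "\<forall>\<^sub>F \<kappa> in nhds \<kappa>0. \<forall>x. \<bar>x\<bar> \<ge> X2 \<longrightarrow> cmod (\<Phi> \<kappa> (of_real x)) \<le> c / 2 * w x"
    using tail[of "c/2"] c by auto
  define X where "X = max 0 (max X1 X2)"
  have X: "X \<ge> X1" "X \<ge> X2" "X \<ge> 0" by (auto simp: X_def)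
  have contn: "continuous_on UNIV (\<lambda>x. cmod (\<Phi> \<kappa>0 x))"
    using hol holomorphic_on_imp_continuous_on continuous_on_norm by blast
  have opV: "open V" unfolding V_def using contn by (intro open_Collect_less) auto
  have pathV: "\<exists>g. polynomial_function g \<and> path_image g \<subseteq> V \<and> pathstart g = a \<and> pathfinish g = b"
    if "connected_component V a b" for a b
  proof -
    have "\<exists>g. polynomial_function g \<and> path_image g \<subseteq> connected_component_set V a \<and> pathstart g = a \<and> pathfinish g = b"
      using that opV open_connected_component connected_connected_component
      by (intro connected_open_polynomial_connected) (auto simp: connected_component_refl_eq connected_component_in)
    then show ?thesis using connected_component_subset by blast
  qed
  obtain gl where gl: "polynomial_function gl" "path_image gl \<subseteq> V" "pathstart gl = - of_real X" "pathfinish gl = pl"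
    using pathV X1[OF X(1)] by blast
  obtain gr where gr: "polynomial_function gr" "path_image gr \<subseteq> V" "pathstart gr = pr" "pathfinish gr = of_real X"
    using pathV X1[OF X(1)] by blast
  obtain Bl where Bl: "Bl \<ge> 0" "\<And>\<Psi> f M. (\<And>x. (\<Psi> has_field_derivative f x) (at x)) \<Longrightarrow> (\<And>x. x \<in> path_image gl \<Longrightarrow> cmod (f x) \<le> M) \<Longrightarrow> M \<ge> 0 \<Longrightarrow>
       cmod (\<Psi> (pathfinish gl) - \<Psi> (pathstart gl)) \<le> Bl * M"
    using primitive_difference_bound[OF gl(1)] by metis
  obtain Br where Br: "Br \<ge> 0" "\<And>\<Psi> f M. (\<And>x. (\<Psi> has_field_derivative f x) (at x)) \<Longrightarrow> (\<And>x. x \<in> path_image gr \<Longrightarrow> cmod (f x) \<le> M) \<Longrightarrow> M \<ge> 0 \<Longrightarrow>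
       cmod (\<Psi> (pathfinish gr) - \<Psi> (pathstart gr)) \<le> Br * M"
    using primitive_difference_bound[OF gr(1)] by metis
  have "pl \<in> V" "pr \<in> V" using gl gr pathfinish_in_path_image pathstart_in_path_image by blast+
  then obtain \<eta>1 \<eta>2 where \<eta>12: "\<eta>1 > 0" "cball pl \<eta>1 \<subseteq> V" "\<eta>2 > 0" "cball pr \<eta>2 \<subseteq> V"
    using opV open_contains_cball by metis
  define \<eta> where "\<eta> = min \<eta>1 \<eta>2"
  have \<eta>: "\<eta> > 0" "cball pl \<eta> \<subseteq> V" "cball pr \<eta> \<subseteq> V"
    using \<eta>12 by (auto simp: \<eta>_def)
  \<comment> \<open>The discs about \<open>pl\<close> and \<open>pr\<close> contain the endpoints of
    the moved segment, so the bound on \<open>K\<close> also covers the short connecting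
    segments.\<close>
  define K where "K = path_image gl \<union> path_image gr \<union> cball pl \<eta> \<union> cball pr \<eta>"
  have "path gl" "path gr" using gl(1) gr(1) path_polynomial_function by blast+
  then have cK: "compact K" unfolding K_def by (intro compact_Un compact_path_image compact_cball)
  have KV: "K \<subseteq> V" using gl gr \<eta> by (auto simp: K_def)
  have "K \<noteq> {}" using \<eta>(1) by (auto simp: K_def)
  then obtain xm where xm: "xm \<in> K" "\<forall>y\<in>K. cmod (\<Phi> \<kappa>0 y) \<le> cmod (\<Phi> \<kappa>0 xm)"
    using continuous_attains_sup[OF cK] contn continuous_on_subset by (metis subset_UNIV)
  \<comment> \<open>Two levels between the maximum on \<open>K\<close> and \<open>c\<close>: the
    side pieces will stay below \<open>\<theta>1\<close> and the value at the moved saddle above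
    \<open>\<theta>2\<close>. The term \<open>c/2\<close> puts the tails below
    \<open>\<theta>1\<close> as well.\<close>
  define \<theta>1 where "\<theta>1 = (max (cmod (\<Phi> \<kappa>0 xm)) (c/2) + c) / 2"
  define \<theta>2 where "\<theta>2 = (\<theta>1 + c) / 2"
  have "cmod (\<Phi> \<kappa>0 xm) < c" using xm KV by (auto simp: V_def)
  then have \<theta>: "cmod (\<Phi> \<kappa>0 xm) < \<theta>1" "c/2 \<le> \<theta>1" "\<theta>1 < \<theta>2" "\<theta>2 < c" "0 < \<theta>1"
    using c by (auto simp: \<theta>1_def \<theta>2_def)

  \<comment> \<open>Bounds for nearby parameters\<close>
  have evK: "\<forall>\<^sub>F \<kappa> in nhds \<kappa>0. \<forall>x\<in>K. cmod (\<Phi> \<kappa> x) \<le> \<theta>1"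
  proof -
    define W where "W = {p. cmod (case p of (\<kappa>, x) \<Rightarrow> \<Phi> \<kappa> x) < \<theta>1}"
    have W: "open W" unfolding W_def using continuous_on_norm[OF cont0] by (intro open_Collect_less) auto
    have KW: "{\<kappa>0} \<times> K \<subseteq> W" using xm \<theta>(1) by (auto simp: W_def intro: le_less_trans)
    obtain U where "\<kappa>0 \<in> U" "open U" "U \<times> K \<subseteq> W"
      using Elementary_Topology.tube_lemma[OF cK W KW] by blast
    then show ?thesis unfolding eventually_nhds by (intro exI[of _ U]) (auto simp: W_def intro: less_imp_le)
  qed
  obtain P2 \<rho>2 where P2: "eventually P2 (nhds \<kappa>0)" "\<rho>2 > 0"
    "\<And>\<kappa> x. P2 \<kappa> \<Longrightarrow> dist x x0 < \<rho>2 \<Longrightarrow> cmod (\<Phi> \<kappa> x) > \<theta>2"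
  proof -
    have "\<forall>\<^sub>F p in nhds (\<kappa>0, x0). cmod (case p of (\<kappa>, x) \<Rightarrow> \<Phi> \<kappa> x) \<in> {\<theta>2<..}"
      using \<theta> by (intro isCont_eventually_in_open[OF continuous_norm[OF ic(1)]]) (auto simp: c_def)
    then obtain Pf Pg where "eventually Pf (nhds \<kappa>0)" "eventually Pg (nhds x0)"
       "\<And>\<kappa> x. Pf \<kappa> \<Longrightarrow> Pg x \<Longrightarrow> cmod (\<Phi> \<kappa> x) > \<theta>2"
      unfolding nhds_prod eventually_prod_filter by auto
    then show ?thesis using that unfolding eventually_nhds_metric[of _ x0] by blast
  qed
  define T where "T = (LINT x|lborel. w x)"
  have T: "T \<ge> 0" unfolding T_def using w by simp
  \<comment> \<open>Tail, left path, right path and two connecting segments, each measured in units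
    of \<open>\<theta>1 ^ n\<close>.\<close>
  define C where "C = T + Bl + Br + 2 * \<eta>"
  have C: "C > 0" using T Bl Br \<eta> by (simp add: C_def)
  define c0 where "c0 = min \<delta> 1 * exp (- A / 2)"
  have c0: "c0 > 0" using \<delta> by (simp add: c0_def)
  have "(\<lambda>n. C * (real n * (\<theta>1 / \<theta>2) ^ n)) \<longlonglongrightarrow> C * 0"
    using \<theta> by (intro tendsto_mult_left powser_times_n_limit_0) auto
  then have "\<forall>\<^sub>F n in sequentially. C * (real n * (\<theta>1 / \<theta>2) ^ n) < c0"
    using c0 by (intro order_tendstoD(2)) auto
  then obtain N0 where N0: "\<And>n. n \<ge> N0 \<Longrightarrow> C * (real n * (\<theta>1 / \<theta>2) ^ n) < c0"
    unfolding eventually_sequentially by blast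
  define \<epsilon> where "\<epsilon> = min \<eta> (min \<delta> \<rho>2)"
  have \<epsilon>: "\<epsilon> > 0" using \<eta> \<delta> P2 by (simp add: \<epsilon>_def)

  \<comment> \<open>Comparison of the pieces\<close>
  show ?thesis
  proof (intro exI[of _ "max N0 1"])
    show "\<forall>\<^sub>F \<kappa> in nhds \<kappa>0. \<forall>n\<ge>max N0 1. (LINT x|lborel. \<Phi> \<kappa> (of_real x) ^ n) \<noteq> 0"
      using P1(1) P2(1) X2 evK crit_near[OF \<epsilon>]
    proof eventually_elim
      case (elim \<kappa>)
      obtain y where y: "dist x0 y < \<epsilon>" "deriv (\<Phi> \<kappa>) y = 0" using elim(5) by blast
      show ?case
      proof (intro allI impI notI)
        fix n assume n: "n \<ge> max N0 1" and int0: "(LINT x|lborel. \<Phi> \<kappa> (of_real x) ^ n) = 0"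
        define f where "f = (\<lambda>x. \<Phi> \<kappa> x ^ n)"
        have holf: "f holomorphic_on UNIV" unfolding f_def using hol by (intro holomorphic_intros)
        obtain \<Psi> where \<Psi>: "\<And>x. (\<Psi> has_field_derivative f x) (at x)" using entire_primitive[OF holf] by blast
        have Mn: "\<theta>1 ^ n \<ge> 0" using \<theta> by simp
        have fK: "cmod (f x) \<le> \<theta>1 ^ n" if "x \<in> K" for x
          using elim(4) that by (simp add: f_def norm_power power_mono)
        have b1: "cmod (\<Psi> pl - \<Psi> (- of_real X)) \<le> Bl * \<theta>1 ^ n"
          using Bl(2)[OF \<Psi> _ Mn] fK gl by (auto simp: K_def)
        have b2: "cmod (\<Psi> (of_real X) - \<Psi> pr) \<le> Br * \<theta>1 ^ n"
          using Br(2)[OF \<Psi> _ Mn] fK gr by (auto simp: K_def)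
        define yl where "yl = y - of_real \<delta> * e"
        define yr where "yr = y + of_real \<delta> * e"
        have dl: "dist pl yl \<le> \<eta>" "dist pr yr \<le> \<eta>"
          using y(1) by (auto simp: pl_def yl_def pr_def yr_def \<epsilon>_def dist_norm)
        have seg: "cmod (\<Psi> a - \<Psi> b) \<le> \<theta>1 ^ n * \<eta>" if "cball a \<eta> \<subseteq> K" "dist a b \<le> \<eta>" for a b
        proof -
          have "cmod (\<Psi> a - \<Psi> b) \<le> \<theta>1 ^ n * cmod (a - b)"
            using that \<eta>(1) fK
            by (intro field_differentiable_bound[of "cball a \<eta>" \<Psi> f] has_field_derivative_at_within[OF \<Psi>]) auto
          also have "\<dots> \<le> \<theta>1 ^ n * \<eta>" using that Mn by (intro mult_left_mono) (auto simp: dist_norm)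
          finally show ?thesis .
        qed
        have b3: "cmod (\<Psi> pl - \<Psi> yl) \<le> \<theta>1 ^ n * \<eta>" "cmod (\<Psi> pr - \<Psi> yr) \<le> \<theta>1 ^ n * \<eta>"
          using dl by (intro seg; auto simp: K_def)+
        have mid: "((\<lambda>v. e * f (y + of_real v * e)) has_integral (\<Psi> (y + of_real \<delta> * e) - \<Psi> (y + of_real (-\<delta>) * e))) {-\<delta>..\<delta>}"
        proof (rule fundamental_theorem_of_calculus)
          fix v :: real assume "v \<in> {-\<delta>..\<delta>}"
          have "((\<lambda>v. y + of_real v * e) has_vector_derivative e) (at v)"
            by (auto intro!: derivative_eq_intros)
          then have "((\<Psi> \<circ> (\<lambda>v. y + of_real v * e)) has_vector_derivative e * f (y + of_real v * e)) (at v)"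
            by (rule field_vector_diff_chain_at[OF _ \<Psi>])
          then show "((\<lambda>v. \<Psi> (y + of_real v * e)) has_vector_derivative e * f (y + of_real v * e)) (at v within {-\<delta>..\<delta>})"
            by (simp add: o_def has_vector_derivative_at_within)
        qed (use \<delta> in auto)
        have "\<Psi> yr - \<Psi> yl = integral {-\<delta>..\<delta>} (\<lambda>v. e * f (y + of_real v * e))"
          using integral_unique[OF mid] by (simp add: yr_def yl_def)
        then have mideq: "cmod (\<Psi> yr - \<Psi> yl) = cmod (integral {-\<delta>..\<delta>} (\<lambda>v. \<Phi> \<kappa> (y + of_real v * e) ^ n))"
          using e by (simp add: norm_mult f_def)
        have "cmod (integral {-\<delta>..\<delta>} (\<lambda>v. \<Phi> \<kappa> (y + of_real v * e) ^ n)) \<ge> cmod (\<Phi> \<kappa> y) ^ n * (min \<delta> 1 * exp (- A / 2) / n)"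
        proof (rule saddle_segment_lower_bound[where ?x0.0 = x0 and \<rho> = \<rho>])
          show "\<Phi> \<kappa> holomorphic_on ball x0 \<rho>" using hol holomorphic_on_subset by blast
          show "\<Phi> \<kappa> x \<noteq> 0" if "x \<in> ball x0 \<rho>" for x using P1(3)[OF elim(1)] that by (simp add: dist_commute)
          show "cmod ((deriv (deriv (\<Phi> \<kappa>)) x * \<Phi> \<kappa> x - (deriv (\<Phi> \<kappa>) x)\<^sup>2) / (\<Phi> \<kappa> x)\<^sup>2 * e\<^sup>2 + of_real A) \<le> A / 8"
            if "x \<in> ball x0 \<rho>" for x
            using P1(3)[OF elim(1), of x] that by (simp add: dist_commute \<psi>_def)
          show "dist x0 y + \<delta> < \<rho>" using y(1) \<delta> by (auto simp: \<epsilon>_def)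
        qed (use A e \<delta> y n in auto)
        then have mid2: "cmod (\<Psi> yr - \<Psi> yl) \<ge> cmod (\<Phi> \<kappa> y) ^ n * (c0 / n)"
          unfolding mideq c0_def .
        have "\<theta>2 < cmod (\<Phi> \<kappa> y)" using P2(3)[OF elim(2)] y(1) by (simp add: \<epsilon>_def dist_commute)
        then have "\<theta>2 ^ n * (c0 / n) \<le> cmod (\<Phi> \<kappa> y) ^ n * (c0 / n)"
          using \<theta> c0 by (intro mult_right_mono power_mono) auto
        then have mid3: "\<theta>2 ^ n * (c0 / n) \<le> cmod (\<Psi> yr - \<Psi> yl)" using mid2 by linarith
        \<comment> \<open>As the full integral is 0, the part over \<open>{-X..X}\<close> is minus
          the tail. There \<open>0 \<le> w \<le> 1\<close> gives \<open>w ^ n \<le> w\<close>, so a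
          single integrable function bounds all powers up to \<open>\<theta>1 ^ n\<close>.\<close>
        have b4: "cmod (\<Psi> (of_real X) - \<Psi> (- of_real X)) \<le> \<theta>1 ^ n * T"
        proof -
          define F where "F = (\<lambda>x::real. f (of_real x))"
          define I where "I = {-X..X}"
          have contF: "continuous_on S F" for S unfolding F_def
            by (intro continuous_on_compose2[OF holomorphic_on_imp_continuous_on[OF holf]] continuous_intros) auto
          have measF: "F \<in> borel_measurable borel" using contF by (rule borel_measurable_continuous_onI)
          have Fw: "cmod (F x) \<le> \<theta>1 ^ n * w x" if "x \<notin> I" for x
          proof -
            have "cmod (\<Phi> \<kappa> (of_real x)) \<le> c / 2 * w x" using elim(3) that X by (auto simp: I_def)
            also have "\<dots> \<le> \<theta>1 * w x" using \<theta> w by (intro mult_right_mono) auto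
            finally have "cmod (F x) \<le> (\<theta>1 * w x) ^ n" unfolding F_def f_def norm_power by (intro power_mono) auto
            also have "\<dots> = \<theta>1 ^ n * w x ^ n" by (simp add: power_mult_distrib)
            also have "\<dots> \<le> \<theta>1 ^ n * w x ^ 1" using w n \<theta> by (intro mult_left_mono power_decreasing) auto
            finally show ?thesis by simp
          qed
          have hI: "(F has_integral (\<Psi> (of_real X) - \<Psi> (of_real (-X)))) {-X..X}"
          proof (rule fundamental_theorem_of_calculus)
            fix v :: real assume "v \<in> {-X..X}"
            have "((\<lambda>v. of_real v) has_vector_derivative (1::complex)) (at v)"
              by (auto intro!: derivative_eq_intros)
            then have "((\<Psi> \<circ> of_real) has_vector_derivative 1 * f (of_real v)) (at v)"
              by (rule field_vector_diff_chain_at[OF _ \<Psi>])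
            then show "((\<lambda>v. \<Psi> (of_real v)) has_vector_derivative F v) (at v within {-X..X})"
              by (simp add: o_def has_vector_derivative_at_within F_def)
          qed (use X in auto)
          have i1: "set_integrable lborel I F" unfolding I_def by (intro borel_integrable_atLeastAtMost' contF)
          have i2: "set_integrable lborel (- I) F"
            unfolding set_integrable_def
          proof (rule Bochner_Integration.integrable_bound)
            show "integrable lborel (\<lambda>x. \<theta>1 ^ n * w x)" using w by simp
            show "(\<lambda>x. indicat_real (- I) x *\<^sub>R F x) \<in> borel_measurable lborel" using measF by (simp add: I_def)
            show "AE x in lborel. norm (indicat_real (- I) x *\<^sub>R F x) \<le> norm (\<theta>1 ^ n * w x)"
              using Fw w \<theta> by (intro AE_I2) (auto simp: indicator_def intro: order_trans)
          qed
          have e1: "(LINT x:I|lborel. F x) = \<Psi> (of_real X) - \<Psi> (- of_real X)"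
            using set_borel_integral_eq_integral(2)[OF i1] integral_unique[OF hI] by (simp add: I_def)
          have e2: "cmod (LINT x:(-I)|lborel. F x) \<le> \<theta>1 ^ n * T"
          proof -
            have "cmod (LINT x:(-I)|lborel. F x) \<le> (LINT x|lborel. \<theta>1 ^ n * w x)"
              unfolding set_lebesgue_integral_def
            proof (rule Bochner_Integration.integral_norm_bound_integral)
              show "integrable lborel (\<lambda>x. indicat_real (- I) x *\<^sub>R F x)" using i2 by (simp add: set_integrable_def)
              show "integrable lborel (\<lambda>x. \<theta>1 ^ n * w x)" using w by simp
              show "norm (indicat_real (- I) x *\<^sub>R F x) \<le> \<theta>1 ^ n * w x" for x
                using Fw[of x] w(2)[of x] \<theta> by (auto simp: indicator_def)
            qed
            then show ?thesis by (simp add: T_def)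
          qed
          have "(LINT x:(I \<union> - I)|lborel. F x) = (LINT x:I|lborel. F x) + (LINT x:(-I)|lborel. F x)"
            using i1 i2 by (intro set_integral_Un) auto
          moreover have "(LINT x:(I \<union> - I)|lborel. F x) = 0" using int0
            by (simp add: F_def f_def set_lebesgue_integral_def)
          ultimately have "(LINT x:I|lborel. F x) = - (LINT x:(-I)|lborel. F x)" by (simp add: eq_neg_iff_add_eq_0)
          then show ?thesis using e1 e2 by (metis norm_minus_cancel)
        qed
        have tri: "cmod (a - b - c - d + e) \<le> cmod a + cmod b + cmod c + cmod d + cmod e" for a b c d e :: complex
          using norm_triangle_ineq[of "a - b - c - d" e] norm_triangle_ineq4[of "a - b - c" d]
            norm_triangle_ineq4[of "a - b" c] norm_triangle_ineq4[of a b] by linarith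
        have dec: "\<Psi> yr - \<Psi> yl = (\<Psi> (of_real X) - \<Psi> (- of_real X)) - (\<Psi> (of_real X) - \<Psi> pr) - (\<Psi> pl - \<Psi> (- of_real X)) - (\<Psi> pr - \<Psi> yr) + (\<Psi> pl - \<Psi> yl)"
          by simp
        have "cmod (\<Psi> yr - \<Psi> yl) \<le> \<theta>1 ^ n * T + Br * \<theta>1 ^ n + Bl * \<theta>1 ^ n + \<theta>1 ^ n * \<eta> + \<theta>1 ^ n * \<eta>"
          using b1 b2 b3 b4 by (subst dec) (rule order_trans[OF tri], linarith)
        also have "\<dots> = C * \<theta>1 ^ n" by (simp add: C_def algebra_simps)
        finally have "\<theta>2 ^ n * (c0 / n) \<le> C * \<theta>1 ^ n" using mid3 by linarith
        then have "c0 \<le> C * (real n * (\<theta>1 / \<theta>2) ^ n)"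
          using \<theta> n by (simp add: field_simps power_divide)
        then show False using N0[of n] n by simp
      qed
    qed
  qed
qed

section \<open>Heat flow of polynomials\<close>

lemma degree_higher_pderiv: "degree ((pderiv ^^ m) (p :: complex poly)) = degree p - m"
  by (induction m) (auto simp: degree_pderiv)

lemma higher_pderiv_eq_0:
  fixes p :: "complex poly"
  assumes "degree p < m"
  shows "(pderiv ^^ m) p = 0"
proof -
  obtain k where k: "m = Suc (degree p) + k" using assms less_iff_Suc_add by (metis add_Suc_shift add.commute add_Suc)
  have "(pderiv ^^ Suc (degree p)) p = 0"
    using degree_higher_pderiv[of "degree p" p] by (simp add: pderiv_eq_0_iff)
  moreover have "(pderiv ^^ k) (0 :: complex poly) = 0" by (induction k) auto
  ultimately show ?thesis unfolding k add.commute[of _ k] funpow_add by (simp del: funpow.simps)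
qed

text \<open>Terms beyond the degree vanish, so polynomials of different degrees can be given one
  range of summation.\<close>

lemma heat_flow_altdef:
  assumes "degree p \<le> K"
  shows "heat_flow c p = (\<Sum>k\<le>K. smult (c ^ k / fact k) ((pderiv ^^ (2 * k)) p))"
  unfolding heat_flow_def using assms
  by (intro sum.mono_neutral_left) (auto simp: higher_pderiv_eq_0)

lemma poly_heat_flow:
  assumes "degree p \<le> K"
  shows "poly (heat_flow c p) z = (\<Sum>k\<le>K. c ^ k / fact k * poly ((pderiv ^^ (2 * k)) p) z)"
  unfolding heat_flow_altdef[OF assms] by (simp add: poly_sum)

lemma poly_heat_flow_sum_mset:
  "poly (heat_flow c (\<Sum>x\<in>#A. f x)) z = (\<Sum>x\<in>#A. poly (heat_flow c (f x)) z)"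
proof (induction A)
  case empty
  show ?case by (simp add: heat_flow_def)
next
  case (add x A)
  define K where "K = max (degree (f x)) (degree (\<Sum>x\<in>#A. f x))"
  have d: "degree (f x) \<le> K" "degree (\<Sum>x\<in>#A. f x) \<le> K" "degree (f x + (\<Sum>x\<in>#A. f x)) \<le> K"
    by (auto simp: K_def degree_add_le_max)
  have "poly (heat_flow c (f x + (\<Sum>x\<in>#A. f x))) z = poly (heat_flow c (f x)) z + poly (heat_flow c (\<Sum>x\<in>#A. f x)) z"
    by (simp add: poly_heat_flow[OF d(1)] poly_heat_flow[OF d(2)] poly_heat_flow[OF d(3)]
          higher_pderiv_add distrib_left sum.distrib)
  then show ?case using add by simp
qed

lemma higher_pderiv_linear_mult:
  "(pderiv ^^ m) ([:- \<xi>, 1:] * q) = [:- \<xi>, 1:] * (pderiv ^^ m) q + smult (of_nat m) ((pderiv ^^ (m - 1)) (q :: complex poly))"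
proof (induction m)
  case (Suc m)
  have "(pderiv ^^ Suc m) ([:- \<xi>, 1:] * q) = pderiv ([:- \<xi>, 1:] * (pderiv ^^ m) q + smult (of_nat m) ((pderiv ^^ (m - 1)) q))"
    by (simp only: funpow.simps o_apply Suc)
  also have "\<dots> = [:- \<xi>, 1:] * (pderiv ^^ Suc m) q + (pderiv ^^ m) q + smult (of_nat m) (pderiv ((pderiv ^^ (m - 1)) q))"
    by (simp add: pderiv_add pderiv_mult pderiv_pCons pderiv_smult del: mult_pCons_left)
  also have "smult (of_nat m) (pderiv ((pderiv ^^ (m - 1)) q)) = smult (of_nat m) ((pderiv ^^ m) q)"
    by (cases m) auto
  finally show ?case by (simp add: smult_add_left)
qed simp

text \<open>The commutator of the second derivative with multiplication by the variable is twice the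
  first derivative; exponentiated, it contributes the term with \<open>2 * c\<close>.\<close>

lemma poly_heat_flow_linear_mult:
  "poly (heat_flow c ([:- \<xi>, 1:] * q)) z = (z - \<xi>) * poly (heat_flow c q) z + 2 * c * poly (heat_flow c (pderiv q)) z"
proof -
  define K where "K = degree q + 1"
  have d: "degree ([:- \<xi>, 1:] * q) \<le> Suc K" "degree q \<le> Suc K" "degree (pderiv q) \<le> K"
    using degree_mult_le[of "[:- \<xi>, 1:]" q] by (auto simp: K_def degree_pderiv)
  \<comment> \<open>At \<open>k = 0\<close> the truncated index \<open>2 * k - 1\<close> is
    multiplied by 0. Dropping this term shifts the sum and cancels one factor of the
    factorial.\<close>
  have *: "(\<Sum>k\<le>Suc K. c ^ k / fact k * (of_nat (2 * k) * poly ((pderiv ^^ (2 * k - 1)) q) z))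
      = 2 * c * (\<Sum>k\<le>K. c ^ k / fact k * poly ((pderiv ^^ (2 * k)) (pderiv q)) z)"
  proof -
    have coef: "c ^ Suc k / fact (Suc k) * of_nat (2 * Suc k) = 2 * c * (c ^ k / fact k)" for k
      by (simp only: fact_Suc of_nat_mult power_Suc of_nat_numeral) (simp add: field_simps del: of_nat_Suc)
    have "(pderiv ^^ (2 * Suc k - 1)) q = (pderiv ^^ (2 * k)) (pderiv q)" for k
      by (simp add: funpow_swap1)
    then show ?thesis
      unfolding sum.atMost_Suc_shift sum_distrib_left mult.assoc[symmetric] coef by simp
  qed
  have "poly (heat_flow c ([:- \<xi>, 1:] * q)) z = (\<Sum>k\<le>Suc K. c ^ k / fact k * ((z - \<xi>) * poly ((pderiv ^^ (2 * k)) q) z + of_nat (2 * k) * poly ((pderiv ^^ (2 * k - 1)) q) z))"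
    unfolding poly_heat_flow[OF d(1)] higher_pderiv_linear_mult
    by (intro sum.cong refl) (simp add: algebra_simps)
  also have "\<dots> = (z - \<xi>) * (\<Sum>k\<le>Suc K. c ^ k / fact k * poly ((pderiv ^^ (2 * k)) q) z) + 2 * c * (\<Sum>k\<le>K. c ^ k / fact k * poly ((pderiv ^^ (2 * k)) (pderiv q)) z)"
    unfolding *[symmetric] by (simp add: distrib_left sum.distrib sum_distrib_left mult_ac del: sum.atMost_Suc)
  finally show ?thesis unfolding poly_heat_flow[OF d(2)] poly_heat_flow[OF d(3)] .
qed

lemma heat_flow_monic:
  assumes "lead_coeff p = 1"
  shows "degree (heat_flow c p) = degree p" "lead_coeff (heat_flow c p) = 1"
proof -
  define r where "r = (\<Sum>k\<in>{1..degree p}. smult (c ^ k / fact k) ((pderiv ^^ (2 * k)) p))"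
  have eq: "heat_flow c p = p + r"
    unfolding heat_flow_def r_def atMost_atLeast0 by (subst sum.atLeast_Suc_atMost) auto
  have "degree (heat_flow c p) = degree p \<and> lead_coeff (heat_flow c p) = 1"
  proof (cases "degree p = 0")
    case True
    then show ?thesis using assms by (simp add: eq r_def)
  next
    case False
    have "degree r < degree p"
      unfolding r_def
    proof (rule degree_sum_less)
      show "degree (smult (c ^ k / fact k) ((pderiv ^^ (2 * k)) p)) < degree p" if "k \<in> {1..degree p}" for k
        using that False degree_smult_le[of "c ^ k / fact k" "(pderiv ^^ (2 * k)) p"] degree_higher_pderiv[of "2*k" p]
        by (auto intro: le_less_trans)
    qed (use False in auto)
    then show ?thesis using assms
      by (simp add: eq degree_add_eq_left lead_coeff_add_le coeff_eq_0)
  qed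
  then show "degree (heat_flow c p) = degree p" "lead_coeff (heat_flow c p) = 1" by auto
qed

lemma pderiv_sum: "pderiv (sum f A :: complex poly) = (\<Sum>x\<in>A. pderiv (f x))"
  by (induction A rule: infinite_finite_induct) (auto simp: pderiv_add)

lemma poly_pderiv_heat_flow: "poly (pderiv (heat_flow c p)) z = poly (heat_flow c (pderiv p)) z"
proof -
  have d: "degree (pderiv p) \<le> degree p" by (simp add: degree_pderiv)
  have "pderiv (heat_flow c p) = (\<Sum>k\<le>degree p. smult (c ^ k / fact k) (pderiv ((pderiv ^^ (2 * k)) p)))"
    unfolding heat_flow_def by (simp add: pderiv_sum pderiv_smult)
  then show ?thesis unfolding poly_heat_flow[OF d]
    by (simp add: poly_sum funpow_swap1)
qed

lemma pderiv_heat_flow: "pderiv (heat_flow c p) = heat_flow c (pderiv p)"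
  by (simp add: poly_eq_poly_eq_iff[symmetric] fun_eq_iff poly_pderiv_heat_flow)

text \<open>The heat equation: differentiating the exponential series in \<open>c\<close> brings
  down the second derivative in \<open>z\<close>.\<close>

lemma has_field_derivative_heat_flow_parameter:
  "((\<lambda>c. poly (heat_flow c p) z) has_field_derivative poly (heat_flow c (pderiv (pderiv p))) z) (at c)"
proof -
  define K where "K = degree p"
  have d: "degree p \<le> Suc K" "degree (pderiv (pderiv p)) \<le> K" by (auto simp: K_def degree_pderiv)
  define a where "a = (\<lambda>k. poly ((pderiv ^^ (2 * k)) p) z)"
  have a: "a (Suc k) = poly ((pderiv ^^ (2 * k)) (pderiv (pderiv p))) z" for k
    by (simp add: a_def funpow_swap1)
  have "((\<lambda>c. \<Sum>k\<le>Suc K. c ^ k / fact k * a k) has_field_derivative (\<Sum>k\<le>Suc K. of_nat k * c ^ (k - 1) / fact k * a k)) (at c)"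
    by (rule derivative_eq_intros refl | simp)+
  moreover have "(\<Sum>k\<le>Suc K. of_nat k * c ^ (k - 1) / fact k * a k) = (\<Sum>k\<le>K. c ^ k / fact k * a (Suc k))"
  proof -
    have coef: "of_nat (Suc k) * c ^ (Suc k - 1) / fact (Suc k) = c ^ k / fact k" for k
      by (simp add: fact_Suc del: of_nat_Suc)
    show ?thesis unfolding sum.atMost_Suc_shift coef by simp
  qed
  moreover have "poly (heat_flow c p) z = (\<Sum>k\<le>Suc K. c ^ k / fact k * a k)" for c
    by (simp only: poly_heat_flow[OF d(1)] a_def)
  moreover have "poly (heat_flow c (pderiv (pderiv p))) z = (\<Sum>k\<le>K. c ^ k / fact k * a (Suc k))"
    by (simp only: poly_heat_flow[OF d(2)] a)
  ultimately show ?thesis by (simp only:)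
qed

lemma poly_taylor:
  fixes p :: "complex poly"
  assumes "degree p \<le> n"
  shows "poly p (z + h) = (\<Sum>j\<le>n. poly ((pderiv ^^ j) p) z / fact j * h ^ j)"
proof -
  define q where "q = pcompose p [:z, 1:]"
  have hd: "(pderiv ^^ j) q = pcompose ((pderiv ^^ j) p) [:z, 1:]" for j
    by (induction j) (auto simp: q_def pderiv_pcompose pderiv_pCons)
  have "poly ((pderiv ^^ j) p) z = fact j * coeff q j" for j
  proof -
    have "poly ((pderiv ^^ j) p) z = poly ((pderiv ^^ j) q) 0" by (simp add: hd poly_pcompose)
    also have "\<dots> = coeff ((pderiv ^^ j) q) 0" by (simp add: poly_0_coeff_0)
    also have "\<dots> = fact j * coeff q j" by (simp add: coeff_higher_pderiv pochhammer_fact)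
    finally show ?thesis .
  qed
  then have c: "poly ((pderiv ^^ j) p) z / fact j = coeff q j" for j by simp
  have "degree q \<le> n" using assms by (simp add: q_def degree_pcompose)
  then have "poly q h = (\<Sum>j\<le>n. coeff q j * h ^ j)"
    unfolding poly_altdef by (intro sum.mono_neutral_left) (auto simp: coeff_eq_0)
  then show ?thesis unfolding c by (simp add: q_def poly_pcompose)
qed

text \<open>In the Taylor expansion at \<open>z\<close> the odd moments of the normal distribution
  vanish, and the even ones, \<open>fact (2 * k) / (2 ^ k * fact k)\<close>, produce the exponential
  series. As \<open>\<sigma>\<close> may be complex, every flow parameter
  \<open>\<sigma>\<^sup>2 / 2\<close> is reached.\<close>

lemma heat_flow_gaussian_average:
  "has_bochner_integral lborel (\<lambda>x. of_real (std_normal_density x) * poly p (z + \<sigma> * of_real x)) (poly (heat_flow (\<sigma>\<^sup>2 / 2) p) z)"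
proof -
  define K where "K = degree p"
  define b where "b = (\<lambda>j. poly ((pderiv ^^ j) p) z / fact j * \<sigma> ^ j)"
  define M where "M = (\<lambda>j. LINT x|lborel. std_normal_density x * x ^ j)"
  have split: "(\<Sum>j\<le>2 * n + 1. f j) = (\<Sum>k\<le>n. f (2 * k) + f (2 * k + 1))" for f :: "nat \<Rightarrow> complex" and n
    by (induction n) (auto simp: algebra_simps)
  have d: "degree p \<le> 2 * K + 1" by (simp add: K_def)
  have eq: "of_real (std_normal_density x) * poly p (z + \<sigma> * of_real x)
      = (\<Sum>j\<le>2 * K + 1. of_real (std_normal_density x * x ^ j) * b j)" for x
    unfolding poly_taylor[OF d] sum_distrib_left b_def
    by (intro sum.cong refl) (simp add: power_mult_distrib)
  have "has_bochner_integral lborel (\<lambda>x. of_real (std_normal_density x * x ^ j) * b j) (of_real (M j) * b j)" for j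
    unfolding M_def by (intro has_bochner_integral_mult_left has_bochner_integral_of_real has_bochner_integral_integrable integrable_std_normal_moment)
  then have "has_bochner_integral lborel (\<lambda>x. \<Sum>j\<le>2 * K + 1. of_real (std_normal_density x * x ^ j) * b j) (\<Sum>j\<le>2 * K + 1. of_real (M j) * b j)"
    by (intro has_bochner_integral_sum)
  moreover have "(\<Sum>j\<le>2 * K + 1. of_real (M j) * b j) = poly (heat_flow (\<sigma>\<^sup>2 / 2) p) z"
    unfolding split poly_heat_flow[OF order_refl] K_def[symmetric]
  proof (intro sum.cong refl)
    fix k
    have M1: "M (2 * k + 1) = 0" and M: "M (2 * k) = fact (2 * k) / (2 ^ k * fact k)"
      unfolding M_def by (rule integral_std_normal_moment_odd integral_std_normal_moment_even)+
    have M2: "complex_of_real (M (2 * k)) = fact (2 * k) / (2 ^ k * fact k)" unfolding M by simp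
    show "of_real (M (2 * k)) * b (2 * k) + of_real (M (2 * k + 1)) * b (2 * k + 1) =
        (\<sigma>\<^sup>2 / 2) ^ k / fact k * poly ((pderiv ^^ (2 * k)) p) z"
      by (simp only: M1 M2 b_def) (simp add: power_mult power_divide divide_simps)
  qed
  ultimately show ?thesis unfolding eq by simp
qed

text \<open>Indexed by a multiset, so that an induction on the number of roots can split off one
  occurrence at a time.\<close>

definition root_poly :: "complex multiset \<Rightarrow> complex poly" where
  "root_poly A = (\<Prod>\<xi>\<in>#A. [:- \<xi>, 1:])"

lemma root_poly_add_mset [simp]: "root_poly (add_mset \<xi> A) = [:- \<xi>, 1:] * root_poly A"
  by (simp add: root_poly_def)

lemma pderiv_root_poly: "pderiv (root_poly A) = (\<Sum>\<xi>\<in>#A. root_poly (A - {#\<xi>#}))"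
proof (induction A)
  case empty
  show ?case by (simp add: root_poly_def)
next
  case (add x A)
  have "(\<Sum>\<xi>\<in>#A. root_poly (add_mset x A - {#\<xi>#})) = (\<Sum>\<xi>\<in>#A. [:- x, 1:] * root_poly (A - {#\<xi>#}))"
    by (intro arg_cong[of _ _ sum_mset] image_mset_cong) simp
  also have "\<dots> = [:- x, 1:] * pderiv (root_poly A)" by (simp add: add sum_mset_distrib_left del: mult_pCons_left)
  finally show ?case by (simp add: pderiv_mult pderiv_pCons del: mult_pCons_left)
qed

lemma norm_sum_mset_le:
  fixes f :: "complex \<Rightarrow> complex"
  assumes "\<And>a. a \<in># A \<Longrightarrow> cmod (f a) \<le> b"
  shows "cmod (\<Sum>a\<in>#A. f a) \<le> real (size A) * b"
  using assms
proof (induction A)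
  case (add x A)
  have "cmod (f x + (\<Sum>a\<in>#A. f a)) \<le> b + real (size A) * b"
    using add by (intro order_trans[OF norm_triangle_ineq] add_mono) auto
  then show ?case by (simp add: algebra_simps)
qed auto

text \<open>
  The recursion of Heilmann and Lieb for matching polynomials:
  \<open>T (root_poly A) = (z - \<xi>) T (root_poly (A - \<xi>)) + 2 c (\<Sum>\<eta>. T (root_poly (A - \<xi> - \<eta>)))\<close>, where
  \<open>T\<close> is evaluation of the heat flow at \<open>z\<close>.
\<close>

lemma heat_flow_root_poly_nonzero:
  assumes D: "D > 0" and c: "8 * cmod c * real N \<le> D\<^sup>2"
    and "size A \<le> N" and "\<And>\<xi>. \<xi> \<in># A \<Longrightarrow> cmod (z - \<xi>) \<ge> D"
  shows "poly (heat_flow c (root_poly A)) z \<noteq> 0 \<and>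
    (\<forall>\<xi>\<in>#A. cmod (poly (heat_flow c (root_poly (A - {#\<xi>#}))) z) \<le> 2 / D * cmod (poly (heat_flow c (root_poly A)) z))"
  using assms(3,4)
proof (induction "size A" arbitrary: A)
  case 0
  then have "A = {#}" by simp
  then show ?case by (simp add: root_poly_def heat_flow_def)
next
  case (Suc m)
  define H where "H = (\<lambda>A. poly (heat_flow c (root_poly A)) z)"
  have step: "H (A - {#\<xi>#}) \<noteq> 0 \<and> D / 2 * cmod (H (A - {#\<xi>#})) \<le> cmod (H A)" if \<xi>: "\<xi> \<in># A" for \<xi>
  proof -
    define B where "B = A - {#\<xi>#}"
    have A: "A = add_mset \<xi> B" using \<xi> by (simp add: B_def)
    have IH: "H B \<noteq> 0 \<and> (\<forall>\<eta>\<in>#B. cmod (H (B - {#\<eta>#})) \<le> 2 / D * cmod (H B))"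
      unfolding H_def using Suc.prems Suc.hyps(2) by (intro Suc.hyps(1)) (auto simp: A)
    have eq: "H A = (z - \<xi>) * H B + 2 * c * (\<Sum>\<eta>\<in>#B. H (B - {#\<eta>#}))"
      unfolding A H_def root_poly_add_mset poly_heat_flow_linear_mult pderiv_root_poly poly_heat_flow_sum_mset ..
    have "cmod (\<Sum>\<eta>\<in>#B. H (B - {#\<eta>#})) \<le> real (size B) * (2 / D * cmod (H B))"
      using IH by (intro norm_sum_mset_le) auto
    also have "\<dots> \<le> real N * (2 / D * cmod (H B))"
      using Suc.prems(1) D by (intro mult_right_mono) (auto simp: A)
    finally have "cmod (2 * c * (\<Sum>\<eta>\<in>#B. H (B - {#\<eta>#}))) \<le> 2 * cmod c * (real N * (2 / D * cmod (H B)))"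
      unfolding norm_mult by (intro mult_mono) auto
    \<comment> \<open>Here the constant 8 is spent: the coefficient \<open>2 * c\<close> and the
      inductive factor \<open>2 / D\<close> leave \<open>4 * cmod c * real N / D\<close>, at most
      half of the lower bound \<open>D\<close> of \<open>cmod (z - \<xi>)\<close>. The other half
      reproduces the factor \<open>2 / D\<close>.\<close>
    also have "\<dots> = (8 * cmod c * real N) / (2 * D) * cmod (H B)" using D by (simp add: field_simps)
    also have "\<dots> \<le> D\<^sup>2 / (2 * D) * cmod (H B)" using c D by (intro mult_right_mono divide_right_mono) auto
    also have "\<dots> = D / 2 * cmod (H B)" using D by (simp add: power2_eq_square)
    finally have 1: "cmod (2 * c * (\<Sum>\<eta>\<in>#B. H (B - {#\<eta>#}))) \<le> D / 2 * cmod (H B)" .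
    have "cmod ((z - \<xi>) * H B) \<ge> D * cmod (H B)"
      unfolding norm_mult using Suc.prems(2)[OF \<xi>] by (intro mult_right_mono) auto
    moreover have "cmod (H A) \<ge> cmod ((z - \<xi>) * H B) - cmod (2 * c * (\<Sum>\<eta>\<in>#B. H (B - {#\<eta>#})))"
      unfolding eq by (metis norm_diff_ineq)
    ultimately have "D / 2 * cmod (H B) \<le> cmod (H A)" using 1 by (simp add: field_simps)
    then show ?thesis using IH by (simp add: B_def)
  qed
  obtain \<xi>0 where \<xi>0: "\<xi>0 \<in># A" using Suc.hyps(2) by (cases A) auto
  have "H A \<noteq> 0"
  proof
    assume "H A = 0"
    then have "D / 2 * cmod (H (A - {#\<xi>0#})) \<le> 0" using step[OF \<xi>0] by simp
    then show False using step[OF \<xi>0] D by (simp add: mult_le_0_iff)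
  qed
  then show ?case using step D unfolding H_def by (auto simp: field_simps)
qed

lemma heat_flow_zero_bound:
  assumes p: "lead_coeff p = 1" and roots: "\<And>\<xi>. poly p \<xi> = 0 \<Longrightarrow> cmod \<xi> \<le> \<rho>"
    and z: "cmod z > \<rho> + sqrt (8 * cmod c * real (degree p))"
  shows "poly (heat_flow c p) z \<noteq> 0"
proof -
  have p0: "p \<noteq> 0" using p by auto
  define A where "A = proots p"
  have A: "root_poly A = p" "size A = degree p"
    using p complex_poly_decompose_multiset[of p] by (auto simp: A_def root_poly_def size_proots_complex)
  define D where "D = cmod z - \<rho>"
  have s: "0 \<le> sqrt (8 * cmod c * real (degree p))" by simp
  then have D: "D > 0" "sqrt (8 * cmod c * real (degree p)) \<le> D" using z unfolding D_def by linarith+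
  have "(sqrt (8 * cmod c * real (degree p)))\<^sup>2 \<le> D\<^sup>2" using D s by (intro power_mono) auto
  then have "8 * cmod c * real (degree p) \<le> D\<^sup>2" by simp
  moreover have "cmod (z - \<xi>) \<ge> D" if "\<xi> \<in># A" for \<xi>
    using roots[of \<xi>] that p0 norm_triangle_ineq2[of z \<xi>] by (auto simp: A_def D_def)
  ultimately show ?thesis using heat_flow_root_poly_nonzero[OF D(1), of c "degree p" A z] A by auto
qed

section \<open>Zero-free regions\<close>

lemma total_mult_eq_degree:
  assumes "p \<noteq> 0"
  shows "total_mult p = degree p"
proof -
  have "degree p = size (proots p)" by (simp add: size_proots_complex)
  also have "\<dots> = (\<Sum>x\<in>set_mset (proots p). count (proots p) x)" by (rule size_multiset_overloaded_eq)
  also have "\<dots> = total_mult p" using assms by (simp add: total_mult_def)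
  finally show ?thesis by simp
qed

text \<open>
  Substituting \<open>u = z + \<i> r x\<close> with \<open>r\<^sup>2 = t\<close> turns the exponent \<open>(z - u)\<^sup>2 / (2 t)\<close> into \<open>- x\<^sup>2 / 2\<close>, so
  that the contour is always the real line.
\<close>

definition dilated :: "complex poly \<Rightarrow> complex \<Rightarrow> complex \<Rightarrow> complex poly" where
  "dilated P z r = pcompose P [:z, \<i> * r:]"

lemma poly_dilated [simp]: "poly (dilated P z r) x = poly P (z + \<i> * r * x)"
  by (simp add: dilated_def poly_pcompose algebra_simps)

lemma pderiv_dilated: "pderiv (dilated P z r) = smult (\<i> * r) (dilated (pderiv P) z r)"
  by (simp add: dilated_def pderiv_pcompose pderiv_pCons)

lemma degree_dilated: "r \<noteq> 0 \<Longrightarrow> degree (dilated P z r) = degree P"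
  by (simp add: dilated_def degree_pcompose)

lemma lead_coeff_dilated: "r \<noteq> 0 \<Longrightarrow> lead_coeff (dilated P z r) = lead_coeff P * (\<i> * r) ^ degree P"
  unfolding dilated_def by (subst lead_coeff_comp) auto

lemma poly_saddle_eqn_dilated:
  "poly (saddle_eqn (dilated P z r) k) x = \<i> * r * poly (pderiv P) (z + \<i> * r * x) - of_real k * x * poly P (z + \<i> * r * x)"
  by (simp add: saddle_eqn_def pderiv_dilated)

lemma poly_pderiv_saddle_eqn_dilated:
  "poly (pderiv (saddle_eqn (dilated P z r) k)) x = (\<i> * r)\<^sup>2 * poly (pderiv (pderiv P)) (z + \<i> * r * x)
     - of_real k * poly P (z + \<i> * r * x) - of_real k * x * (\<i> * r) * poly (pderiv P) (z + \<i> * r * x)"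
  by (simp add: saddle_eqn_def pderiv_dilated pderiv_diff pderiv_mult pderiv_smult pderiv_pCons power2_eq_square algebra_simps)

lemma degree_lead_saddle_eqn:
  assumes "p \<noteq> 0" "k \<noteq> 0"
  shows "degree (saddle_eqn p k) = Suc (degree p)" "lead_coeff (saddle_eqn p k) = - (of_real k * lead_coeff p)"
proof -
  define q where "q = - ([:0, of_real k:] * p)"
  have eq: "saddle_eqn p k = pderiv p + q" by (simp add: saddle_eqn_def q_def)
  have dq: "degree q = Suc (degree p)"
    unfolding q_def degree_minus using assms by (subst degree_mult_eq) auto
  have lt: "degree (pderiv p) < degree q" unfolding dq by (simp add: degree_pderiv)
  show "degree (saddle_eqn p k) = Suc (degree p)" unfolding eq using degree_add_eq_right[OF lt] dq by simp
  have "lead_coeff (saddle_eqn p k) = lead_coeff q" unfolding eq by (rule lead_coeff_add_le[OF lt])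
  also have "\<dots> = - (of_real k * lead_coeff p)" unfolding q_def lead_coeff_minus lead_coeff_mult using assms by simp
  finally show "lead_coeff (saddle_eqn p k) = - (of_real k * lead_coeff p)" .
qed

text \<open>For \<open>\<sigma> = \<i> * r / sqrt N\<close> the Gaussian average is the evolved
  power. Scaling the variable by \<open>sqrt N\<close> makes the density a constant times the
  \<open>n\<close>-th power of a fixed Gaussian, so \<open>n\<close> enters the integrand only as an
  exponent.\<close>

lemma evolved_power_integral:
  assumes P: "lead_coeff P = 1" and \<alpha>: "degree P > 0" and n: "n \<ge> 1"
  obtains C where "C \<noteq> 0" "poly (evolved_power P n (r\<^sup>2)) z =
     C * (LINT x|lborel. gauss_poly (dilated P z r) (real (degree P)) (of_real x) ^ n)"
proof -
  have P0: "P \<noteq> 0" using P by auto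
  define N where "N = real (degree P) * real n"
  have N: "N > 0" using \<alpha> n by (simp add: N_def)
  define \<sigma> where "\<sigma> = \<i> * r / of_real (sqrt N)"
  have \<sigma>2: "\<sigma>\<^sup>2 / 2 = - (r\<^sup>2) / (2 * of_nat (total_mult P) * of_nat n)"
    using N by (simp add: \<sigma>_def power_divide power_mult_distrib total_mult_eq_degree[OF P0] flip: of_real_power)
      (simp add: N_def)
  have "poly (evolved_power P n (r\<^sup>2)) z = poly (heat_flow (\<sigma>\<^sup>2 / 2) (P ^ n)) z"
    unfolding evolved_power_def \<sigma>2 ..
  also have "\<dots> = (LINT x|lborel. of_real (std_normal_density x) * poly (P ^ n) (z + \<sigma> * of_real x))"
    using has_bochner_integral_integral_eq[OF heat_flow_gaussian_average] by metis
  also have "\<dots> = \<bar>sqrt N\<bar> *\<^sub>R (LINT x|lborel. of_real (std_normal_density (0 + sqrt N * x)) * poly (P ^ n) (z + \<sigma> * of_real (0 + sqrt N * x)))"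
    using N by (intro lborel_integral_real_affine) simp
  also have "(\<lambda>x::real. of_real (std_normal_density (0 + sqrt N * x)) * poly (P ^ n) (z + \<sigma> * of_real (0 + sqrt N * x)))
     = (\<lambda>x. of_real (1 / sqrt (2 * pi)) * gauss_poly (dilated P z r) (real (degree P)) (of_real x) ^ n)"
  proof
    fix x :: real
    have 1: "\<sigma> * of_real (0 + sqrt N * x) = \<i> * r * of_real x" using N by (simp add: \<sigma>_def)
    have 2: "std_normal_density (0 + sqrt N * x) = 1 / sqrt (2 * pi) * exp (- (real (degree P) * x\<^sup>2 / 2)) ^ n"
      using N by (simp add: std_normal_density_def power_mult_distrib N_def exp_of_nat_mult[symmetric])
    have "complex_of_real (std_normal_density (0 + sqrt N * x)) = of_real (1 / sqrt (2 * pi)) * exp (- (of_real (real (degree P)) * (of_real x)\<^sup>2 / 2)) ^ n"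
      unfolding 2 of_real_mult of_real_power exp_of_real[symmetric] by simp
    then show "of_real (std_normal_density (0 + sqrt N * x)) * poly (P ^ n) (z + \<sigma> * of_real (0 + sqrt N * x))
       = of_real (1 / sqrt (2 * pi)) * gauss_poly (dilated P z r) (real (degree P)) (of_real x) ^ n"
      unfolding 1 by (simp add: gauss_poly_def power_mult_distrib poly_power)
  qed
  also have "\<bar>sqrt N\<bar> *\<^sub>R (LINT x|lborel. complex_of_real (1 / sqrt (2 * pi)) * gauss_poly (dilated P z r) (real (degree P)) (of_real x) ^ n)
     = of_real (sqrt N * (1 / sqrt (2 * pi))) * (LINT x|lborel. gauss_poly (dilated P z r) (real (degree P)) (of_real x) ^ n)"
    unfolding integral_mult_right_zero using N by (simp add: scaleR_conv_of_real)
  finally show ?thesis using N by (intro that[of "of_real (sqrt N * (1 / sqrt (2 * pi)))"]) auto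
qed

text \<open>The parameter is \<open>(z, r)\<close> because the integrand is a polynomial in it times
  a fixed Gaussian, whereas \<open>(z, t)\<close> would require the choice of a root.\<close>

lemma eventually_nonvanishing_evolved_power_root:
  fixes z0 r0 :: complex
  assumes P: "lead_coeff P = 1" and \<alpha>: "degree P > 0" and r0: "r0 \<noteq> 0"
    and gen: "generic_saddles (dilated P z0 r0) (real (degree P))"
  shows "\<exists>N. \<forall>\<^sub>F (z, r) in nhds (z0, r0). \<forall>n\<ge>N. poly (evolved_power P n (r\<^sup>2)) z \<noteq> 0"
proof -
  define p where "p = dilated P z0 r0"
  define k where "k = real (degree P)"
  have P0: "P \<noteq> 0" using P by auto
  have k: "k > 0" "k \<ge> 1" using \<alpha> by (auto simp: k_def)
  have p0: "p \<noteq> 0" using degree_dilated[OF r0, of P z0] \<alpha> by (auto simp: p_def)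
  define \<Phi> where "\<Phi> = (\<lambda>(z, r). gauss_poly (dilated P z r) k)"
  have d1: "deriv (\<Phi> (z, r)) = gauss_poly (saddle_eqn (dilated P z r) k) k" for z r
    by (simp add: \<Phi>_def deriv_gauss_poly)
  have d2: "deriv (deriv (\<Phi> (z, r))) x = (poly (pderiv (saddle_eqn (dilated P z r) k)) x - of_real k * x * poly (saddle_eqn (dilated P z r) k) x) * exp (- (of_real k * x\<^sup>2 / 2))" for z r x
    by (simp add: d1 deriv_gauss_poly gauss_poly_def saddle_eqn_def[of "saddle_eqn _ _"])
  obtain x0 e A \<delta> where mp: "saddle_crossing (gauss_poly p k) x0 e A \<delta>"
    using mountain_pass_gauss_poly[OF p0 k(1)] gen unfolding p_def k_def by metis
  have \<Phi>0: "\<Phi> (z0, r0) = gauss_poly p k" by (simp add: \<Phi>_def p_def)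
  \<comment> \<open>Since \<open>k \<ge> 1\<close>, the Gaussian factor on the real line is at most
    \<open>w x * w x\<close>: one factor absorbs the growth of the polynomial, the other is the
    integrable majorant.\<close>
  define w where "w = (\<lambda>x::real. exp (- (x\<^sup>2) / 4))"
  have "\<exists>N. \<forall>\<^sub>F \<kappa> in nhds (z0, r0). \<forall>n\<ge>N. (LINT x|lborel. \<Phi> \<kappa> (of_real x) ^ n) \<noteq> 0"
  proof (rule saddle_point_nonvanishing[where w = w and ?\<delta>0.0 = \<delta>])
    show "\<Phi> \<kappa> holomorphic_on UNIV" for \<kappa>
      by (cases \<kappa>) (simp add: \<Phi>_def holomorphic_gauss_poly)
    show "continuous_on UNIV (\<lambda>(\<kappa>, x). \<Phi> \<kappa> x)"
      unfolding \<Phi>_def case_prod_unfold gauss_poly_def poly_dilated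
      by (auto intro!: continuous_intros)
    show "continuous_on UNIV (\<lambda>(\<kappa>, x). deriv (\<Phi> \<kappa>) x)"
    proof -
      have eq: "(\<lambda>(\<kappa>, x). deriv (\<Phi> \<kappa>) x) = (\<lambda>(\<kappa>, x). poly (saddle_eqn (dilated P (fst \<kappa>) (snd \<kappa>)) k) x * exp (- (of_real k * x\<^sup>2 / 2)))"
        by (auto simp: d1 gauss_poly_def fun_eq_iff)
      show ?thesis unfolding eq unfolding case_prod_unfold poly_saddle_eqn_dilated
        by (auto intro!: continuous_intros)
    qed
    show "continuous_on UNIV (\<lambda>(\<kappa>, x). deriv (deriv (\<Phi> \<kappa>)) x)"
    proof -
      have eq: "(\<lambda>(\<kappa>, x). deriv (deriv (\<Phi> \<kappa>)) x) = (\<lambda>(\<kappa>, x). (poly (pderiv (saddle_eqn (dilated P (fst \<kappa>) (snd \<kappa>)) k)) x - of_real k * x * poly (saddle_eqn (dilated P (fst \<kappa>) (snd \<kappa>)) k) x) * exp (- (of_real k * x\<^sup>2 / 2)))"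
        by (auto simp: d2 fun_eq_iff)
      show ?thesis unfolding eq unfolding case_prod_unfold poly_saddle_eqn_dilated poly_pderiv_saddle_eqn_dilated
        by (auto intro!: continuous_intros)
    qed
    show "\<forall>\<^sub>F \<kappa> in nhds (z0, r0). \<exists>y. dist x0 y < \<epsilon> \<and> deriv (\<Phi> \<kappa>) y = 0" if \<epsilon>: "\<epsilon> > 0" for \<epsilon>
    proof -
      \<comment> \<open>\<open>h\<close> below is the modulus of the leading coefficient of the
        saddle equation times \<open>\<epsilon>\<close> to its degree. While \<open>g\<close> is
        smaller than \<open>h\<close>, \<open>poly_nearest_root\<close> yields a critical point
        within \<open>\<epsilon>\<close> of \<open>x0\<close>; at \<open>(z0, r0)\<close> the value
        of \<open>g\<close> is 0.\<close>
      define g where "g = (\<lambda>\<kappa>. cmod (poly (saddle_eqn (dilated P (fst \<kappa>) (snd \<kappa>)) k) x0))"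
      define h where "h = (\<lambda>\<kappa>::complex \<times> complex. k * cmod (snd \<kappa>) ^ degree P * \<epsilon> ^ Suc (degree P))"
      have "continuous_on UNIV (\<lambda>\<kappa>. h \<kappa> - g \<kappa>)"
        unfolding g_def h_def poly_saddle_eqn_dilated by (intro continuous_intros)
      then have ic: "isCont (\<lambda>\<kappa>. h \<kappa> - g \<kappa>) (z0, r0)" by (simp add: continuous_on_eq_continuous_at)
      have "poly (saddle_eqn p k) x0 = 0" using mp by (simp add: saddle_crossing_def deriv_gauss_poly)
      then have "h (z0, r0) - g (z0, r0) > 0" using k \<epsilon> r0 by (simp add: h_def g_def p_def)
      then have "\<forall>\<^sub>F \<kappa> in nhds (z0, r0). h \<kappa> - g \<kappa> \<in> {0<..}"
        by (intro isCont_eventually_in_open[OF ic]) auto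
      moreover have "\<forall>\<^sub>F \<kappa> in nhds (z0, r0). snd \<kappa> \<in> - {0}"
        using r0 by (intro isCont_eventually_in_open) (auto intro!: continuous_intros)
      ultimately show ?thesis
      proof eventually_elim
        case (elim \<kappa>)
        define q where "q = saddle_eqn (dilated P (fst \<kappa>) (snd \<kappa>)) k"
        have r: "snd \<kappa> \<noteq> 0" using elim(2) by simp
        have dn: "dilated P (fst \<kappa>) (snd \<kappa>) \<noteq> 0" using degree_dilated[OF r, of P "fst \<kappa>"] \<alpha> by auto
        have dq: "degree q = Suc (degree P)" "cmod (lead_coeff q) = k * cmod (snd \<kappa>) ^ degree P"
          using degree_lead_saddle_eqn[OF dn, of k] k degree_dilated[OF r, of P "fst \<kappa>"] lead_coeff_dilated[OF r, of P "fst \<kappa>"] P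
          by (auto simp: q_def norm_mult norm_power)
        obtain y where y: "poly q y = 0" "cmod (lead_coeff q) * cmod (x0 - y) ^ degree q \<le> cmod (poly q x0)"
          using poly_nearest_root[of q x0] dq by auto
        have "k * cmod (snd \<kappa>) ^ degree P * cmod (x0 - y) ^ Suc (degree P) < k * cmod (snd \<kappa>) ^ degree P * \<epsilon> ^ Suc (degree P)"
          using y(2)[unfolded dq(2), unfolded dq(1)] elim(1) by (simp add: h_def g_def q_def)
        then have "cmod (x0 - y) ^ Suc (degree P) < \<epsilon> ^ Suc (degree P)"
          using k r by (subst (asm) mult_less_cancel_left_pos) auto
        then have "cmod (x0 - y) < \<epsilon>" using \<epsilon> by (metis less_imp_le power_less_imp_less_base)
        moreover have "deriv (\<Phi> \<kappa>) y = 0" using y(1) d1[of "fst \<kappa>" "snd \<kappa>"] by (simp add: q_def)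
        ultimately show ?case by (auto simp: dist_norm)
      qed
    qed
    show "integrable lborel w"
    proof -
      have "integrable lborel (\<lambda>x. std_normal_density x * x ^ 0)" by (rule integrable_std_normal_moment)
      then have "integrable lborel (\<lambda>x. std_normal_density (0 + (1 / sqrt 2) * x))"
        using lborel_integrable_real_affine[of std_normal_density "1 / sqrt 2" 0] by simp
      then have "integrable lborel (\<lambda>x. sqrt (2 * pi) * std_normal_density (0 + (1 / sqrt 2) * x))"
        by (rule integrable_mult_right)
      moreover have "(\<lambda>x. sqrt (2 * pi) * std_normal_density (0 + (1 / sqrt 2) * x)) = w"
        by (auto simp: w_def std_normal_density_def power_divide fun_eq_iff)
      ultimately show ?thesis by (simp only:)
    qed
    show "\<exists>X. \<forall>\<^sub>F \<kappa> in nhds (z0, r0). \<forall>x. \<bar>x\<bar> \<ge> X \<longrightarrow> cmod (\<Phi> \<kappa> (of_real x)) \<le> \<theta> * w x" if \<theta>: "\<theta> > 0" for \<theta>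
    proof -
      obtain B where B: "B > 0" "\<And>x. cmod (poly P x) \<le> B * (1 + cmod x) ^ degree P" using poly_norm_growth by blast
      define Z where "Z = cmod z0 + 1"
      define R where "R = cmod r0 + 1"
      have ZR: "Z > 0" "R > 0" by (auto simp: Z_def R_def add_nonneg_pos)
      have "((\<lambda>x::real. B * (1 + (Z + R * x)) ^ degree P * exp (- (x\<^sup>2) / 4)) \<longlongrightarrow> 0) at_top"
        using ZR by real_asymp
      then have "\<forall>\<^sub>F x in at_top. B * (1 + (Z + R * x)) ^ degree P * exp (- (x\<^sup>2) / 4) < \<theta>"
        using \<theta> by (rule order_tendstoD(2))
      then obtain X where X: "\<And>x. x \<ge> X \<Longrightarrow> B * (1 + (Z + R * x)) ^ degree P * exp (- (x\<^sup>2) / 4) < \<theta>"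
        unfolding eventually_at_top_linorder by blast
      have "\<forall>\<^sub>F \<kappa> in nhds (z0, r0). fst \<kappa> \<in> ball 0 Z"
        by (intro isCont_eventually_in_open) (auto intro!: continuous_intros simp: Z_def)
      moreover have "\<forall>\<^sub>F \<kappa> in nhds (z0, r0). snd \<kappa> \<in> ball 0 R"
        by (intro isCont_eventually_in_open) (auto intro!: continuous_intros simp: R_def)
      ultimately have "\<forall>\<^sub>F \<kappa> in nhds (z0, r0). \<forall>x. \<bar>x\<bar> \<ge> X \<longrightarrow> cmod (\<Phi> \<kappa> (of_real x)) \<le> \<theta> * w x"
      proof eventually_elim
        case (elim \<kappa>)
        show ?case
        proof (intro allI impI)
          fix x :: real assume x: "\<bar>x\<bar> \<ge> X"
          have "cmod (fst \<kappa> + \<i> * snd \<kappa> * of_real x) \<le> cmod (fst \<kappa>) + cmod (snd \<kappa>) * \<bar>x\<bar>"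
            by (rule order_trans[OF norm_triangle_ineq]) (simp add: norm_mult)
          also have "\<dots> \<le> Z + R * \<bar>x\<bar>" using elim by (intro add_mono mult_right_mono) auto
          finally have "B * (1 + cmod (fst \<kappa> + \<i> * snd \<kappa> * of_real x)) ^ degree P \<le> B * (1 + (Z + R * \<bar>x\<bar>)) ^ degree P"
            using B(1) by (intro mult_left_mono power_mono) auto
          then have 1: "cmod (poly P (fst \<kappa> + \<i> * snd \<kappa> * of_real x)) \<le> B * (1 + (Z + R * \<bar>x\<bar>)) ^ degree P"
            using B(2) order_trans by blast
          have "k * x\<^sup>2 \<ge> 1 * x\<^sup>2" using k by (intro mult_right_mono) auto
          then have "exp (k * ((Im (of_real x))\<^sup>2 - (Re (of_real x))\<^sup>2) / 2) \<le> exp (- (x\<^sup>2) / 4) * exp (- (x\<^sup>2) / 4)"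
            unfolding exp_add[symmetric] by simp
          then have "cmod (\<Phi> \<kappa> (of_real x)) \<le> B * (1 + (Z + R * \<bar>x\<bar>)) ^ degree P * (exp (- (x\<^sup>2) / 4) * exp (- (x\<^sup>2) / 4))"
            unfolding \<Phi>_def case_prod_unfold norm_gauss_poly poly_dilated using 1 B ZR by (intro mult_mono) auto
          also have "\<dots> = B * (1 + (Z + R * \<bar>x\<bar>)) ^ degree P * exp (- (\<bar>x\<bar>\<^sup>2) / 4) * w x" by (simp add: w_def)
          also have "\<dots> \<le> \<theta> * w x" using X[OF x] by (intro mult_right_mono) (auto simp: w_def)
          finally show "cmod (\<Phi> \<kappa> (of_real x)) \<le> \<theta> * w x" .
        qed
      qed
      then show ?thesis by blast
    qed
  qed (use mp in \<open>auto simp: \<Phi>0 w_def\<close>)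
  then obtain N where N: "\<forall>\<^sub>F \<kappa> in nhds (z0, r0). \<forall>n\<ge>N. (LINT x|lborel. \<Phi> \<kappa> (of_real x) ^ n) \<noteq> 0" by blast
  have "\<forall>\<^sub>F (z, r) in nhds (z0, r0). \<forall>n\<ge>max N 1. poly (evolved_power P n (r\<^sup>2)) z \<noteq> 0"
    using N
  proof eventually_elim
    case (elim \<kappa>)
    obtain z r where \<kappa>: "\<kappa> = (z, r)" by (cases \<kappa>)
    have "poly (evolved_power P n (r\<^sup>2)) z \<noteq> 0" if n: "n \<ge> max N 1" for n
    proof -
      obtain C where C: "C \<noteq> 0" "poly (evolved_power P n (r\<^sup>2)) z = C * (LINT x|lborel. gauss_poly (dilated P z r) (real (degree P)) (of_real x) ^ n)"
        using evolved_power_integral[OF P \<alpha>, of n r z] n by auto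
      show ?thesis using elim n C unfolding C(2) \<kappa> \<Phi>_def k_def by auto
    qed
    then show ?case by (simp add: \<kappa>)
  qed
  then show ?thesis by blast
qed

lemma eventually_nonvanishing_evolved_power:
  fixes z0 r0 t0 :: complex
  assumes P: "lead_coeff P = 1" and \<alpha>: "degree P > 0" and r0: "r0 \<noteq> 0" "r0\<^sup>2 = t0"
    and gen: "generic_saddles (dilated P z0 r0) (real (degree P))"
  obtains N \<epsilon> where "\<epsilon> > 0" "\<And>z t n. dist z z0 < \<epsilon> \<Longrightarrow> dist t t0 < \<epsilon> \<Longrightarrow> n \<ge> N \<Longrightarrow> poly (evolved_power P n t) z \<noteq> 0"
proof -
  obtain N where N: "\<forall>\<^sub>F (z, r) in nhds (z0, r0). \<forall>n\<ge>N. poly (evolved_power P n (r\<^sup>2)) z \<noteq> 0"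
    using eventually_nonvanishing_evolved_power_root[OF P \<alpha> r0(1) gen] by blast
  obtain Pf Pg where Pfg: "eventually Pf (nhds z0)" "eventually Pg (nhds r0)"
       "\<And>z r. Pf z \<Longrightarrow> Pg r \<Longrightarrow> \<forall>n\<ge>N. poly (evolved_power P n (r\<^sup>2)) z \<noteq> 0"
    using N unfolding nhds_prod eventually_prod_filter by auto
  have t0: "t0 \<noteq> 0" using r0 by auto
  \<comment> \<open>The branch of the square root through \<open>r0\<close>; dividing by
    \<open>t0\<close> moves the base point to 1, away from the cut of \<open>csqrt\<close>.\<close>
  define \<rho> where "\<rho> = (\<lambda>t. r0 * csqrt (t / t0))"
  have "isCont \<rho> t0" unfolding \<rho>_def using t0 by (intro continuous_intros) auto
  then have "filterlim \<rho> (nhds r0) (nhds t0)"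
    using t0 unfolding continuous_at tendsto_at_iff_tendsto_nhds by (simp add: \<rho>_def)
  then have "\<forall>\<^sub>F t in nhds t0. Pg (\<rho> t)" using Pfg(2) unfolding filterlim_iff by blast
  then obtain \<epsilon>1 \<epsilon>2 where \<epsilon>: "\<epsilon>1 > 0" "\<And>z. dist z z0 < \<epsilon>1 \<Longrightarrow> Pf z" "\<epsilon>2 > 0" "\<And>t. dist t t0 < \<epsilon>2 \<Longrightarrow> Pg (\<rho> t)"
    using Pfg(1) unfolding eventually_nhds_metric by metis
  have sq: "(\<rho> t)\<^sup>2 = t" for t using r0 t0 by (simp add: \<rho>_def power_mult_distrib)
  show ?thesis
  proof (rule that[of "min \<epsilon>1 \<epsilon>2"])
    show "poly (evolved_power P n t) z \<noteq> 0" if "dist z z0 < min \<epsilon>1 \<epsilon>2" "dist t t0 < min \<epsilon>1 \<epsilon>2" "n \<ge> N" for z t n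
      using Pfg(3)[OF \<epsilon>(2)[of z] \<epsilon>(4)[of t]] that by (simp add: sq)
  qed (use \<epsilon> in auto)
qed

text \<open>The orders of the roots add up to the degree, so with this many distinct roots there is
  no room for an order above 1.\<close>

lemma simple_roots_of_card:
  fixes q :: "complex poly"
  assumes "degree q \<le> card {u. poly q u = 0}" "q \<noteq> 0" "poly q u = 0"
  shows "poly (pderiv q) u \<noteq> 0"
proof
  assume d0: "poly (pderiv q) u = 0"
  define S where "S = {u. poly q u = 0}"
  have fin: "finite S" unfolding S_def using assms(2) by (rule poly_roots_finite)
  have ge1: "order v q \<ge> 1" if "v \<in> S" for v using that assms(2) by (simp add: S_def order_root Suc_le_eq)
  have sum: "(\<Sum>v\<in>S. order v q) = degree q"
    using total_mult_eq_degree[OF assms(2)] by (simp add: total_mult_def S_def)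
  have uS: "u \<in> S" using assms(3) by (simp add: S_def)
  have "order u q \<noteq> 1"
  proof
    assume "order u q = 1"
    then have "order u (pderiv q) = 0" using order_pderiv[of q u] assms(2,3) d0
      by (metis One_nat_def Suc_inject order_root pderiv_0)
    moreover have "pderiv q \<noteq> 0"
    proof
      assume "pderiv q = 0"
      then have "degree q = 0" by (simp add: pderiv_eq_0_iff)
      then show False using assms(2,3) by (metis degree_eq_zeroE order_root poly_const_conv pCons_0_0 poly_0)
    qed
    ultimately show False using d0 by (simp add: order_root)
  qed
  then have "order u q \<ge> 2" using ge1[OF uS] by simp
  moreover have "(\<Sum>v\<in>S. 1) < (\<Sum>v\<in>S. order v q)"
    using fin uS ge1 \<open>order u q \<ge> 2\<close> by (intro sum_strict_mono_ex1) (auto intro!: bexI[of _ u])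
  ultimately show False using sum assms(1) by (simp add: S_def)
qed

text \<open>The partial fraction expansion of \<open>pderiv R / R\<close> with all denominators
  cleared, hence valid as an identity of polynomials.\<close>

lemma logarithmic_derivative_numerator:
  fixes R :: "complex poly"
  assumes "R \<noteq> 0"
  defines "N \<equiv> {\<nu>. poly R \<nu> = 0}"
  shows "(\<Sum>\<nu>\<in>N. smult (of_nat (order \<nu> R)) (\<Prod>\<kappa>\<in>N - {\<nu>}. [:- \<kappa>, 1:])) * R = (\<Prod>\<nu>\<in>N. [:- \<nu>, 1:]) * pderiv R"
proof -
  have fin: "finite N" unfolding N_def using assms by (intro poly_roots_finite) auto
  define f where "f = (\<lambda>\<nu>. [:- \<nu>, 1:] ^ order \<nu> R)"
  have R: "R = smult (lead_coeff R) (prod f N)"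
    using complex_poly_decompose[of R] by (simp add: N_def f_def)
  have df: "[:- \<nu>, 1:] * pderiv (f \<nu>) = smult (of_nat (order \<nu> R)) (f \<nu>)" if "\<nu> \<in> N" for \<nu>
  proof -
    have "order \<nu> R \<noteq> 0" using that assms(1) by (simp add: N_def order_root)
    then obtain m where m: "order \<nu> R = Suc m" using not0_implies_Suc by blast
    have "pderiv [:- \<nu>, 1:] = 1" by (simp add: pderiv_pCons one_pCons)
    then show ?thesis unfolding f_def m pderiv_power_Suc by (simp del: mult_pCons_left add: mult_ac)
  qed
  have summand: "smult (of_nat (order \<nu> R)) (\<Prod>\<kappa>\<in>N - {\<nu>}. [:- \<kappa>, 1:]) * prod f N = (\<Prod>\<nu>\<in>N. [:- \<nu>, 1:]) * (prod f (N - {\<nu>}) * pderiv (f \<nu>))"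
    if \<nu>: "\<nu> \<in> N" for \<nu>
  proof -
    define D where "D = (\<Prod>\<kappa>\<in>N - {\<nu>}. [:- \<kappa>, 1:])"
    define M where "M = prod f (N - {\<nu>})"
    have 1: "(\<Prod>\<nu>\<in>N. [:- \<nu>, 1:]) = [:- \<nu>, 1:] * D" unfolding D_def using fin \<nu> by (rule prod.remove)
    have 2: "prod f N = f \<nu> * M" unfolding M_def using fin \<nu> by (rule prod.remove)
    have "[:- \<nu>, 1:] * D * (M * pderiv (f \<nu>)) = D * M * ([:- \<nu>, 1:] * pderiv (f \<nu>))" by (simp only: mult_ac)
    also have "\<dots> = smult (of_nat (order \<nu> R)) D * (f \<nu> * M)" unfolding df[OF \<nu>] by (simp add: mult_ac)
    finally show ?thesis unfolding 1 2 D_def[symmetric] M_def[symmetric] by simp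
  qed
  have "pderiv R = smult (lead_coeff R) (\<Sum>\<nu>\<in>N. prod f (N - {\<nu>}) * pderiv (f \<nu>))"
    by (subst R) (simp add: pderiv_smult pderiv_prod)
  then have "(\<Prod>\<nu>\<in>N. [:- \<nu>, 1:]) * pderiv R = smult (lead_coeff R) (\<Sum>\<nu>\<in>N. (\<Prod>\<nu>\<in>N. [:- \<nu>, 1:]) * (prod f (N - {\<nu>}) * pderiv (f \<nu>)))"
    by (simp add: sum_distrib_left)
  also have "\<dots> = smult (lead_coeff R) (\<Sum>\<nu>\<in>N. smult (of_nat (order \<nu> R)) (\<Prod>\<kappa>\<in>N - {\<nu>}. [:- \<kappa>, 1:]) * prod f N)"
    using summand by (intro arg_cong[of _ _ "smult (lead_coeff R)"] sum.cong) auto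
  also have "\<dots> = (\<Sum>\<nu>\<in>N. smult (of_nat (order \<nu> R)) (\<Prod>\<kappa>\<in>N - {\<nu>}. [:- \<kappa>, 1:])) * smult (lead_coeff R) (prod f N)"
    by (simp add: sum_distrib_right)
  finally show ?thesis by (simp flip: R)
qed

text \<open>\<open>saddle_poly\<close> contains each zero of \<open>R\<close> only as a simple
  factor. Multiplying by \<open>R\<close> restores the multiplicities and makes it comparable with
  an expression in \<open>R\<close> and its derivative.\<close>

lemma saddle_poly_mult:
  assumes "R \<noteq> 0"
  shows "saddle_poly s R z * R = (\<Prod>\<nu>\<in>{\<nu>. poly R \<nu> = 0}. [:- \<nu>, 1:]) *
     (smult (of_real s / of_nat (degree R)) (pderiv R) - [:z, - 1:] * R)"
  unfolding saddle_poly_def Let_def total_mult_eq_degree[OF assms] left_diff_distrib mult_smult_left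
    logarithmic_derivative_numerator[OF assms]
  by (simp only: right_diff_distrib mult_smult_right mult_smult_left mult_ac)

lemma degree_saddle_poly_le:
  assumes "R \<noteq> 0"
  shows "degree (saddle_poly s R z) \<le> card {\<nu>. poly R \<nu> = 0} + 1"
proof -
  define N where "N = {\<nu>. poly R \<nu> = 0}"
  have fin: "finite N" unfolding N_def using assms by (intro poly_roots_finite) auto
  have dp: "degree (\<Prod>\<kappa>\<in>M. [:- \<kappa>, 1::complex:]) = card M" for M
    by (subst degree_prod_sum_eq) auto
  have "degree (\<Sum>\<nu>\<in>N. smult (of_nat (order \<nu> R)) (\<Prod>\<kappa>\<in>N - {\<nu>}. [:- \<kappa>, 1:])) \<le> card N + 1"
  proof (rule degree_sum_le[OF fin])
    fix \<nu> assume "\<nu> \<in> N"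
    have "degree (\<Prod>\<kappa>\<in>N - {\<nu>}. [:- \<kappa>, 1:]) \<le> card N" unfolding dp using fin by (intro card_mono) auto
    then show "degree (smult (of_nat (order \<nu> R)) (\<Prod>\<kappa>\<in>N - {\<nu>}. [:- \<kappa>, 1:])) \<le> card N + 1"
      using degree_smult_le le_trans by (metis trans_le_add1)
  qed
  then have "degree (smult c (\<Sum>\<nu>\<in>N. smult (of_nat (order \<nu> R)) (\<Prod>\<kappa>\<in>N - {\<nu>}. [:- \<kappa>, 1:]))) \<le> card N + 1" for c
    using degree_smult_le order_trans by blast
  moreover have "degree ([:z, - 1:] * (\<Prod>\<nu>\<in>N. [:- \<nu>, 1:])) \<le> card N + 1"
    using degree_mult_le[of "[:z, - 1:]" "\<Prod>\<nu>\<in>N. [:- \<nu>, 1:]"] unfolding dp by simp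
  ultimately show ?thesis unfolding saddle_poly_def Let_def N_def[symmetric] by (intro degree_diff_le)
qed

text \<open>Under \<open>u = z + \<i> * sqrt s * x\<close> the saddles of nonzero value become roots
  of \<open>saddle_poly\<close>, all simple because their number reaches the degree bound. The
  logarithm of the modulus becomes \<open>degree R\<close> times \<open>saddle_fun\<close> plus a
  constant, so distinct values give distinct moduli.\<close>

lemma generic_saddle_conditions:
  fixes R :: "complex poly" and s :: real and z :: complex
  assumes R: "degree R > 0" and s: "s > 0" and z: "z \<in> generic_points s R"
  shows "generic_saddles (dilated R z (of_real (sqrt s))) (real (degree R))"
proof -
  define p where "p = dilated R z (of_real (sqrt s))"
  define k where "k = real (degree R)"
  have R0: "R \<noteq> 0" using R by auto
  have k: "k > 0" using R by (simp add: k_def)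
  define N where "N = {\<nu>. poly R \<nu> = 0}"
  have fin: "finite N" unfolding N_def using R0 by (intro poly_roots_finite) auto
  define Q where "Q = saddle_poly s R z"
  define D where "D = (\<Prod>\<nu>\<in>N. [:- \<nu>, 1:])"
  define E where "E = smult (of_real s / of_nat (degree R)) (pderiv R) - [:z, - 1:] * R"
  have QE: "Q * R = D * E" unfolding Q_def D_def E_def N_def using saddle_poly_mult[OF R0] by simp
  have card: "card {u. poly Q u = 0} = card N + 1" and injG: "inj_on (saddle_fun s R z) {u. poly Q u = 0}"
    using z by (auto simp: generic_points_def Q_def N_def)
  have Q0: "Q \<noteq> 0"
  proof
    assume "Q = 0"
    then have "card {u. poly Q u = 0} = 0" by (simp add: infinite_UNIV_char_0)
    then show False using card by simp
  qed
  have simple: "poly (pderiv Q) u \<noteq> 0" if "poly Q u = 0" for u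
    using degree_saddle_poly_le[OF R0, of s z] card that Q0
    by (intro simple_roots_of_card) (auto simp: Q_def N_def)
  have D: "poly D u \<noteq> 0" if "poly R u \<noteq> 0" for u
    using that fin by (auto simp: D_def poly_prod N_def)
  define c where "c = \<i> * of_real (sqrt s)"
  have c: "c \<noteq> 0" "c\<^sup>2 = - of_real s" using s by (auto simp: c_def power_mult_distrib simp flip: of_real_power)
  have px: "poly p x = poly R (z + c * x)" for x by (simp add: p_def c_def)
  have Ex: "poly E (z + c * x) = - (c / of_real k) * poly (saddle_eqn p k) x" for x
  proof -
    have e: "poly (saddle_eqn p k) x = c * poly (pderiv R) (z + c * x) - of_real k * x * poly R (z + c * x)"
      by (simp add: p_def poly_saddle_eqn_dilated c_def)
    have "- (c / of_real k) * poly (saddle_eqn p k) x = - (c\<^sup>2 / of_real k) * poly (pderiv R) (z + c * x) + c * x * poly R (z + c * x)"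
      unfolding e using k by (simp add: field_simps power2_eq_square)
    then show ?thesis unfolding c(2) using k by (simp add: E_def k_def field_simps)
  qed
  have dEx: "poly (pderiv E) (z + c * x) * c = - (c / of_real k) * poly (pderiv (saddle_eqn p k)) x" for x
  proof -
    have 1: "((\<lambda>x. poly E (z + c * x)) has_field_derivative poly (pderiv E) (z + c * x) * c) (at x)"
      by (rule DERIV_chain2[where g = "\<lambda>x. z + c * x" and x = x, OF poly_DERIV]) (auto intro!: derivative_eq_intros)
    have 2: "((\<lambda>x. - (c / of_real k) * poly (saddle_eqn p k) x) has_field_derivative - (c / of_real k) * poly (pderiv (saddle_eqn p k)) x) (at x)"
      by (intro DERIV_cmult poly_DERIV)
    show ?thesis using DERIV_unique[OF 1] 2 unfolding Ex by simp
  qed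
  have rootQ: "poly Q (z + c * x) = 0" if x: "poly p x \<noteq> 0" "poly (saddle_eqn p k) x = 0" for x
  proof -
    have "poly Q (z + c * x) * poly R (z + c * x) = poly D (z + c * x) * poly E (z + c * x)"
      using arg_cong[OF QE, of "\<lambda>q. poly q (z + c * x)"] by simp
    then show ?thesis using x unfolding Ex px by simp
  qed
  \<comment> \<open>A double zero of \<open>E\<close> would be a double zero of
    \<open>Q * R\<close>; as \<open>R\<close> does not vanish there, it would be a double root of
    \<open>Q\<close>.\<close>
  have nondeg: "poly (pderiv (saddle_eqn p k)) x \<noteq> 0" if x: "poly p x \<noteq> 0" "poly (saddle_eqn p k) x = 0" for x
  proof
    assume z0: "poly (pderiv (saddle_eqn p k)) x = 0"
    define u where "u = z + c * x"
    have E0: "poly E u = 0" "poly (pderiv E) u = 0" using Ex[of x] dEx[of x] x(2) z0 c by (auto simp: u_def)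
    have "poly (pderiv (Q * R)) u = poly (pderiv (D * E)) u" using QE by simp
    then have "poly (pderiv Q) u * poly R u = 0" using E0 rootQ[OF x] by (auto simp: pderiv_mult u_def)
    then show False using simple[OF rootQ[OF x]] x(1) by (simp add: px u_def)
  qed
  have inj: "x = y" if xy: "poly p x \<noteq> 0" "poly p y \<noteq> 0" "poly (saddle_eqn p k) x = 0" "poly (saddle_eqn p k) y = 0"
       "cmod (gauss_poly p k x) = cmod (gauss_poly p k y)" for x y
  proof -
    have lc: "cmod (lead_coeff R) > 0" using R0 by simp
    have lnG: "ln (cmod (gauss_poly p k x)) = ln (cmod (lead_coeff R)) + k * saddle_fun s R z (z + c * x)" if x: "poly p x \<noteq> 0" for x
    proof -
      define u where "u = z + c * x"
      have ne: "u - \<nu> \<noteq> 0" if "\<nu> \<in> N" for \<nu> using that x by (auto simp: N_def px u_def)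
      have pR: "poly R u = lead_coeff R * (\<Prod>\<nu>\<in>N. (u - \<nu>) ^ order \<nu> R)"
        by (subst complex_poly_decompose[of R, symmetric]) (simp add: N_def poly_prod poly_power)
      have "ln (cmod (poly R u)) = ln (cmod (lead_coeff R)) + ln (\<Prod>\<nu>\<in>N. cmod (u - \<nu>) ^ order \<nu> R)"
        unfolding pR norm_mult using lc ne fin by (subst ln_mult) (auto simp: norm_power simp flip: prod_norm)
      also have "ln (\<Prod>\<nu>\<in>N. cmod (u - \<nu>) ^ order \<nu> R) = (\<Sum>\<nu>\<in>N. ln (cmod (u - \<nu>) ^ order \<nu> R))"
        using fin ne by (intro ln_prod) auto
      also have "\<dots> = (\<Sum>\<nu>\<in>N. real (order \<nu> R) * ln (cmod (u - \<nu>)))"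
        by (intro sum.cong refl ln_realpow)
      finally have 1: "ln (cmod (poly R u)) = ln (cmod (lead_coeff R)) + (\<Sum>\<nu>\<in>N. real (order \<nu> R) * ln (cmod (u - \<nu>)))" .
      have "(z - u)\<^sup>2 / (2 * of_real s) = - (x\<^sup>2) / 2"
        using c(2) s by (simp add: u_def power_mult_distrib)
      then have "Re ((z - u)\<^sup>2 / (2 * of_real s)) = Re (- (x\<^sup>2) / 2)" by (simp only:)
      also have "\<dots> = ((Im x)\<^sup>2 - (Re x)\<^sup>2) / 2" by (simp add: Re_power2 field_simps)
      finally have 2: "Re ((z - u)\<^sup>2 / (2 * of_real s)) = ((Im x)\<^sup>2 - (Re x)\<^sup>2) / 2" .
      have "ln (cmod (gauss_poly p k x)) = ln (cmod (poly R u)) + k * ((Im x)\<^sup>2 - (Re x)\<^sup>2) / 2"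
        unfolding norm_gauss_poly using x by (subst ln_mult) (auto simp: px u_def)
      also have "\<dots> = ln (cmod (lead_coeff R)) + k * saddle_fun s R z u"
        unfolding saddle_fun_def 1 2 total_mult_eq_degree[OF R0] N_def[symmetric] k_def[symmetric]
        using k by (simp add: distrib_left)
      finally show ?thesis by (simp add: u_def)
    qed
    have "k * saddle_fun s R z (z + c * x) = k * saddle_fun s R z (z + c * y)"
      using lnG[OF xy(1)] lnG[OF xy(2)] xy(5) by auto
    then have "saddle_fun s R z (z + c * x) = saddle_fun s R z (z + c * y)" using k by simp
    then have "z + c * x = z + c * y"
      using inj_onD[OF injG] rootQ xy by blast
    then show ?thesis using c by simp
  qed
  show ?thesis
    unfolding generic_saddles_def p_def[symmetric] k_def[symmetric]
    using nondeg inj by (auto intro!: inj_onI)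
qed

text \<open>The rotation by \<open>\<omega>\<close> and the dilation by \<open>sqrt (cmod t)\<close>
  combine to \<open>r\<close>, a square root of \<open>t\<close>, so the rotated data give the same
  dilated polynomial as \<open>P\<close> at \<open>z\<close>.\<close>

lemma pde_domain_nonvanishing:
  assumes P: "lead_coeff P = 1" and \<alpha>: "degree P > 0" and zt: "(z, t) \<in> pde_domain P"
  obtains N \<epsilon> where "\<epsilon> > 0" "\<And>w s n. dist w z < \<epsilon> \<Longrightarrow> dist s t < \<epsilon> \<Longrightarrow> n \<ge> N \<Longrightarrow> poly (evolved_power P n s) w \<noteq> 0"
proof -
  obtain \<theta> where t: "t \<noteq> 0" "t = of_real (cmod t) * cis \<theta>"
    and g: "cis (- \<theta> / 2) * z \<in> generic_points (cmod t) (pcompose P [:0, cis (\<theta> / 2):])"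
    using zt by (auto simp: pde_domain_def)
  define \<omega> where "\<omega> = cis (\<theta> / 2)"
  have \<omega>: "\<omega> \<noteq> 0" "cis (- \<theta> / 2) * \<omega> = 1" by (auto simp: \<omega>_def cis_mult)
  define R where "R = pcompose P [:0, \<omega>:]"
  have degR: "degree R = degree P" using \<omega> by (simp add: R_def degree_pcompose)
  define r where "r = of_real (sqrt (cmod t)) * \<omega>"
  have r0: "r \<noteq> 0" using t \<omega> by (simp add: r_def)
  have "\<omega>\<^sup>2 = cis \<theta>" unfolding \<omega>_def by (simp add: power2_eq_square cis_mult)
  then have r2: "r\<^sup>2 = t" using t(2) by (simp add: r_def power_mult_distrib flip: of_real_power)
  have "poly (dilated R (cis (- \<theta> / 2) * z) (of_real (sqrt (cmod t)))) x = poly (dilated P z r) x" for x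
  proof -
    have "\<omega> * (cis (- \<theta> / 2) * z + \<i> * of_real (sqrt (cmod t)) * x) = (cis (- \<theta> / 2) * \<omega>) * z + \<i> * r * x"
      by (simp add: r_def algebra_simps)
    also have "\<dots> = z + \<i> * r * x" by (simp only: \<omega>(2) mult_1)
    finally have e: "\<omega> * (cis (- \<theta> / 2) * z + \<i> * of_real (sqrt (cmod t)) * x) = z + \<i> * r * x" .
    have "poly [:0, \<omega>:] y = \<omega> * y" for y by simp
    then show ?thesis by (simp only: R_def poly_dilated poly_pcompose e)
  qed
  then have eq: "dilated R (cis (- \<theta> / 2) * z) (of_real (sqrt (cmod t))) = dilated P z r"
    by (simp add: poly_eq_poly_eq_iff[symmetric] fun_eq_iff)
  have "degree R > 0" "cmod t > 0" using degR \<alpha> t by auto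
  then have gen: "generic_saddles (dilated P z r) (real (degree P))"
    using generic_saddle_conditions[OF _ _ g[folded \<omega>_def, folded R_def]] unfolding eq degR by blast
  show ?thesis
    by (rule eventually_nonvanishing_evolved_power[OF P \<alpha> r0 r2 gen]) (rule that)
qed

section \<open>Limits of logarithmic potentials\<close>

text \<open>The pointwise limit is given on all of \<open>S\<close>, so every limit extracted by
  Montel's theorem must be \<open>g\<close>. Derivatives converge along a further subsequence of any
  subsequence, hence along the full sequence.\<close>

lemma vitali:
  fixes f :: "nat \<Rightarrow> complex \<Rightarrow> complex"
  assumes S: "open S" and hol: "\<And>n. f n holomorphic_on S"
    and bd: "\<And>n z. z \<in> S \<Longrightarrow> cmod (f n z) \<le> B"
    and lim: "\<And>z. z \<in> S \<Longrightarrow> (\<lambda>n. f n z) \<longlonglongrightarrow> g z"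
  shows "g holomorphic_on S" "\<And>z. z \<in> S \<Longrightarrow> (\<lambda>n. deriv (f n) z) \<longlonglongrightarrow> deriv g z"
proof -
  have sub: "g holomorphic_on S \<and> (\<exists>q. strict_mono (q :: nat \<Rightarrow> nat) \<and> (\<forall>z\<in>S. (\<lambda>n. deriv (f (r (q n))) z) \<longlonglongrightarrow> deriv g z))"
    if r: "strict_mono r" for r :: "nat \<Rightarrow> nat"
  proof -
    obtain h q where h: "h holomorphic_on S" "strict_mono (q :: nat \<Rightarrow> nat)"
      "\<And>x. x \<in> S \<Longrightarrow> ((\<lambda>n. f (r (q n)) x) \<longlongrightarrow> h x) sequentially"
      "\<And>K. \<lbrakk>compact K; K \<subseteq> S\<rbrakk> \<Longrightarrow> uniform_limit K ((\<lambda>n. f (r n)) \<circ> q) h sequentially"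
    proof (rule Montel[of S "range f" "\<lambda>n. f (r n)"])
      show "\<exists>B. \<forall>h\<in>range f. \<forall>z\<in>K. cmod (h z) \<le> B" if "compact K" "K \<subseteq> S" for K
        using bd that by blast
    qed (use S hol that in auto)
    have hg: "h x = g x" if "x \<in> S" for x
    proof -
      have "(\<lambda>n. f (r (q n)) x) \<longlonglongrightarrow> g x"
        using LIMSEQ_subseq_LIMSEQ[OF lim[OF that] strict_mono_o[OF r h(2)]] by (simp add: o_def)
      then show ?thesis using h(3)[OF that] LIMSEQ_unique by blast
    qed
    have "g holomorphic_on S" using h(1) hg holomorphic_transform by blast
    moreover have "(\<lambda>n. deriv (f (r (q n))) z) \<longlonglongrightarrow> deriv g z" if z: "z \<in> S" for z
    proof -
      obtain d where d: "d > 0" "cball z d \<subseteq> S" using S z open_contains_cball by blast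
      have "uniform_limit (ball z d) ((\<lambda>n. f (r n)) \<circ> q) h sequentially"
        using uniform_limit_on_subset[OF h(4)[OF compact_cball d(2)] ball_subset_cball] .
      then have "(\<lambda>n. (deriv ^^ 1) (((\<lambda>n. f (r n)) \<circ> q) n) z) \<longlonglongrightarrow> (deriv ^^ 1) h z"
      proof (rule higher_deriv_complex_uniform_limit)
        have "ball z d \<subseteq> S" using d(2) ball_subset_cball[of z d] by blast
        then show "\<forall>\<^sub>F n in sequentially. ((\<lambda>n. f (r n)) \<circ> q) n holomorphic_on ball z d"
          by (intro always_eventually allI) (auto intro: holomorphic_on_subset[OF hol])
      qed (use d in auto)
      moreover have "deriv h z = deriv g z"
        by (rule complex_derivative_transform_within_open[OF h(1) \<open>g holomorphic_on S\<close> S z hg])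
      ultimately show ?thesis by (simp add: o_def)
    qed
    ultimately show ?thesis using h(2) by blast
  qed
  show "g holomorphic_on S" using sub[of id] by (simp add: strict_mono_def)
  fix z assume z: "z \<in> S"
  show "(\<lambda>n. deriv (f n) z) \<longlonglongrightarrow> deriv g z"
  proof (rule ccontr)
    assume "\<not> ?thesis"
    then obtain e where e: "e > 0" "\<forall>N. \<exists>n\<ge>N. dist (deriv (f n) z) (deriv g z) \<ge> e"
      unfolding LIMSEQ_def by (metis not_less)
    then have inf: "infinite {n. dist (deriv (f n) z) (deriv g z) \<ge> e}"
      unfolding infinite_nat_iff_unbounded_le by auto
    then obtain r where r: "strict_mono (r :: nat \<Rightarrow> nat)" "\<And>n. dist (deriv (f (r n)) z) (deriv g z) \<ge> e"
      using infinite_enumerate[OF inf] by auto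
    obtain q where "(\<lambda>n. deriv (f (r (q n))) z) \<longlonglongrightarrow> deriv g z" using sub[OF r(1)] z by blast
    then obtain n where "dist (deriv (f (r (q n))) z) (deriv g z) < e"
      using e(1) unfolding LIMSEQ_def by blast
    then show False using r(2)[of "q n"] by simp
  qed
qed

text \<open>The variable may be \<open>z\<close> or \<open>t\<close>. A holomorphic primitive of
  \<open>g\<close> with real part \<open>U\<close> provides the differentiability of
  \<open>U\<close> together with its gradient.\<close>

lemma log_modulus_limit:
  fixes q :: "nat \<Rightarrow> complex \<Rightarrow> complex" and U :: "complex \<Rightarrow> real" and \<nu> :: "nat \<Rightarrow> real"
  assumes \<rho>: "\<rho> > 0" and \<nu>: "\<And>n. \<nu> n > 0" and hol: "\<And>n. q n holomorphic_on ball c \<rho>"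
    and nz: "\<And>n z. z \<in> ball c \<rho> \<Longrightarrow> q n z \<noteq> 0"
    and bd: "\<And>n z. z \<in> ball c \<rho> \<Longrightarrow> cmod (deriv (q n) z / (\<nu> n * q n z)) \<le> B"
    and lim: "\<And>z. z \<in> ball c \<rho> \<Longrightarrow> (\<lambda>n. deriv (q n) z / (\<nu> n * q n z)) \<longlonglongrightarrow> g z"
    and limU: "\<And>z. z \<in> ball c \<rho> \<Longrightarrow> (\<lambda>n. ln (cmod (q n z)) / \<nu> n) \<longlonglongrightarrow> U z"
  obtains H where "\<And>z. z \<in> ball c \<rho> \<Longrightarrow> (H has_field_derivative g z) (at z)" "\<And>z. z \<in> ball c \<rho> \<Longrightarrow> U z = Re (H z)"
proof -
  have cb: "c \<in> ball c \<rho>" using \<rho> by simp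
  have "\<exists>G. G holomorphic_on ball c \<rho> \<and> (\<forall>z\<in>ball c \<rho>. q n z = exp (G z) \<and> deriv (q n) z = q n z * deriv G z)" for n
    using holomorphic_log_on_ball[OF hol nz] by metis
  then obtain G where G: "\<And>n. G n holomorphic_on ball c \<rho>" "\<And>n z. z \<in> ball c \<rho> \<Longrightarrow> q n z = exp (G n z)"
    "\<And>n z. z \<in> ball c \<rho> \<Longrightarrow> deriv (q n) z = q n z * deriv (G n) z"
    by metis
  \<comment> \<open>The imaginary parts of the logarithms could run off with \<open>n\<close>. Made
    real at the centre, the functions are bounded there by \<open>limU\<close>, and then on the ball
    by the bound on their derivatives, so Montel's theorem applies.\<close>
  define k where "k = (\<lambda>n z. (G n z - \<i> * of_real (Im (G n c))) / of_real (\<nu> n))"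
  have khol: "k n holomorphic_on ball c \<rho>" for n
    unfolding k_def using G(1) \<nu>[of n] by (intro holomorphic_intros) auto
  have Gd: "(G n has_field_derivative deriv G' z) (at z)" if "z \<in> ball c \<rho>" "G' = G n" for n z G'
    using holomorphic_derivI[OF G(1) open_ball that(1)] that(2) by simp
  have dk: "(k n has_field_derivative deriv (q n) z / (\<nu> n * q n z)) (at z)" if z: "z \<in> ball c \<rho>" for n z
  proof -
    have 1: "deriv (q n) z / (\<nu> n * q n z) = deriv (G n) z / \<nu> n" using nz[OF z] G(3)[OF z] by simp
    show ?thesis unfolding 1 k_def by (rule derivative_eq_intros Gd[OF z refl] refl | use \<nu>[of n] in simp)+
  qed
  have Rek: "Re (k n z) = ln (cmod (q n z)) / \<nu> n" if "z \<in> ball c \<rho>" for n z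
    using G(2)[OF that] by (simp add: k_def)
  have kc: "k n c = of_real (ln (cmod (q n c)) / \<nu> n)" for n
  proof -
    have "ln (cmod (q n c)) = Re (G n c)" using G(2)[OF cb] by simp
    moreover have "G n c - \<i> * of_real (Im (G n c)) = of_real (Re (G n c))" by (simp add: complex_eq_iff)
    ultimately show ?thesis by (simp only: k_def of_real_divide)
  qed
  obtain B0 where B0: "\<And>n. cmod (k n c) \<le> B0"
  proof -
    have "(\<lambda>n. k n c) \<longlonglongrightarrow> of_real (U c)" unfolding kc by (intro tendsto_of_real limU cb)
    then have "Bseq (\<lambda>n. k n c)" by (rule convergent_imp_Bseq[OF convergentI])
    then obtain K where "\<And>n. cmod (k n c) \<le> K" unfolding Bseq_def by blast
    then show ?thesis by (rule that)
  qed
  have kb: "cmod (k n z) \<le> B0 + B * \<rho>" if z: "z \<in> ball c \<rho>" for n z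
  proof -
    have Bn: "B \<ge> 0" using bd[OF cb] norm_ge_zero order_trans by blast
    have "cmod (k n z - k n c) \<le> B * cmod (z - c)"
      by (rule field_differentiable_bound[of "ball c \<rho>"]) (use dk bd z cb in \<open>auto intro: has_field_derivative_at_within\<close>)
    also have "\<dots> \<le> B * \<rho>" using z Bn by (intro mult_left_mono) (auto simp: dist_norm norm_minus_commute)
    finally show ?thesis using B0[of n] norm_triangle_ineq2[of "k n z" "k n c"] by linarith
  qed
  obtain H r where H: "H holomorphic_on ball c \<rho>" "strict_mono (r :: nat \<Rightarrow> nat)"
      "\<And>x. x \<in> ball c \<rho> \<Longrightarrow> ((\<lambda>n. k (r n) x) \<longlongrightarrow> H x) sequentially"
      "\<And>K. \<lbrakk>compact K; K \<subseteq> ball c \<rho>\<rbrakk> \<Longrightarrow> uniform_limit K (k \<circ> r) H sequentially"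
  proof (rule Montel[of "ball c \<rho>" "range k" k])
    show "\<exists>B. \<forall>h\<in>range k. \<forall>z\<in>K. cmod (h z) \<le> B" if "compact K" "K \<subseteq> ball c \<rho>" for K
      using kb that by blast
  qed (use khol that in auto)
  have dH: "(\<lambda>n. deriv (k (r n)) z) \<longlonglongrightarrow> deriv H z" if "z \<in> ball c \<rho>" for z
    by (rule vitali(2)[of "ball c \<rho>" "\<lambda>n. k (r n)"]) (use khol kb H(3) that in auto)
  show ?thesis
  proof
    fix z assume z: "z \<in> ball c \<rho>"
    have "(\<lambda>n. deriv (q (r n)) z / (\<nu> (r n) * q (r n) z)) \<longlonglongrightarrow> deriv H z"
      using dH[OF z] DERIV_imp_deriv[OF dk[OF z]] by simp
    moreover have "(\<lambda>n. deriv (q (r n)) z / (\<nu> (r n) * q (r n) z)) \<longlonglongrightarrow> g z"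
      using LIMSEQ_subseq_LIMSEQ[OF lim[OF z] H(2)] by (simp add: o_def)
    ultimately have "deriv H z = g z" by (rule LIMSEQ_unique)
    then show "(H has_field_derivative g z) (at z)" using holomorphic_derivI[OF H(1) open_ball z] by simp
    have "(\<lambda>n. Re (k (r n) z)) \<longlonglongrightarrow> Re (H z)" by (intro tendsto_Re H z)
    moreover have "(\<lambda>n. Re (k (r n) z)) \<longlonglongrightarrow> U z"
      unfolding Rek[OF z] using LIMSEQ_subseq_LIMSEQ[OF limU[OF z] H(2)] by (simp add: o_def)
    ultimately show "U z = Re (H z)" using LIMSEQ_unique by blast
  qed
qed

lemma evolved_power_monic:
  assumes "lead_coeff P = 1"
  shows "lead_coeff (evolved_power P n t) = 1" "degree (evolved_power P n t) = degree P * n" "evolved_power P n t \<noteq> 0"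
proof -
  have P0: "P \<noteq> 0" using assms by auto
  have "lead_coeff (P ^ n) = 1" using assms by (simp add: lead_coeff_power)
  then show 1: "lead_coeff (evolved_power P n t) = 1" and "degree (evolved_power P n t) = degree P * n"
    unfolding evolved_power_def using heat_flow_monic[of "P ^ n"] assms
    by (auto simp: degree_power_eq[OF P0] mult.commute)
  show "evolved_power P n t \<noteq> 0" using 1 by auto
qed

text \<open>The flow parameter carries the factor \<open>1 / (2 * degree P * n)\<close> and the
  degree is \<open>degree P * n\<close>; their product leaves \<open>4 * cmod t\<close> under the
  root, so the bound does not depend on \<open>n\<close>.\<close>

lemma evolved_power_zero_bound:
  assumes P: "lead_coeff P = 1" "degree P > 0" and roots: "\<And>\<xi>. poly P \<xi> = 0 \<Longrightarrow> cmod \<xi> \<le> \<rho>"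
    and n: "n \<ge> 1" and z: "poly (evolved_power P n t) z = 0"
  shows "cmod z \<le> \<rho> + 2 * sqrt (cmod t)"
proof (rule ccontr)
  assume *: "\<not> ?thesis"
  have P0: "P \<noteq> 0" using P by auto
  have c: "8 * cmod (- t / (2 * of_nat (total_mult P) * of_nat n)) * real (degree (P ^ n)) = 4 * cmod t"
    using P n by (simp add: total_mult_eq_degree[OF P0] degree_power_eq[OF P0] norm_divide norm_mult field_simps)
  have "poly (evolved_power P n t) z \<noteq> 0" unfolding evolved_power_def
  proof (rule heat_flow_zero_bound[where \<rho> = \<rho>])
    show "\<rho> + sqrt (8 * cmod (- t / (2 * of_nat (total_mult P) * of_nat n)) * real (degree (P ^ n))) < cmod z"
      unfolding c using * by (simp add: real_sqrt_mult)
    show "cmod \<xi> \<le> \<rho>" if "poly (P ^ n) \<xi> = 0" for \<xi>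
      using that roots by (simp add: poly_power)
  qed (use P in \<open>simp add: lead_coeff_power\<close>)
  then show False using z by simp
qed

text \<open>The flow commutes with differentiation, so every derivative in \<open>z\<close> solves
  the same heat equation in \<open>s\<close>.\<close>

lemma evolved_power_heat_equation:
  assumes P: "lead_coeff P = 1" "degree P > 0" and n: "n \<ge> 1"
  shows "((\<lambda>s. poly ((pderiv ^^ j) (evolved_power P n s)) z) has_field_derivative
     - poly ((pderiv ^^ (j + 2)) (evolved_power P n s)) z / (2 * of_nat (degree P * n))) (at s)"
proof -
  have P0: "P \<noteq> 0" using P by auto
  define b where "b = (\<lambda>s::complex. - s / (2 * of_nat (total_mult P) * of_nat n))"
  have hd: "(pderiv ^^ m) (heat_flow c p) = heat_flow c ((pderiv ^^ m) p)" for m c p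
    by (induction m) (auto simp: pderiv_heat_flow)
  have eq: "(pderiv ^^ m) (evolved_power P n s) = heat_flow (b s) ((pderiv ^^ m) (P ^ n))" for m s
    by (simp add: evolved_power_def b_def hd)
  have b': "(b has_field_derivative (- 1 / (2 * of_nat (degree P * n)))) (at s)"
    unfolding b_def total_mult_eq_degree[OF P0]
    by (rule derivative_eq_intros refl | use P n in simp)+
  have "((\<lambda>s. poly (heat_flow (b s) ((pderiv ^^ j) (P ^ n))) z) has_field_derivative
      poly (heat_flow (b s) (pderiv (pderiv ((pderiv ^^ j) (P ^ n))))) z * (- 1 / (2 * of_nat (degree P * n)))) (at s)"
    by (rule DERIV_chain2[where g = b and x = s, OF has_field_derivative_heat_flow_parameter b'])
  then show ?thesis unfolding eq by simp
qed

lemma finite_zeros_evolved_power: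
  "lead_coeff P = 1 \<Longrightarrow> finite {w. poly (evolved_power P n t) w = 0}"
  using evolved_power_monic(3) poly_roots_finite by blast

lemma integral_zero_measure:
  fixes f :: "complex \<Rightarrow> real"
  assumes P: "lead_coeff P = 1" and f: "continuous_on UNIV f"
  shows "(\<integral>w. f w \<partial>zero_measure P n t) =
    (\<Sum>w | poly (evolved_power P n t) w = 0. real (order w (evolved_power P n t)) * f w) / (real (degree P) * real n)"
proof -
  have P0: "P \<noteq> 0" using P by auto
  define S where "S = {w. poly (evolved_power P n t) w = 0}"
  have fin: "finite S" unfolding S_def using P by (rule finite_zeros_evolved_power)
  have fm: "f \<in> borel_measurable borel" using f by (rule borel_measurable_continuous_onI)
  have "(\<integral>w. f w \<partial>zero_measure P n t) = (\<integral>w. f w \<partial>point_measure S (\<lambda>w. ennreal (real (order w (evolved_power P n t)) / (real (total_mult P) * real n))))"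
    unfolding zero_measure_def S_def[symmetric] using fm
    by (subst integral_distr) (auto simp: measurable_def space_point_measure sets_point_measure)
  also have "\<dots> = (\<Sum>w\<in>S. real (order w (evolved_power P n t)) / (real (total_mult P) * real n) * f w)"
    using fin by (subst lebesgue_integral_point_measure_finite) auto
  also have "\<dots> = (\<Sum>w\<in>S. real (order w (evolved_power P n t)) * f w) / (real (degree P) * real n)"
    by (simp add: total_mult_eq_degree[OF P0] sum_divide_distrib)
  finally show ?thesis by (simp add: S_def)
qed

lemma ln_norm_monic_poly:
  fixes q :: "complex poly"
  assumes "lead_coeff q = 1" "poly q z \<noteq> 0"
  shows "ln (cmod (poly q z)) = (\<Sum>w | poly q w = 0. real (order w q) * ln (cmod (z - w)))"
proof -
  define S where "S = {w. poly q w = 0}"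
  have q0: "q \<noteq> 0" using assms by auto
  have fin: "finite S" unfolding S_def using q0 by (rule poly_roots_finite)
  have ne: "z - w \<noteq> 0" if "w \<in> S" for w using that assms(2) by (auto simp: S_def)
  have "poly q z = (\<Prod>w\<in>S. (z - w) ^ order w q)"
    by (subst complex_poly_decompose[of q, symmetric]) (simp add: assms(1) S_def poly_prod poly_power)
  then have "ln (cmod (poly q z)) = ln (\<Prod>w\<in>S. cmod (z - w) ^ order w q)"
    by (simp add: norm_power flip: prod_norm)
  also have "\<dots> = (\<Sum>w\<in>S. ln (cmod (z - w) ^ order w q))" using fin ne by (intro ln_prod) auto
  also have "\<dots> = (\<Sum>w\<in>S. real (order w q) * ln (cmod (z - w)))" by (intro sum.cong refl ln_realpow)
  finally show ?thesis by (simp add: S_def)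
qed

lemma logarithmic_derivative_poly:
  fixes q :: "complex poly"
  assumes "poly q z \<noteq> 0"
  shows "poly (pderiv q) z / poly q z = (\<Sum>w | poly q w = 0. of_nat (order w q) / (z - w))"
proof -
  define S where "S = {w. poly q w = 0}"
  have q0: "q \<noteq> 0" using assms by auto
  have fin: "finite S" unfolding S_def using q0 by (rule poly_roots_finite)
  have ne: "z - w \<noteq> 0" if "w \<in> S" for w using that assms by (auto simp: S_def)
  have D: "(\<Prod>w\<in>S. z - w) \<noteq> 0" using fin ne by simp
  have "(\<Sum>w\<in>S. of_nat (order w q) * (\<Prod>v\<in>S - {w}. z - v)) * poly q z = (\<Prod>w\<in>S. z - w) * poly (pderiv q) z"
    using arg_cong[OF logarithmic_derivative_numerator[OF q0], of "\<lambda>p. poly p z"]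
    by (simp add: S_def poly_sum poly_prod)
  then have "poly (pderiv q) z / poly q z = (\<Sum>w\<in>S. of_nat (order w q) * (\<Prod>v\<in>S - {w}. z - v)) / (\<Prod>w\<in>S. z - w)"
    using assms D by (simp add: field_simps)
  also have "\<dots> = (\<Sum>w\<in>S. of_nat (order w q) / (z - w))"
    unfolding sum_divide_distrib
  proof (intro sum.cong refl)
    fix w assume w: "w \<in> S"
    have "(\<Prod>w\<in>S. z - w) = (z - w) * (\<Prod>v\<in>S - {w}. z - v)" using fin w by (rule prod.remove)
    then show "of_nat (order w q) * (\<Prod>v\<in>S - {w}. z - v) / (\<Prod>w\<in>S. z - w) = of_nat (order w q) / (z - w)"
      using D by auto
  qed
  finally show ?thesis by (simp add: S_def)
qed

text \<open>
  The test functions are \<open>ln (cmod (z - \<xi>))\<close> and \<open>1 / (z - \<xi>)\<close>, modified outside the annulus that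
  contains all zeros.
\<close>

lemma weak_limit_potential:
  assumes P: "lead_coeff P = 1" "degree P > 0"
    and M: "sets M = sets borel" "prob_space M" and weak: "weakly_converges (\<lambda>n. zero_measure P n t) M"
    and r: "r > 0" and zeros: "\<And>n \<xi>. n \<ge> N0 \<Longrightarrow> poly (evolved_power P n t) \<xi> = 0 \<Longrightarrow> r \<le> cmod (z - \<xi>) \<and> cmod (z - \<xi>) \<le> R"
  defines "\<nu> \<equiv> \<lambda>n. real (degree P) * real n" and "E \<equiv> \<lambda>n. evolved_power P n t"
  shows "integrable M (\<lambda>\<xi>. ln (cmod (z - \<xi>)))" "integrable M (\<lambda>\<xi>. 1 / (z - \<xi>))"
    "(\<lambda>n. ln (cmod (poly (E n) z)) / \<nu> n) \<longlonglongrightarrow> log_potential M z"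
    "(\<lambda>n. poly (pderiv (E n)) z / (of_real (\<nu> n) * poly (E n) z)) \<longlonglongrightarrow> stieltjes M z"
proof -
  interpret prob_space M by fact
  have cont_meas: "f \<in> borel_measurable M" if "continuous_on UNIV f" for f :: "complex \<Rightarrow> real"
    using borel_measurable_continuous_onI[OF that] M(1) measurable_cong_sets by blast
  have conv: "(\<lambda>n. (\<Sum>w | poly (E n) w = 0. real (order w (E n)) * f w) / \<nu> n) \<longlonglongrightarrow> (\<integral>w. f w \<partial>M)"
    if "continuous_on UNIV f" "\<And>x. \<bar>f x\<bar> \<le> b" for f b
  proof -
    have "bounded (range f)" using that(2) unfolding bounded_iff by auto
    then have "(\<lambda>n. \<integral>w. f w \<partial>zero_measure P n t) \<longlonglongrightarrow> (\<integral>w. f w \<partial>M)"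
      using weak that(1) unfolding weakly_converges_def by blast
    then show ?thesis unfolding integral_zero_measure[OF P(1) that(1)] E_def \<nu>_def .
  qed
  have int: "integrable M f" if "continuous_on UNIV f" "\<And>x. \<bar>f x\<bar> \<le> b" for f and b :: real
    using cont_meas[OF that(1)] that(2) by (intro integrable_const_bound[of _ b]) auto
  have nz: "poly (E n) z \<noteq> 0" if "n \<ge> N0" for n using zeros[OF that, of z] r by (auto simp: E_def)
  \<comment> \<open>One test function locates the limit measure: it vanishes exactly on the annulus,
    hence at all zeros of large index, and the cap at 1 makes it bounded.\<close>
  have AE: "AE \<xi> in M. r \<le> cmod (z - \<xi>) \<and> cmod (z - \<xi>) \<le> R"
  proof -
    define f where "f = (\<lambda>\<xi>. min 1 (max 0 (r - cmod (z - \<xi>)) + max 0 (cmod (z - \<xi>) - R)))"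
    have cf: "continuous_on UNIV f" unfolding f_def by (intro continuous_intros)
    have f0: "0 \<le> f x" "f x \<le> 1" for x by (auto simp: f_def)
    then have fb: "\<bar>f x\<bar> \<le> 1" for x by (simp add: abs_le_iff)
    have "\<forall>\<^sub>F n in sequentially. (\<Sum>w | poly (E n) w = 0. real (order w (E n)) * f w) / \<nu> n = 0"
      using eventually_ge_at_top[of N0]
    proof eventually_elim
      case (elim n)
      have "f w = 0" if "poly (E n) w = 0" for w
        using zeros[OF elim, of w] that unfolding E_def f_def by (simp add: max_def min_def)
      then show ?case by simp
    qed
    then have "(\<lambda>n. (\<Sum>w | poly (E n) w = 0. real (order w (E n)) * f w) / \<nu> n) \<longlonglongrightarrow> 0"
      by (rule tendsto_eventually)
    then have "(\<integral>w. f w \<partial>M) = 0" using conv[OF cf fb] LIMSEQ_unique by blast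
    then have "AE \<xi> in M. f \<xi> = 0"
      using integral_nonneg_eq_0_iff_AE[OF int[OF cf fb]] f0 by auto
    then show ?thesis by eventually_elim (auto simp: f_def max_def min_def split: if_splits)
  qed
  have R: "r \<le> R"
  proof -
    have "AE \<xi> in M. r \<le> R" using AE by eventually_elim auto
    then show ?thesis using AE_const by simp
  qed
  define F where "F = (\<lambda>\<xi>. ln (max r (min R (cmod (z - \<xi>)))))"
  have cF: "continuous_on UNIV F" unfolding F_def using r
    by (intro continuous_intros) (auto simp: max_def)
  have Fb: "\<bar>F x\<bar> \<le> max \<bar>ln r\<bar> \<bar>ln R\<bar>" for x
  proof -
    have "ln r \<le> F x" "F x \<le> ln R" unfolding F_def using r R by (auto simp: max_def min_def)
    then show ?thesis by linarith
  qed
  have Feq: "F \<xi> = ln (cmod (z - \<xi>))" if "r \<le> cmod (z - \<xi>) \<and> cmod (z - \<xi>) \<le> R" for \<xi>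
    using that by (simp add: F_def)
  have meas1: "(\<lambda>\<xi>. ln (cmod (z - \<xi>))) \<in> borel_measurable M"
  proof -
    have "(\<lambda>\<xi>. ln (cmod (z - \<xi>))) \<in> borel_measurable borel" by measurable
    then show ?thesis using M(1) measurable_cong_sets by blast
  qed
  have AEF: "AE \<xi> in M. F \<xi> = ln (cmod (z - \<xi>))" using AE by eventually_elim (rule Feq)
  show "integrable M (\<lambda>\<xi>. ln (cmod (z - \<xi>)))"
    using integrable_cong_AE[OF cont_meas[OF cF] meas1 AEF] int[OF cF Fb] by simp
  have lp: "log_potential M z = (\<integral>w. F w \<partial>M)" unfolding log_potential_def
    using integral_cong_AE[OF cont_meas[OF cF] meas1 AEF] by simp
  have "\<forall>\<^sub>F n in sequentially. (\<Sum>w | poly (E n) w = 0. real (order w (E n)) * F w) / \<nu> n = ln (cmod (poly (E n) z)) / \<nu> n"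
    using eventually_ge_at_top[of N0]
  proof eventually_elim
    case (elim n)
    have "lead_coeff (E n) = 1" unfolding E_def using P(1) by (rule evolved_power_monic)
    then show ?case unfolding ln_norm_monic_poly[OF \<open>lead_coeff (E n) = 1\<close> nz[OF elim]]
      using Feq zeros[OF elim] by (auto simp: E_def intro!: arg_cong2[of _ _ _ _ "(/)"] sum.cong)
  qed
  then show "(\<lambda>n. ln (cmod (poly (E n) z)) / \<nu> n) \<longlonglongrightarrow> log_potential M z"
    unfolding lp by (rule Lim_transform_eventually[OF conv[OF cF Fb]])
  \<comment> \<open>\<open>1 / (z - \<xi>)\<close> is the conjugate over the squared modulus;
    keeping the modulus at least \<open>r\<close> makes this continuous and bounded.\<close>
  define K where "K = (\<lambda>\<xi>. cnj (z - \<xi>) / of_real ((max r (cmod (z - \<xi>)))\<^sup>2))"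
  have cK: "continuous_on UNIV K" unfolding K_def using r
    by (intro continuous_intros) (auto simp: max_def)
  have Kb: "cmod (K \<xi>) \<le> 1 / r" for \<xi>
  proof -
    define a where "a = max r (cmod (z - \<xi>))"
    have a: "a > 0" "r \<le> a" "cmod (z - \<xi>) \<le> a" using r by (auto simp: a_def)
    have "cmod (K \<xi>) = cmod (z - \<xi>) / a\<^sup>2" by (simp add: K_def norm_divide norm_power a_def del: complex_cnj_diff)
    also have "\<dots> \<le> a / a\<^sup>2" using a by (intro divide_right_mono) auto
    also have "\<dots> = 1 / a" using a by (simp add: power2_eq_square)
    also have "\<dots> \<le> 1 / r" using a r by (simp add: frac_le)
    finally show ?thesis .
  qed
  have Keq: "K \<xi> = 1 / (z - \<xi>)" if "r \<le> cmod (z - \<xi>) \<and> cmod (z - \<xi>) \<le> R" for \<xi>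
  proof -
    have "z - \<xi> \<noteq> 0" using that r by auto
    moreover have "of_real ((cmod (z - \<xi>))\<^sup>2) = (z - \<xi>) * cnj (z - \<xi>)" by (rule complex_norm_square)
    ultimately show ?thesis using that unfolding K_def by (simp add: max_absorb2 field_simps del: of_real_power)
  qed
  \<comment> \<open>\<open>weakly_converges\<close> tests with real functions only, so the two
    components are treated separately.\<close>
  have cRI: "continuous_on UNIV (\<lambda>\<xi>. Re (K \<xi>))" "continuous_on UNIV (\<lambda>\<xi>. Im (K \<xi>))"
    using cK by (auto intro: continuous_intros)
  have bRI: "\<bar>Re (K \<xi>)\<bar> \<le> 1 / r" "\<bar>Im (K \<xi>)\<bar> \<le> 1 / r" for \<xi>
    using Kb[of \<xi>] abs_Re_le_cmod[of "K \<xi>"] abs_Im_le_cmod[of "K \<xi>"] by linarith+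
  have mK: "K \<in> borel_measurable M"
    using borel_measurable_continuous_onI[OF cK] M(1) measurable_cong_sets by blast
  have mS: "(\<lambda>\<xi>. 1 / (z - \<xi>)) \<in> borel_measurable M"
  proof -
    have "(\<lambda>\<xi>. 1 / (z - \<xi>)) \<in> borel_measurable borel" by measurable
    then show ?thesis using M(1) measurable_cong_sets by blast
  qed
  have AEK: "AE \<xi> in M. K \<xi> = 1 / (z - \<xi>)" using AE by eventually_elim (rule Keq)
  have intK: "integrable M K" using mK Kb by (intro integrable_const_bound[of _ "1 / r"]) auto
  then show "integrable M (\<lambda>\<xi>. 1 / (z - \<xi>))"
    using integrable_cong_AE[OF mK mS AEK] by simp
  have st: "stieltjes M z = (\<integral>w. K w \<partial>M)" unfolding stieltjes_def
    using integral_cong_AE[OF mK mS AEK] by simp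
  have eqK: "(\<integral>w. K w \<partial>M) = Complex (\<integral>w. Re (K w) \<partial>M) (\<integral>w. Im (K w) \<partial>M)"
    using intK by (simp add: complex_eq_iff)
  define A where "A = (\<lambda>n f. (\<Sum>w | poly (E n) w = 0. real (order w (E n)) * f w) / \<nu> n)"
  have "(\<lambda>n. Complex (A n (\<lambda>w. Re (K w))) (A n (\<lambda>w. Im (K w)))) \<longlonglongrightarrow> Complex (\<integral>w. Re (K w) \<partial>M) (\<integral>w. Im (K w) \<partial>M)"
    unfolding A_def by (intro tendsto_Complex conv[OF cRI(1) bRI(1)] conv[OF cRI(2) bRI(2)])
  then have lim: "(\<lambda>n. Complex (A n (\<lambda>w. Re (K w))) (A n (\<lambda>w. Im (K w)))) \<longlonglongrightarrow> stieltjes M z"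
    unfolding st eqK .
  have "\<forall>\<^sub>F n in sequentially. Complex (A n (\<lambda>w. Re (K w))) (A n (\<lambda>w. Im (K w))) = poly (pderiv (E n)) z / (of_real (\<nu> n) * poly (E n) z)"
    using eventually_ge_at_top[of N0]
  proof eventually_elim
    case (elim n)
    have "Complex (A n (\<lambda>w. Re (K w))) (A n (\<lambda>w. Im (K w))) = (\<Sum>w | poly (E n) w = 0. of_nat (order w (E n)) * K w) / of_real (\<nu> n)"
      by (simp add: complex_eq_iff A_def)
    also have "\<dots> = (\<Sum>w | poly (E n) w = 0. of_nat (order w (E n)) / (z - w)) / of_real (\<nu> n)"
      using Keq zeros[OF elim] by (auto simp: E_def intro!: arg_cong2[of _ _ _ _ "(/)"] sum.cong)
    also have "\<dots> = poly (pderiv (E n)) z / (of_real (\<nu> n) * poly (E n) z)"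
      unfolding logarithmic_derivative_poly[OF nz[OF elim], symmetric] by simp
    finally show ?case .
  qed
  then show "(\<lambda>n. poly (pderiv (E n)) z / (of_real (\<nu> n) * poly (E n) z)) \<longlonglongrightarrow> stieltjes M z"
    by (rule Lim_transform_eventually[OF lim])
qed

section \<open>The differential equations\<close>

lemma partial_has_derivative:
  assumes "(f has_derivative f') (at z)"
  shows "partial_x f z = f' 1" "partial_y f z = f' \<i>"
proof -
  have lin: "linear f'" using assms by (rule has_derivative_linear)
  have dir: "vector_derivative (\<lambda>x::real. f (z + of_real x * v)) (at 0) = f' v" for v
  proof (rule vector_derivative_at)
    have "((\<lambda>x::real. z + of_real x * v) has_derivative (\<lambda>x. of_real x * v)) (at 0)"
      by (auto intro!: derivative_eq_intros)
    moreover have "(f has_derivative f') (at (z + of_real 0 * v))" using assms by simp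
    ultimately have "((\<lambda>x::real. f (z + of_real x * v)) has_derivative (\<lambda>x. f' (of_real x * v))) (at 0)"
      by (rule has_derivative_compose)
    moreover have "(\<lambda>x. f' (of_real x * v)) = (\<lambda>x. x *\<^sub>R f' v)"
      using linear_scale[OF lin] by (simp add: scaleR_conv_of_real[symmetric] fun_eq_iff)
    ultimately show "((\<lambda>x::real. f (z + of_real x * v)) has_vector_derivative f' v) (at 0)"
      by (simp add: has_vector_derivative_def)
  qed
  show "partial_x f z = f' 1" "partial_y f z = f' \<i>"
    using dir[of 1] dir[of \<i>] by (simp_all add: partial_x_def partial_y_def mult.commute)
qed

text \<open>The vanishing of the second and third derivative is what settles the equations with
  conjugates: there all three members are 0.\<close>

lemma wirtinger_holomorphic:
  assumes "(f has_field_derivative D) (at z)"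
  shows "wirtinger f z = D" "wirtinger_bar f z = 0" "wirtinger (\<lambda>w. cnj (f w)) z = 0"
proof -
  have d: "(f has_derivative (\<lambda>h. D * h)) (at z)" using assms by (simp add: has_field_derivative_def)
  then have d': "((\<lambda>w. cnj (f w)) has_derivative (\<lambda>h. cnj (D * h))) (at z)"
    by (rule has_derivative_cnj)
  show "wirtinger f z = D" "wirtinger_bar f z = 0"
    by (simp_all add: wirtinger_def wirtinger_bar_def partial_has_derivative[OF d] algebra_simps)
  show "wirtinger (\<lambda>w. cnj (f w)) z = 0"
    by (simp add: wirtinger_def partial_has_derivative[OF d'] algebra_simps)
qed

text \<open>\<open>Re H\<close> is half the sum of \<open>H\<close> and its conjugate, and the
  conjugate contributes nothing; hence the factor 1/2.\<close>

lemma wirtinger_Re_holomorphic: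
  assumes "open S" "z \<in> S" "(H has_field_derivative D) (at z)" "\<And>w. w \<in> S \<Longrightarrow> f w = of_real (Re (H w))"
  shows "f differentiable (at z)" "wirtinger f z = D / 2"
proof -
  have "(H has_derivative (\<lambda>h. D * h)) (at z)" using assms(3) by (simp add: has_field_derivative_def)
  then have "((\<lambda>w. of_real (Re (H w)) :: complex) has_derivative (\<lambda>h. of_real (Re (D * h)))) (at z)"
    by (intro derivative_intros has_derivative_Re)
  then have d: "(f has_derivative (\<lambda>h. of_real (Re (D * h)))) (at z)"
    by (rule has_derivative_transform_within_open[OF _ assms(1,2)]) (simp add: assms(4))
  then show "f differentiable (at z)" by (auto simp: differentiable_def)
  show "wirtinger f z = D / 2"
    by (simp add: wirtinger_def partial_has_derivative[OF d] complex_eq_iff)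
qed

lemma norm_logarithmic_derivative_le:
  fixes q :: "complex poly"
  assumes q: "poly q z \<noteq> 0" and r: "r > 0" and zeros: "\<And>w. poly q w = 0 \<Longrightarrow> r \<le> cmod (z - w)"
  shows "cmod (poly (pderiv q) z / poly q z) \<le> real (degree q) / r"
proof -
  have q0: "q \<noteq> 0" using q by auto
  have "cmod (poly (pderiv q) z / poly q z) \<le> (\<Sum>w | poly q w = 0. cmod (of_nat (order w q) / (z - w)))"
    unfolding logarithmic_derivative_poly[OF q] by (rule norm_sum)
  also have "\<dots> \<le> (\<Sum>w | poly q w = 0. real (order w q) / r)"
    using zeros r by (intro sum_mono) (auto simp: norm_divide intro!: divide_left_mono mult_pos_pos dest: less_le_trans)
  also have "\<dots> = real (degree q) / r"
    using total_mult_eq_degree[OF q0] by (simp add: total_mult_def flip: sum_divide_distrib of_nat_sum)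
  finally show ?thesis .
qed

lemma deriv_higher_poly:
  "((\<lambda>w. poly ((pderiv ^^ j) p) w) has_field_derivative poly ((pderiv ^^ Suc j) p) w) (at w)"
  using poly_DERIV[of "(pderiv ^^ j) p" w] by simp

text \<open>Everything is written in the derivatives \<open>A j\<close> because the heat equation
  expresses time derivatives by them too; the evolution equations then reduce to identities of
  rational expressions.\<close>

lemma logarithmic_derivative_derivs:
  fixes p :: "complex poly" and v :: real and f :: "complex \<Rightarrow> complex" and A :: "nat \<Rightarrow> complex \<Rightarrow> complex"
  assumes S: "open S" and nz: "\<And>w. w \<in> S \<Longrightarrow> poly p w \<noteq> 0" and v: "v > 0"
  defines "f \<equiv> \<lambda>w. poly (pderiv p) w / (v * poly p w)" and "A \<equiv> \<lambda>j w. poly ((pderiv ^^ j) p) w"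
  shows "f holomorphic_on S"
    and "\<And>w. w \<in> S \<Longrightarrow> deriv f w = (A 2 w * A 0 w - (A 1 w)\<^sup>2) / (v * (A 0 w)\<^sup>2)"
    and "\<And>w. w \<in> S \<Longrightarrow> deriv (deriv f) w = ((A 3 w * A 0 w - A 1 w * A 2 w) * A 0 w - 2 * A 1 w * (A 2 w * A 0 w - (A 1 w)\<^sup>2)) / (v * (A 0 w) ^ 3)"
proof -
  have A: "(A j has_field_derivative A (Suc j) w) (at w)" for j w
    unfolding A_def by (rule deriv_higher_poly)
  have f: "f = (\<lambda>w. A 1 w / (v * A 0 w))" by (simp add: f_def A_def)
  have nz': "A 0 w \<noteq> 0" if "w \<in> S" for w using nz[OF that] by (simp add: A_def)
  have A': "(A 0 has_field_derivative A 1 w) (at w)" "(A 1 has_field_derivative A 2 w) (at w)" "(A 2 has_field_derivative A 3 w) (at w)" for w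
    using A[of 0 w] A[of 1 w] A[of 2 w] by (simp_all add: numeral_2_eq_2 numeral_3_eq_3)
  have d1: "(f has_field_derivative (A 2 w * A 0 w - (A 1 w)\<^sup>2) / (v * (A 0 w)\<^sup>2)) (at w)" if w: "w \<in> S" for w
  proof -
    have "((\<lambda>w. A 1 w / (v * A 0 w)) has_field_derivative
        (A 2 w * (v * A 0 w) - A 1 w * (v * A 1 w)) / ((v * A 0 w) * (v * A 0 w))) (at w)"
      using nz'[OF w] v by (intro DERIV_divide DERIV_cmult A') auto
    also have "(A 2 w * (v * A 0 w) - A 1 w * (v * A 1 w)) / ((v * A 0 w) * (v * A 0 w)) =
        (A 2 w * A 0 w - (A 1 w)\<^sup>2) / (v * (A 0 w)\<^sup>2)"
      using nz'[OF w] v by (simp add: divide_simps power2_eq_square) (simp add: algebra_simps)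
    finally show ?thesis unfolding f .
  qed
  show "f holomorphic_on S" using d1 S by (auto simp: holomorphic_on_open)
  show d1': "deriv f w = (A 2 w * A 0 w - (A 1 w)\<^sup>2) / (v * (A 0 w)\<^sup>2)" if "w \<in> S" for w
    using d1[OF that] by (rule DERIV_imp_deriv)
  show "deriv (deriv f) w = ((A 3 w * A 0 w - A 1 w * A 2 w) * A 0 w - 2 * A 1 w * (A 2 w * A 0 w - (A 1 w)\<^sup>2)) / (v * (A 0 w) ^ 3)"
    if w: "w \<in> S" for w
  proof (rule DERIV_imp_deriv)
    have num: "((\<lambda>w. A 2 w * A 0 w - (A 1 w)\<^sup>2) has_field_derivative A 3 w * A 0 w - A 1 w * A 2 w) (at w)"
      by (rule derivative_eq_intros A' refl | simp add: algebra_simps)+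
    have den: "((\<lambda>w. v * (A 0 w)\<^sup>2) has_field_derivative v * (2 * A 0 w * A 1 w)) (at w)"
      by (rule derivative_eq_intros A' refl | simp add: algebra_simps)+
    have "((\<lambda>w. (A 2 w * A 0 w - (A 1 w)\<^sup>2) / (v * (A 0 w)\<^sup>2)) has_field_derivative
       ((A 3 w * A 0 w - A 1 w * A 2 w) * (v * (A 0 w)\<^sup>2) - (A 2 w * A 0 w - (A 1 w)\<^sup>2) * (v * (2 * A 0 w * A 1 w))) / ((v * (A 0 w)\<^sup>2) * (v * (A 0 w)\<^sup>2))) (at w)"
      using nz'[OF w] v by (intro DERIV_divide num den) auto
    also have "((A 3 w * A 0 w - A 1 w * A 2 w) * (v * (A 0 w)\<^sup>2) - (A 2 w * A 0 w - (A 1 w)\<^sup>2) * (v * (2 * A 0 w * A 1 w))) / ((v * (A 0 w)\<^sup>2) * (v * (A 0 w)\<^sup>2))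
      = ((A 3 w * A 0 w - A 1 w * A 2 w) * A 0 w - 2 * A 1 w * (A 2 w * A 0 w - (A 1 w)\<^sup>2)) / (v * (A 0 w) ^ 3)"
    proof -
      define a where "a = A 0 w"
      define x where "x = A 3 w * A 0 w - A 1 w * A 2 w"
      define y where "y = A 2 w * A 0 w - (A 1 w)\<^sup>2"
      have "a \<noteq> 0" using nz'[OF w] by (simp add: a_def)
      then show ?thesis unfolding x_def[symmetric] y_def[symmetric] a_def[symmetric]
        using v by (simp add: divide_simps power2_eq_square power3_eq_cube) (simp add: algebra_simps)
    qed
    finally show "(deriv f has_field_derivative ((A 3 w * A 0 w - A 1 w * A 2 w) * A 0 w - 2 * A 1 w * (A 2 w * A 0 w - (A 1 w)\<^sup>2)) / (v * (A 0 w) ^ 3)) (at w)"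
      by (rule has_field_derivative_transform_within_open[OF _ S w]) (simp add: d1')
  qed
qed

text \<open>\<open>H\<close> and \<open>K\<close> are complex potentials in \<open>z\<close> alone
  and in \<open>t\<close> alone. Their derivatives, \<open>m\<close> and
  \<open>- m\<^sup>2 / 2\<close>, encode the Hamilton-Jacobi equation before real parts are
  taken.\<close>

lemma local_structure_pde_domain:
  fixes \<mu> :: "complex \<Rightarrow> complex measure"
  assumes P: "lead_coeff P = 1" "degree P > 0"
    and borel: "\<And>t. sets (\<mu> t) = sets borel" and prob: "\<And>t. prob_space (\<mu> t)"
    and weak: "\<And>t. weakly_converges (\<lambda>n. zero_measure P n t) (\<mu> t)"
    and zt: "(z, t) \<in> pde_domain P"
  defines "m \<equiv> \<lambda>s w. stieltjes (\<mu> s) w"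
  obtains \<epsilon> H K where "\<epsilon> > 0"
    "\<And>w. w \<in> ball z \<epsilon> \<Longrightarrow> (H has_field_derivative m t w) (at w)" "\<And>w. w \<in> ball z \<epsilon> \<Longrightarrow> log_potential (\<mu> t) w = Re (H w)"
    "\<And>s. s \<in> ball t \<epsilon> \<Longrightarrow> (K has_field_derivative - (m s z)\<^sup>2 / 2) (at s)" "\<And>s. s \<in> ball t \<epsilon> \<Longrightarrow> log_potential (\<mu> s) z = Re (K s)"
    "(m t has_field_derivative deriv (m t) z) (at z)"
    "((\<lambda>s. m s z) has_field_derivative - (m t z * deriv (m t) z)) (at t)"
    "integrable (\<mu> t) (\<lambda>\<xi>. ln (cmod (z - \<xi>)))" "integrable (\<mu> t) (\<lambda>\<xi>. 1 / (z - \<xi>))"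
proof -
  obtain N \<epsilon>0 where \<epsilon>0: "\<epsilon>0 > 0" and nv: "\<And>w s n. dist w z < \<epsilon>0 \<Longrightarrow> dist s t < \<epsilon>0 \<Longrightarrow> n \<ge> N \<Longrightarrow> poly (evolved_power P n s) w \<noteq> 0"
    using pde_domain_nonvanishing[OF P zt] by metis
  have P0: "P \<noteq> 0" using P by auto
  have "bounded {\<xi>. poly P \<xi> = 0}" using poly_roots_finite[OF P0] by (rule finite_imp_bounded)
  then obtain \<rho> where \<rho>: "\<And>\<xi>. poly P \<xi> = 0 \<Longrightarrow> cmod \<xi> \<le> \<rho>" unfolding bounded_iff by auto
  \<comment> \<open>Shifting the index makes the exponent positive and the region zero-free from the
    first term on, without affecting limits.\<close>
  define N1 where "N1 = max N 1"
  define E where "E = (\<lambda>n s. evolved_power P (n + N1) s)"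
  define \<nu> where "\<nu> = (\<lambda>n. real (degree P) * real (n + N1))"
  have \<nu>: "\<nu> n > 0" for n using P by (simp add: \<nu>_def N1_def)
  have degE: "real (degree (E n s)) = \<nu> n" for n s by (simp add: E_def \<nu>_def evolved_power_monic[OF P(1)])
  \<comment> \<open>Halving the radius keeps every zero at distance at least
    \<open>\<epsilon>\<close> from each point of \<open>ball z \<epsilon>\<close>, which gives the
    uniform bound \<open>1 / \<epsilon>\<close> on the logarithmic derivatives.\<close>
  define \<epsilon> where "\<epsilon> = \<epsilon>0 / 2"
  have \<epsilon>: "\<epsilon> > 0" using \<epsilon>0 by (simp add: \<epsilon>_def)
  define R where "R = (cmod z + \<epsilon>) + (\<rho> + 2 * sqrt (cmod t + \<epsilon>))"
  have zeros: "\<epsilon> \<le> cmod (w - \<xi>) \<and> cmod (w - \<xi>) \<le> R"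
    if "w \<in> ball z \<epsilon>" "s \<in> ball t \<epsilon>" "n \<ge> N1" "poly (evolved_power P n s) \<xi> = 0" for w s n \<xi>
  proof
    have "dist s t < \<epsilon>0" using that(2) \<epsilon> by (simp add: \<epsilon>_def dist_commute)
    then have "dist \<xi> z \<ge> \<epsilon>0" using nv[of \<xi> s n] that by (force simp: N1_def)
    moreover have "dist \<xi> z \<le> dist \<xi> w + dist w z" by (rule dist_triangle)
    ultimately show "\<epsilon> \<le> cmod (w - \<xi>)" using that(1) by (simp add: \<epsilon>_def dist_norm norm_minus_commute)
    have "cmod \<xi> \<le> \<rho> + 2 * sqrt (cmod s)"
      using evolved_power_zero_bound[OF P \<rho> _ that(4)] that(3) by (simp add: N1_def)
    also have "\<dots> \<le> \<rho> + 2 * sqrt (cmod t + \<epsilon>)"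
      using that(2) norm_triangle_ineq2[of s t] by (simp add: dist_norm norm_minus_commute)
    finally have 1: "cmod \<xi> \<le> \<rho> + 2 * sqrt (cmod t + \<epsilon>)" .
    have "cmod w \<le> cmod z + \<epsilon>" using that(1) norm_triangle_ineq2[of w z] by (simp add: dist_norm norm_minus_commute)
    then show "cmod (w - \<xi>) \<le> R" using 1 norm_triangle_ineq4[of w \<xi>] by (simp add: R_def)
  qed
  have nz: "poly (E n s) w \<noteq> 0" if "w \<in> ball z \<epsilon>" "s \<in> ball t \<epsilon>" for n s w
    using zeros[OF that, of "n + N1" w] \<epsilon> by (auto simp: E_def)
  define M where "M = (\<lambda>n s w. poly (pderiv (E n s)) w / (\<nu> n * poly (E n s) w))"
  have zt': "z \<in> ball z \<epsilon>" "t \<in> ball t \<epsilon>" using \<epsilon> by auto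
  note wl = weak_limit_potential[OF P borel prob weak \<epsilon>]
  have limM: "(\<lambda>n. M n s w) \<longlonglongrightarrow> m s w" if "w \<in> ball z \<epsilon>" "s \<in> ball t \<epsilon>" for s w
  proof -
    have "(\<lambda>n. poly (pderiv (evolved_power P n s)) w / (complex_of_real (real (degree P) * real n) * poly (evolved_power P n s) w)) \<longlonglongrightarrow> stieltjes (\<mu> s) w"
      by (rule wl(4)[OF zeros[OF that]])
    from LIMSEQ_ignore_initial_segment[OF this, of N1] show ?thesis by (simp add: M_def E_def \<nu>_def m_def)
  qed
  have limL: "(\<lambda>n. ln (cmod (poly (E n s) w)) / \<nu> n) \<longlonglongrightarrow> log_potential (\<mu> s) w" if "w \<in> ball z \<epsilon>" "s \<in> ball t \<epsilon>" for s w
  proof -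
    have "(\<lambda>n. ln (cmod (poly (evolved_power P n s) w)) / (real (degree P) * real n)) \<longlonglongrightarrow> log_potential (\<mu> s) w"
      by (rule wl(3)[OF zeros[OF that]])
    from LIMSEQ_ignore_initial_segment[OF this, of N1] show ?thesis by (simp add: E_def \<nu>_def)
  qed
  have bdM: "cmod (M n s w) \<le> 1 / \<epsilon>" if "w \<in> ball z \<epsilon>" "s \<in> ball t \<epsilon>" for n s w
  proof -
    have "cmod (poly (pderiv (E n s)) w / poly (E n s) w) \<le> real (degree (E n s)) / \<epsilon>"
      using zeros[OF that, of "n + N1"] by (intro norm_logarithmic_derivative_le nz that \<epsilon>) (auto simp: E_def)
    then have "cmod (poly (pderiv (E n s)) w / poly (E n s) w) / \<nu> n \<le> (\<nu> n / \<epsilon>) / \<nu> n"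
      unfolding degE using \<nu>[of n] by (intro divide_right_mono) auto
    then show ?thesis using \<nu>[of n] by (simp add: M_def norm_divide norm_mult mult.commute)
  qed
  define A where "A = (\<lambda>j n s w. poly ((pderiv ^^ j) (E n s)) w)"
  have dz: "M n s holomorphic_on ball z \<epsilon>"
    "\<And>w. w \<in> ball z \<epsilon> \<Longrightarrow> deriv (M n s) w = (A 2 n s w * A 0 n s w - (A 1 n s w)\<^sup>2) / (\<nu> n * (A 0 n s w)\<^sup>2)"
    "\<And>w. w \<in> ball z \<epsilon> \<Longrightarrow> deriv (deriv (M n s)) w = ((A 3 n s w * A 0 n s w - A 1 n s w * A 2 n s w) * A 0 n s w - 2 * A 1 n s w * (A 2 n s w * A 0 n s w - (A 1 n s w)\<^sup>2)) / (\<nu> n * (A 0 n s w) ^ 3)"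
    if s: "s \<in> ball t \<epsilon>" for n s
    using logarithmic_derivative_derivs[OF open_ball nz[OF _ s] \<nu>[of n]] unfolding M_def A_def by blast+
  have viz: "m s holomorphic_on ball z \<epsilon>" "(\<lambda>n. deriv (M n s) z) \<longlonglongrightarrow> deriv (m s) z" if s: "s \<in> ball t \<epsilon>" for s
    using vitali[of "ball z \<epsilon>" "\<lambda>n. M n s" "1 / \<epsilon>" "m s"] dz(1)[OF s] bdM[OF _ s] limM[OF _ s] zt' by blast+
  \<comment> \<open>Circles of radius \<open>\<epsilon> / 2\<close> lie where the bound
    \<open>1 / \<epsilon>\<close> holds, so derivatives of each order are bounded uniformly in
    \<open>n\<close>, and the viscous terms, divided by \<open>\<nu> n\<close>, tend to 0.\<close>
  have cauchy: "cmod ((deriv ^^ j) (M n s) z) \<le> fact j * (1 / \<epsilon>) / (\<epsilon> / 2) ^ j" if s: "s \<in> ball t \<epsilon>" for j n s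
  proof (rule Cauchy_inequality)
    have sub: "cball z (\<epsilon> / 2) \<subseteq> ball z \<epsilon>" using \<epsilon> by auto
    show "M n s holomorphic_on ball z (\<epsilon> / 2)" using dz(1)[OF s] by (rule holomorphic_on_subset) (use \<epsilon> in auto)
    show "continuous_on (cball z (\<epsilon> / 2)) (M n s)"
      using holomorphic_on_imp_continuous_on[OF dz(1)[OF s]] sub continuous_on_subset by blast
    show "0 < \<epsilon> / 2" using \<epsilon> by simp
    show "cmod (M n s x) \<le> 1 / \<epsilon>" if "cmod (z - x) = \<epsilon> / 2" for x
      using that \<epsilon> by (intro bdM s) (simp add: dist_norm)
  qed
  have \<nu>lim: "filterlim \<nu> at_top sequentially"
  proof (rule filterlim_at_top_mono[OF filterlim_real_sequentially])
    have "real n \<le> \<nu> n" for n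
    proof -
      have "1 * real n \<le> real (degree P) * real (n + N1)" using P by (intro mult_mono) auto
      then show ?thesis by (simp add: \<nu>_def)
    qed
    then show "\<forall>\<^sub>F n in sequentially. real n \<le> \<nu> n" by simp
  qed
  have vanish: "(\<lambda>n. f n / of_real (\<nu> n)) \<longlonglongrightarrow> 0" if "\<And>n. cmod (f n) \<le> B" for f and B :: real
  proof (rule Lim_null_comparison)
    show "\<forall>\<^sub>F n in sequentially. norm (f n / of_real (\<nu> n)) \<le> B / \<nu> n"
      using that \<nu> by (intro always_eventually allI) (simp add: norm_divide divide_right_mono less_imp_le)
    show "(\<lambda>n. B / \<nu> n) \<longlonglongrightarrow> 0" by (intro tendsto_divide_0[OF tendsto_const] filterlim_at_top_imp_at_infinity \<nu>lim)
  qed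
  have ht: "((\<lambda>s. A j n s z) has_field_derivative - A (j + 2) n s z / (2 * \<nu> n)) (at s)" for j n s
    using evolved_power_heat_equation[OF P, of "n + N1" j z s] by (simp add: A_def E_def \<nu>_def N1_def)
  have A0: "A 0 n s z \<noteq> 0" if "s \<in> ball t \<epsilon>" for n s using nz[OF zt'(1) that] by (simp add: A_def)
  have Mz: "M n s z = A 1 n s z / (\<nu> n * A 0 n s z)" for n s by (simp add: M_def A_def)
  have Ez: "poly (E n s) z = A 0 n s z" for n s by (simp add: A_def)
  \<comment> \<open>The heat equation puts \<open>A 2\<close> into the numerator, and
    \<open>A 2 / (\<nu>\<^sup>2 * A 0)\<close> is the square of \<open>M\<close> plus its
    \<open>z\<close>-derivative over \<open>\<nu>\<close>.\<close>
  have dq: "deriv (\<lambda>s. poly (E n s) z) s / (\<nu> n * poly (E n s) z) = - ((M n s z)\<^sup>2 + deriv (M n s) z / \<nu> n) / 2"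
    if s: "s \<in> ball t \<epsilon>" for n s
  proof -
    have "deriv (\<lambda>s. poly (E n s) z) s = - A 2 n s z / (2 * \<nu> n)"
      unfolding Ez using ht[of 0 n s] by (intro DERIV_imp_deriv) (simp add: numeral_2_eq_2)
    then show ?thesis unfolding Mz dz(2)[OF s zt'(1)] Ez using A0[OF s, of n] \<nu>[of n]
      by (simp add: divide_simps power2_eq_square) (simp add: algebra_simps)
  qed
  \<comment> \<open>The viscous Burgers equation, which is formally the \<open>z\<close>-derivative
    of \<open>dq\<close>; it is derived from the heat equations of \<open>A 0\<close> and
    \<open>A 1\<close>.\<close>
  have dM: "((\<lambda>s. M n s z) has_field_derivative - (M n s z * deriv (M n s) z) - deriv (deriv (M n s)) z / \<nu> n / 2) (at s)"
    if s: "s \<in> ball t \<epsilon>" for n s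
  proof -
    have "((\<lambda>s. A 1 n s z / (\<nu> n * A 0 n s z)) has_field_derivative
       ((- A 3 n s z / (2 * \<nu> n)) * (\<nu> n * A 0 n s z) - A 1 n s z * (\<nu> n * (- A 2 n s z / (2 * \<nu> n)))) / ((\<nu> n * A 0 n s z) * (\<nu> n * A 0 n s z))) (at s)"
      using ht[of 0 n s] ht[of 1 n s] A0[OF s, of n] \<nu>[of n]
      by (intro DERIV_divide DERIV_cmult) (auto simp: numeral_2_eq_2 numeral_3_eq_3)
    also have "((- A 3 n s z / (2 * \<nu> n)) * (\<nu> n * A 0 n s z) - A 1 n s z * (\<nu> n * (- A 2 n s z / (2 * \<nu> n)))) / ((\<nu> n * A 0 n s z) * (\<nu> n * A 0 n s z))
       = - (M n s z * deriv (M n s) z) - deriv (deriv (M n s)) z / \<nu> n / 2"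
    proof -
      define v where "v = complex_of_real (\<nu> n)"
      define a b c d where "a = A 0 n s z" and "b = A 1 n s z" and "c = A 2 n s z" and "d = A 3 n s z"
      have ne: "v \<noteq> 0" "a \<noteq> 0" using A0[OF s, of n] \<nu>[of n] by (auto simp: v_def a_def)
      show ?thesis
        unfolding Mz dz(2)[OF s zt'(1)] dz(3)[OF s zt'(1)] of_real_mult of_real_numeral v_def[symmetric] a_def[symmetric] b_def[symmetric] c_def[symmetric] d_def[symmetric]
        using ne by (simp add: divide_simps power2_eq_square power3_eq_cube) (simp add: algebra_simps)
    qed
    finally show ?thesis unfolding Mz .
  qed
  obtain H where H: "\<And>w. w \<in> ball z \<epsilon> \<Longrightarrow> (H has_field_derivative m t w) (at w)" "\<And>w. w \<in> ball z \<epsilon> \<Longrightarrow> log_potential (\<mu> t) w = Re (H w)"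
  proof (rule log_modulus_limit[where c = z and \<rho> = \<epsilon> and \<nu> = \<nu> and q = "\<lambda>n. poly (E n t)" and B = "1 / \<epsilon>" and g = "m t" and U = "log_potential (\<mu> t)"])
    have dp: "deriv (poly (E n t)) w = poly (pderiv (E n t)) w" for n w by (rule DERIV_imp_deriv[OF poly_DERIV])
    show "cmod (deriv (poly (E n t)) w / (\<nu> n * poly (E n t) w)) \<le> 1 / \<epsilon>" if "w \<in> ball z \<epsilon>" for n w
      unfolding dp using bdM[OF that zt'(2)] by (simp add: M_def)
    show "(\<lambda>n. deriv (poly (E n t)) w / (\<nu> n * poly (E n t) w)) \<longlonglongrightarrow> m t w" if "w \<in> ball z \<epsilon>" for w
      unfolding dp using limM[OF that zt'(2)] by (simp add: M_def)
    show "poly (E n t) holomorphic_on ball z \<epsilon>" for n by (intro holomorphic_intros)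
  qed (use \<epsilon> \<nu> nz[OF _ zt'(2)] limL[OF _ zt'(2)] that in auto)
  obtain K where K: "\<And>s. s \<in> ball t \<epsilon> \<Longrightarrow> (K has_field_derivative - (m s z)\<^sup>2 / 2) (at s)" "\<And>s. s \<in> ball t \<epsilon> \<Longrightarrow> log_potential (\<mu> s) z = Re (K s)"
  proof (rule log_modulus_limit[where c = t and \<rho> = \<epsilon> and \<nu> = \<nu> and q = "\<lambda>n s. poly (E n s) z" and g = "\<lambda>s. - (m s z)\<^sup>2 / 2" and U = "\<lambda>s. log_potential (\<mu> s) z"])
    show "(\<lambda>s. poly (E n s) z) holomorphic_on ball t \<epsilon>" for n
      unfolding Ez using ht[of 0] by (auto simp: holomorphic_on_open)
    show "(\<lambda>n. deriv (\<lambda>s. poly (E n s) z) s / (\<nu> n * poly (E n s) z)) \<longlonglongrightarrow> - (m s z)\<^sup>2 / 2" if s: "s \<in> ball t \<epsilon>" for s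
    proof -
      have "(\<lambda>n. - ((M n s z)\<^sup>2 + deriv (M n s) z / \<nu> n) / 2) \<longlonglongrightarrow> - ((m s z)\<^sup>2 + 0) / 2"
        using cauchy[OF s, of 1] by (intro tendsto_intros limM zt' s vanish) auto
      then show ?thesis unfolding dq[OF s] by simp
    qed
    \<comment> \<open>The summands are the square of the bound on \<open>M\<close> and Cauchy's
      bound for its first derivative, divided by the lower bound \<open>degree P\<close> of
      \<open>\<nu> n\<close>.\<close>
    show "cmod (deriv (\<lambda>s. poly (E n s) z) s / (\<nu> n * poly (E n s) z)) \<le> ((1 / \<epsilon>)\<^sup>2 + (1 / \<epsilon>) / (\<epsilon> / 2) / degree P) / 2"
      if s: "s \<in> ball t \<epsilon>" for n s
    proof -
      have "real (degree P) * 1 \<le> \<nu> n" unfolding \<nu>_def by (intro mult_left_mono) (auto simp: N1_def)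
      then have v: "real (degree P) \<le> \<nu> n" by simp
      have "cmod (deriv (M n s) z) / \<nu> n \<le> (1 / \<epsilon>) / (\<epsilon> / 2) / degree P"
        using cauchy[OF s, of 1 n] v P \<epsilon> by (intro frac_le) auto
      moreover have "(cmod (M n s z))\<^sup>2 \<le> (1 / \<epsilon>)\<^sup>2" by (intro power_mono bdM zt' s) auto
      moreover have "cmod ((M n s z)\<^sup>2 + deriv (M n s) z / \<nu> n) \<le> (cmod (M n s z))\<^sup>2 + cmod (deriv (M n s) z) / \<nu> n"
        by (rule order_trans[OF norm_triangle_ineq]) (use \<nu>[of n] in \<open>simp add: norm_power norm_divide\<close>)
      ultimately have "cmod ((M n s z)\<^sup>2 + deriv (M n s) z / \<nu> n) \<le> (1 / \<epsilon>)\<^sup>2 + (1 / \<epsilon>) / (\<epsilon> / 2) / degree P" by linarith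
      then show ?thesis unfolding dq[OF s] norm_divide norm_minus_cancel by (simp add: divide_right_mono)
    qed
  qed (use \<epsilon> \<nu> nz[OF zt'(1)] limL[OF zt'(1)] that in auto)
  have hM: "(\<lambda>s. M n s z) holomorphic_on ball t \<epsilon>" for n unfolding holomorphic_on_open[OF open_ball] using dM by blast
  have vit: "(\<lambda>s. m s z) holomorphic_on ball t \<epsilon>" "(\<lambda>n. deriv (\<lambda>s. M n s z) t) \<longlonglongrightarrow> deriv (\<lambda>s. m s z) t"
    using vitali[of "ball t \<epsilon>" "\<lambda>n s. M n s z" "1 / \<epsilon>" "\<lambda>s. m s z"] hM bdM[OF zt'(1)] limM[OF zt'(1)] zt' by blast+
  have "(\<lambda>n. - (M n t z * deriv (M n t) z) - deriv (deriv (M n t)) z / \<nu> n / 2) \<longlonglongrightarrow> - (m t z * deriv (m t) z) - 0 / 2"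
  proof (intro tendsto_intros limM zt' viz vanish)
    show "cmod (deriv (deriv (M n t)) z) \<le> fact 2 * (1 / \<epsilon>) / (\<epsilon> / 2) ^ 2" for n
      using cauchy[OF zt'(2), of 2 n] by (simp add: numeral_2_eq_2)
  qed auto
  then have "(\<lambda>n. deriv (\<lambda>s. M n s z) t) \<longlonglongrightarrow> - (m t z * deriv (m t) z)"
    using DERIV_imp_deriv[OF dM[OF zt'(2)]] by simp
  then have dt: "deriv (\<lambda>s. m s z) t = - (m t z * deriv (m t) z)" using vit(2) LIMSEQ_unique by blast
  show ?thesis
  proof (rule that[OF \<epsilon> H K])
    show "(m t has_field_derivative deriv (m t) z) (at z)"
      using holomorphic_derivI[OF viz(1)[OF zt'(2)] open_ball zt'(1)] by simp
    show "((\<lambda>s. m s z) has_field_derivative - (m t z * deriv (m t) z)) (at t)"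
      using holomorphic_derivI[OF vit(1) open_ball zt'(2)] dt by simp
    show "integrable (\<mu> t) (\<lambda>\<xi>. ln (cmod (z - \<xi>)))" by (rule wl(1)[OF zeros[OF zt']])
    show "integrable (\<mu> t) (\<lambda>\<xi>. 1 / (z - \<xi>))" by (rule wl(2)[OF zeros[OF zt']])
  qed
qed

theorem theorem2p9:
  fixes d :: nat and lam :: "nat \<Rightarrow> complex" and a :: "nat \<Rightarrow> nat"
    and P :: "complex poly" and \<mu> :: "complex \<Rightarrow> complex measure"
  assumes d: "d \<ge> 1"
    and distinct: "inj_on lam {1..d}"
    and mult: "\<And>j. j \<in> {1..d} \<Longrightarrow> a j \<ge> 1"
    and P: "P = (\<Prod>j=1..d. [:- lam j, 1:] ^ a j)"
    and mu_borel: "\<And>t. sets (\<mu> t) = sets borel"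
    and mu_prob: "\<And>t. prob_space (\<mu> t)"
    and mu_compact: "\<And>t. compactly_supported (\<mu> t)"
    and mu_limit: "\<And>t. weakly_converges (\<lambda>n. zero_measure P n t) (\<mu> t)"
  defines "U \<equiv> \<lambda>t z. complex_of_real (log_potential (\<mu> t) z)"
    and "m \<equiv> \<lambda>t z. stieltjes (\<mu> t) z"
  shows
    "(\<forall>(z, t) \<in> pde_domain P.
        integrable (\<mu> t) (\<lambda>\<xi>. ln (cmod (z - \<xi>))) \<and>
        (\<lambda>s. U s z) differentiable (at t) \<and>
        (\<lambda>w. U t w) differentiable (at z) \<and>
        wirtinger (\<lambda>s. U s z) t = - (wirtinger (\<lambda>w. U t w) z)\<^sup>2)
   \<and> (\<forall>(z, t) \<in> pde_domain P.
        integrable (\<mu> t) (\<lambda>y. 1 / (z - y)) \<and>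
        (\<lambda>s. m s z) differentiable (at t) \<and>
        (\<lambda>w. m t w) differentiable (at z) \<and>
        wirtinger (\<lambda>s. m s z) t = - (1 / 2) * wirtinger (\<lambda>w. (m t w)\<^sup>2) z \<and>
        - (1 / 2) * wirtinger (\<lambda>w. (m t w)\<^sup>2) z = - m t z * wirtinger (\<lambda>w. m t w) z \<and>
        wirtinger_bar (\<lambda>s. m s z) t = - (1 / 2) * wirtinger (\<lambda>w. cnj ((m t w)\<^sup>2)) z \<and>
        - (1 / 2) * wirtinger (\<lambda>w. cnj ((m t w)\<^sup>2)) z
          = - cnj (m t z) * wirtinger (\<lambda>w. cnj (m t w)) z)"
proof -
  have monic: "lead_coeff P = 1" unfolding P by (simp add: lead_coeff_prod lead_coeff_power)
  have "degree P = (\<Sum>j=1..d. a j)"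
    unfolding P by (subst degree_prod_sum_eq) (auto simp: degree_power_eq)
  also have "\<dots> > 0"
  proof -
    have "a 1 \<le> (\<Sum>j=1..d. a j)" using d by (intro member_le_sum) auto
    then show ?thesis using mult[of 1] d by simp
  qed
  finally have deg: "degree P > 0" .
  have "integrable (\<mu> t) (\<lambda>\<xi>. ln (cmod (z - \<xi>))) \<and>
        (\<lambda>s. U s z) differentiable (at t) \<and>
        (\<lambda>w. U t w) differentiable (at z) \<and>
        wirtinger (\<lambda>s. U s z) t = - (wirtinger (\<lambda>w. U t w) z)\<^sup>2 \<and>
        integrable (\<mu> t) (\<lambda>y. 1 / (z - y)) \<and>
        (\<lambda>s. m s z) differentiable (at t) \<and>
        (\<lambda>w. m t w) differentiable (at z) \<and>
        wirtinger (\<lambda>s. m s z) t = - (1 / 2) * wirtinger (\<lambda>w. (m t w)\<^sup>2) z \<and>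
        - (1 / 2) * wirtinger (\<lambda>w. (m t w)\<^sup>2) z = - m t z * wirtinger (\<lambda>w. m t w) z \<and>
        wirtinger_bar (\<lambda>s. m s z) t = - (1 / 2) * wirtinger (\<lambda>w. cnj ((m t w)\<^sup>2)) z \<and>
        - (1 / 2) * wirtinger (\<lambda>w. cnj ((m t w)\<^sup>2)) z
          = - cnj (m t z) * wirtinger (\<lambda>w. cnj (m t w)) z"
    if zt: "(z, t) \<in> pde_domain P" for z t
  proof -
    obtain \<epsilon> H K where \<epsilon>: "\<epsilon> > 0"
      and H: "\<And>w. w \<in> ball z \<epsilon> \<Longrightarrow> (H has_field_derivative stieltjes (\<mu> t) w) (at w)" "\<And>w. w \<in> ball z \<epsilon> \<Longrightarrow> log_potential (\<mu> t) w = Re (H w)"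
      and K: "\<And>s. s \<in> ball t \<epsilon> \<Longrightarrow> (K has_field_derivative - (stieltjes (\<mu> s) z)\<^sup>2 / 2) (at s)" "\<And>s. s \<in> ball t \<epsilon> \<Longrightarrow> log_potential (\<mu> s) z = Re (K s)"
      and mz0: "(stieltjes (\<mu> t) has_field_derivative deriv (stieltjes (\<mu> t)) z) (at z)"
      and mt0: "((\<lambda>s. stieltjes (\<mu> s) z) has_field_derivative - (stieltjes (\<mu> t) z * deriv (stieltjes (\<mu> t)) z)) (at t)"
      and int: "integrable (\<mu> t) (\<lambda>\<xi>. ln (cmod (z - \<xi>)))" "integrable (\<mu> t) (\<lambda>\<xi>. 1 / (z - \<xi>))"
      by (rule local_structure_pde_domain[OF monic deg mu_borel mu_prob mu_limit zt]) (rule that)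
    define D where "D = deriv (stieltjes (\<mu> t)) z"
    have mz: "((\<lambda>w. m t w) has_field_derivative D) (at z)" using mz0 by (simp add: m_def D_def)
    have mt: "((\<lambda>s. m s z) has_field_derivative - (m t z * D)) (at t)" using mt0 by (simp add: m_def D_def)
    have m2: "((\<lambda>w. (m t w)\<^sup>2) has_field_derivative 2 * m t z * D) (at z)"
      using mz by (auto intro!: derivative_eq_intros)
    have zt': "z \<in> ball z \<epsilon>" "t \<in> ball t \<epsilon>" using \<epsilon> by auto
    note Uz = wirtinger_Re_holomorphic[OF open_ball zt'(1) H(1)[OF zt'(1)], of "U t"]
    note Ut = wirtinger_Re_holomorphic[OF open_ball zt'(2) K(1)[OF zt'(2)], of "\<lambda>s. U s z"]
    have U: "(\<lambda>w. U t w) differentiable (at z)" "wirtinger (\<lambda>w. U t w) z = m t z / 2"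
      "(\<lambda>s. U s z) differentiable (at t)" "wirtinger (\<lambda>s. U s z) t = - (m t z)\<^sup>2 / 2 / 2"
      using Uz Ut H(2) K(2) by (auto simp: U_def m_def)
    have diff: "(\<lambda>s. m s z) differentiable (at t)" "(\<lambda>w. m t w) differentiable (at z)"
      using mt mz by (auto simp: differentiable_def has_field_derivative_def)
    \<comment> \<open>The halves from the real parts match: both sides are
      \<open>- (m t z)\<^sup>2 / 4\<close>.\<close>
    have "wirtinger (\<lambda>s. U s z) t = - (wirtinger (\<lambda>w. U t w) z)\<^sup>2"
      unfolding U(2,4) by (simp add: power_divide)
    then show ?thesis
      using int U(1,3) diff by (simp add: wirtinger_holomorphic[OF mz] wirtinger_holomorphic[OF mt]
          wirtinger_holomorphic[OF m2] del: complex_cnj_power)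
  qed
  then show ?thesis by blast
qed

end
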